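(* Let $\Gamma$ be a finite group and let $H\subset H'$ be subgroups of $\Gamma$ with $H$ normal in $H'$. Then $S_{H,H'}\in\mathbf C[M(\Gamma)]$ is bipositive. Hence, if $W$ is an irreducible Weyl group, $c$ is a family of $W$, $\Gamma=\mathcal G_c$, and $\mathcal E$ is a new representation in $\mathcal R_c$, then $\underline{\mathcal E}\in\mathbf C[M(\Gamma)]$ is bipositive.
   Context: **The set $M(\Gamma)$ and the elements $S_{H,H'}$.** For a finite group $\Gamma$, $M(\Gamma)$ is the set of pairs $(x,\rho)$, $x\in\Gamma$, $\rho$ an irreducible complex representation (up to isomorphism) of the centralizer $Z(x)$, modulo $\Gamma$-conjugacy. $\mathbf C[M(\Gamma)]$ is the $\mathbf C$-vector space with basis $M(\Gamma)$. Let $H\subset H'$ be subgroups of $\Gamma$ with $H$ normal in $H'$. For $x\in\Gamma$ let $(\Gamma/H)^x$ be the fixed point set of left translation by $x$ on $\Gamma/H$; $Z(x)$ acts on it by left translation. The obvious map $\Gamma/H\to\Gamma/H'$ restricts to $(\Gamma/H)^x\to(\Gamma/H')^x$ and induces a $Z(x)$-linear map $\mathbf C[(\Gamma/H)^x]\to\mathbf C[(\Gamma/H')^x]$ of permutation representations. Let $N_{H,H',x,\rho}$ be the multiplicity of $\rho$ in the image of this map, and $$S_{H,H'}=\sum_{(x,\rho)\in M(\Gamma)}N_{H,H',x,\rho}\,(x,\rho)\in\mathbf C[M(\Gamma)].$$ **Bipositivity.** Define $\{,\}:M(\Gamma)\times M(\Gamma)\to\mathbf C$ by $$\{(x,\rho),(x',\rho')\}=|Z(x)|^{-1}|Z(x')|^{-1}\sum_{g\in\Gamma;\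 x\,gx'g^{-1}=gx'g^{-1}\,x}\overline{\mathrm{tr}(g^{-1}xg,\rho')}\ \mathrm{tr}(gx'g^{-1},\rho)$$ (bar = complex conjugation), and let $A:\mathbf C[M(\Gamma)]\to\mathbf C[M(\Gamma)]$ (non-abelian Fourier transform) be the linear map with $A(x,\rho)=\sum_{(x',\rho')\in M(\Gamma)}\{(x,\rho),(x',\rho')\}(x',\rho')$. Let $M(\Gamma)_{\ge0}$ be the set of elements of $\mathbf C[M(\Gamma)]$ all of whose coefficients in the basis $M(\Gamma)$ are real and $\ge0$. An element $f\in\mathbf C[M(\Gamma)]$ is bipositive if $f\in M(\Gamma)_{\ge0}$ and $A(f)\in M(\Gamma)_{\ge0}$. **Families, constructible representations.** $\mathrm{Irr}_W$ is the set of isomorphism classes of irreducible representations of $W$ over $\mathbf Q$. It is partitioned into families, in bijection with the two-sided (Kazhdan–Lusztig) cells: the family of a two-sided cell consists of the irreducible constituents of the representation of $W$ carried by that cell (at $q=1$). For a family $c$, $\mathcal R_c$ is the category of finite dimensional representations of $W$ over $\mathbf Q$ that are direct sums of irreducibles in $c$. The constructible representations in $\mathcal R_c$ are those carried by the left cells contained in the two-sided cell of $c$. The special representation $E_c\in c$ is the unique $E\in c$ for which the smallest degree in which $E$ occurs in the coinvariant algebra of $W$ is minimal among elements of $c$. **The group $\mathcal G_c$ and the imbedding $c\to M(\mathcal G_c)$.** Following Lusztig, to $c$ is attached a finite group $\mathcal G_c$ and an imbedding $c\to M(\mathcal G_c)$ with image $M_0(\mathcal G_c)$; $E_{x,\rho}\in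 c$ denotes the element corresponding to $(x,\rho)\in M_0(\mathcal G_c)$. For $\mathcal E\in\mathcal R_c$ put $\underline{\mathcal E}=\sum_{(x,\rho)\in M_0(\mathcal G_c)}(E_{x,\rho}:\mathcal E)\,(x,\rho)\in\mathbf C[M(\mathcal G_c)]$, where $(E_{x,\rho}:\mathcal E)$ is the multiplicity of $E_{x,\rho}$ in $\mathcal E$. The group and imbedding are as follows. *$|c|=1$* (always so in type $A$): $\mathcal G_c=\{1\}$ and the element of $c$ maps to $(1,1)$. *Types $B_n,C_n$.* $\mathrm{Irr}_W$ is indexed by ordered pairs of partitions $(\xi;\eta)$ of total size $n$ (trivial representation: $((n);\emptyset)$; $(\emptyset;(n))$ is the character trivial on the permutations in the hyperoctahedral group and $-1$ on each single sign change). Writing $\xi$ with $m+1$ parts and $\eta$ with $m$ parts in increasing order (allowing zeros), the symbol is $(\lambda_1<\dots<\lambda_{m+1};\mu_1<\dots<\mu_m)$ with $\lambda_i=\xi_i+i-1$, $\mu_i=\eta_i+i-1$. For $m$ fixed and large, two irreducibles lie in the same family iff their symbols have the same multiset of entries. Let $z_0<z_1<\dots<z_{2d}$ be the entries that occur exactly once in that multiset for $c$, and put $D=2d$. For $E\in c$ let $M_E$ be the set of those $z_i$ lying in the second row of its symbol, $M_0=\{z_1,z_3,\dots,z_{2d-1}\}$, and $x_E=M_E\,\triangle\,M_0$ (symmetric difference), an even subset of $\{z_0,\dots,z_D\}$. *Type $D_n$.* $\mathrm{Irr}_W$ is indexed by unordered pairs $\{\xi,\eta\}$ of partitions of total size $n$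 (two representations if $\xi=\eta$; each of these forms a family with one element). Writing both with $m$ parts, form the symbol with rows $\xi_i+i-1$ and $\eta_i+i-1$, $1\le i\le m$; for $m$ fixed and large, two irreducibles with $\xi\neq\eta$ lie in the same family iff their symbols have the same multiset of entries. Let $z_0<\dots<z_{2d-1}$ be the entries occurring exactly once; put $D=2d-2$. For $E\in c$ let $M_E$ be the set of those $z_i$ in the row of the symbol of $E$ that does not contain $z_{2d-1}$, $M_0=\{z_0,z_2,\dots,z_{2d-2}\}$ and $x_E=M_E\,\triangle\,M_0$, an even subset of $\{z_0,\dots,z_D\}$. In types $B,C,D$ let $V$ be the $\mathbf F_2$-vector space of even subsets of $\{z_0,\dots,z_D\}$ (addition is symmetric difference), with basis $e_i=\{z_{i-1},z_i\}$, $1\le i\le D$, and symplectic form $(e_i,e_j)=1$ if $i-j=\pm1$, $0$ otherwise. For $\delta\in\{0,1\}$ let $V^\delta$ be the span of the $e_i$ with $i\equiv\delta\bmod 2$. Then $\mathcal G_c=V^\delta$ for $\delta\in\{0,1\}$ (either value may be taken); $M(\mathcal G_c)$ is identified with $V=V^\delta\oplus V^{1-\delta}$ by letting $y\in V^{1-\delta}$ correspond to the character $x\mapsto(-1)^{(x,y)}$ of $V^\delta$, and the imbedding is $E\mapsto x_E$. *Exceptional types.* Then $|c|\in\{1,2,3,4,5,11,17\}$. Let $S_N$ be the symmetric group; $1$ denotes also the trivial representation. In symmetric groups, $g_2$ is a transposition, $g_2'$ a product of two disjoint transpositions, $g_3,g_4,g_5$ are a $3$-, $4$-, $5$-cycle,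 $g_6$ is the product of a $3$-cycle with a disjoint transposition. $E_c$ always maps to $(1,1)$. - $|c|=2$ (types $E_7,E_8$): $\mathcal G_c=S_2$; the non-special element maps to $(1,\epsilon)$, $\epsilon$ = sign. - $|c|=3$: $\mathcal G_c=S_2$; the two non-special elements map to $(g_2,1)$ and $(1,\epsilon)$ (which is which does not matter for the statement). - $|c|=4$ (type $G_2$): $\mathcal G_c=S_3$; the non-special 2-dimensional element maps to $(g_2,1)$, the two 1-dimensional elements map to $(1,r)$ and $(g_3,1)$ ($r$ = 2-dimensional irreducible representation of $S_3$; the two choices are interchanged by the graph automorphism and the choice does not matter). - $|c|=5$ (types $E_6,E_7,E_8$): $\mathcal G_c=S_3$; the constructible representations in $\mathcal R_c$ have the form $E_c+E_1+E_2$, $E_c+E_2+E_3$, $E_c+2E_1+E_4$ with $c=\{E_c,E_1,E_2,E_3,E_4\}$, and $E_1,E_2,E_3,E_4$ map to $(1,r),(g_2,1),(g_3,1),(1,\epsilon)$ ($\epsilon$ = sign). - $|c|=11$ (type $F_4$): $\mathcal G_c=S_4$. In Kondo's notation the imbedding is $12_1\mapsto(1,1)$, $9_3\mapsto(1,[31])$, $6_2\mapsto(1,[22])$, $1_3\mapsto(1,[211])$, $16_1\mapsto(g_2,1)$, $9_2\mapsto(g_2',1)$, $4_4\mapsto(g_2,\epsilon'')$, $6_1\mapsto(g_3,1)$, $4_3\mapsto(g_4,1)$, $4_1\mapsto(g_2',\epsilon'')$, $1_2\mapsto(g_2',\epsilon')$. Here $[\cdot]$ is the irreducible representation of the symmetric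 group attached to a partition ($[4]$ trivial); for $g_2=(12)$, $\epsilon''$ is the character of $Z(g_2)=\langle(12),(34)\rangle$ that is $1$ on $(12)$ and $-1$ on $(34)$; for $g_2'=(12)(34)$, $\epsilon''$ is the character of the dihedral group $Z(g_2')$ of order 8 with kernel $\langle(12),(34)\rangle$ and $\epsilon'$ the character with kernel the normal Klein four-subgroup of $S_4$. - $|c|=17$ (type $E_8$): $\mathcal G_c=S_5$. Elements of $c$ are determined by their dimension, and the imbedding is $4480\mapsto(1,1)$, $5670\mapsto(1,[41])$, $4536\mapsto(1,[32])$, $1680\mapsto(1,[311])$, $1400\mapsto(1,[221])$, $70\mapsto(1,[2111])$, $7168\mapsto(g_2,1)$, $5600\mapsto(g_2,r)$, $448\mapsto(g_2,\mathrm{sgn})$, $3150\mapsto(g_3,1)$, $1134\mapsto(g_3,\epsilon)$, $4200\mapsto(g_2',1)$, $2688\mapsto(g_2',\epsilon'')$, $168\mapsto(g_2',\epsilon')$, $2016\mapsto(g_6,1)$, $1344\mapsto(g_4,1)$, $420\mapsto(g_5,1)$. Here $Z(g_2)=\langle g_2\rangle\times S_3$ and $r,\mathrm{sgn}$ are the 2-dimensional and the sign representation of $S_3$, trivial on $g_2$; $\epsilon$ is the order-2 character of $Z(g_3)$ (cyclic of order 6) trivial on $g_3$; $\epsilon',\epsilon''$ are as for $F_4$, $Z(g_2')$ being the same dihedral group of order 8. **New representations.** There is a $\mathcal G_c$-stable set $\Theta_c$ of pairs $(H,H')$ of subgroups of $\mathcal G_c$, $H$ normal in $H'$, described below, such that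 for every $(H,H')\in\Theta_c$ there is a unique (up to isomorphism) $E_{H,H'}\in\mathcal R_c$ with $\underline{E_{H,H'}}=S_{H,H'}$. The new representations in $\mathcal R_c$ are the representations isomorphic to $E_{H,H'}$ for some $(H,H')\in\Theta_c$. *If $|c|=1$*: $\Theta_c=\{(\{1\},\{1\})\}$. *Types $B,C,D$*: define a collection $\mathcal F(V)$ of subspaces of $V$ by induction on the even number $D$. If $D=0$, $\mathcal F(V)=\{0\}$. If $D\ge2$, let $V'$ be the analogous space with basis $e'_1,\dots,e'_{D-2}$, and for $1\le i\le D$ let $T_i:V'\to V$ be the linear map with $T_i(e'_k)=e_k$ if $k\le i-2$, $T_i(e'_k)=e_{k+2}$ if $k\ge i$, $T_i(e'_{i-1})=e_{i-1}+e_i+e_{i+1}$ if $1<i<D$; a subspace $X\subset V$ is in $\mathcal F(V)$ if $X=0$ or $X=T_i(X')\oplus\mathbf F_2e_i$ for some $i\in\{1,\dots,D\}$ and some $X'\in\mathcal F(V')$. For a subspace $\mathcal L'\subset V^\delta$ put $\mathcal L'^{\,!}=\{y\in V^{1-\delta}:(y,z)=0\ \forall z\in\mathcal L'\}$. Then $\Theta_c$ is the set of pairs $(\mathcal L,\mathcal L')$ of subspaces of $V^\delta=\mathcal G_c$ with $\mathcal L\oplus\mathcal L'^{\,!}\in\mathcal F(V)$ (this forces $\mathcal L\subset\mathcal L'$). *Exceptional types, $|c|>1$*: let $\mathcal S_{a_1a_2\dots}$ be the set of Young subgroups of $S_N$ of type $a_1a_2\dots$ (conjugates of the stabilizer of the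 partition of $\{1,\dots,N\}$ into consecutive blocks of sizes $a_1,a_2,\dots$), and for $N=4,5$ let $\tilde{\mathcal S}_N$ be the set of conjugates of the dihedral group of order 8 consisting of permutations fixing every element $>4$ and commuting on $\{1,2,3,4\}$ with $(14)(23)$. Let $\hat{\mathfrak F}_c$ consist of $\{1\}$, $\mathcal G_c$ and: nothing more if $\mathcal G_c=S_2$; the groups in $\mathcal S_{21}$ if $\mathcal G_c=S_3$; in $\mathcal S_{31},\mathcal S_{22},\mathcal S_{211},\tilde{\mathcal S}_4$ if $\mathcal G_c=S_4$; in $\mathcal S_{41},\mathcal S_{32},\mathcal S_{311},\mathcal S_{221},\mathcal S_{2111},\tilde{\mathcal S}_5$ if $\mathcal G_c=S_5$. Then $\Theta_c$ is the set of all pairs $(H,H')$ with $H,H'\in\hat{\mathfrak F}_c$, $H$ normal in $H'$, except that $(\{1\},\{1\})$ is removed when $|c|\in\{2,4,11,17\}$ and the pairs $(\{1\},\tilde H)$ with $\tilde H\in\tilde{\mathcal S}_4$ (resp. $\tilde{\mathcal S}_5$) are removed when $\mathcal G_c=S_4$ (resp. $S_5$). *)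

theory Defs
  imports
    Complex_Main
    "Jordan_Normal_Form.Matrix"
    "HOL-Algebra.Sym_Groups"
    "HOL-Algebra.Generated_Groups"
    "HOL-Algebra.Left_Coset"
    "HOL-Library.Poly_Mapping"
    "HOL-Library.Nonpos_Ints"
begin

section \<open>Finite-dimensional representations\<close>

text \<open>Representations are matrix valued; only the values on the carrier of the group matter.\<close>

definition tr :: "'k::comm_monoid_add mat \<Rightarrow> 'k" where
  "tr A = (\<Sum>i<dim_row A. A $$ (i, i))"

definition rep_dim :: "('g, 'm) monoid_scheme \<Rightarrow> ('g \<Rightarrow> 'k::field mat) \<Rightarrow> nat" where
  "rep_dim G \<rho> = dim_row (\<rho> \<one>\<^bsub>G\<^esub>)"

definition is_rep :: "('g, 'm) monoid_scheme \<Rightarrow> ('g \<Rightarrow> 'k::field mat) \<Rightarrow> bool" where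
  "is_rep G \<rho> \<longleftrightarrow>
     (\<forall>g\<in>carrier G. \<rho> g \<in> carrier_mat (rep_dim G \<rho>) (rep_dim G \<rho>)) \<and>
     \<rho> \<one>\<^bsub>G\<^esub> = 1\<^sub>m (rep_dim G \<rho>) \<and>
     (\<forall>g\<in>carrier G. \<forall>h\<in>carrier G. \<rho> (g \<otimes>\<^bsub>G\<^esub> h) = \<rho> g * \<rho> h)"

definition lin_subspace :: "nat \<Rightarrow> 'k::field vec set \<Rightarrow> bool" where
  "lin_subspace n U \<longleftrightarrow> U \<subseteq> carrier_vec n \<and> 0\<^sub>v n \<in> U \<and>
     (\<forall>v\<in>U. \<forall>w\<in>U. v + w \<in> U) \<and> (\<forall>a. \<forall>v\<in>U. a \<cdot>\<^sub>v v \<in> U)"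

definition irreducible_rep :: "('g, 'm) monoid_scheme \<Rightarrow> ('g \<Rightarrow> 'k::field mat) \<Rightarrow> bool" where
  "irreducible_rep G \<rho> \<longleftrightarrow> is_rep G \<rho> \<and> 0 < rep_dim G \<rho> \<and>
     (\<forall>U. lin_subspace (rep_dim G \<rho>) U \<and> (\<forall>g\<in>carrier G. \<forall>v\<in>U. \<rho> g *\<^sub>v v \<in> U) \<longrightarrow>
          U = {0\<^sub>v (rep_dim G \<rho>)} \<or> U = carrier_vec (rep_dim G \<rho>))"

definition rep_iso ::
  "('g, 'm) monoid_scheme \<Rightarrow> ('g \<Rightarrow> 'k::field mat) \<Rightarrow> ('g \<Rightarrow> 'k mat) \<Rightarrow> bool" where
  "rep_iso G \<rho> \<sigma> \<longleftrightarrow> is_rep G \<rho> \<and> is_rep G \<sigma> \<and> rep_dim G \<rho> = rep_dim G \<sigma> \<and>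
     (\<exists>P\<in>carrier_mat (rep_dim G \<rho>) (rep_dim G \<rho>). invertible_mat P \<and>
        (\<forall>g\<in>carrier G. P * \<rho> g = \<sigma> g * P))"

definition iso_class ::
  "('g, 'm) monoid_scheme \<Rightarrow> ('g \<Rightarrow> 'k::field mat) \<Rightarrow> ('g \<Rightarrow> 'k mat) set" where
  "iso_class G \<rho> = {\<sigma>. rep_iso G \<rho> \<sigma>}"

definition Irr :: "('g, 'm) monoid_scheme \<Rightarrow> ('g \<Rightarrow> 'k::field mat) set set" where
  "Irr G = iso_class G ` {\<rho>. irreducible_rep G \<rho>}"

definition dsum :: "('g \<Rightarrow> 'k::field mat) list \<Rightarrow> 'g \<Rightarrow> 'k mat" where
  "dsum \<rho>s = (\<lambda>g. diag_block_mat (map (\<lambda>\<rho>. \<rho> g) \<rho>s))"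

definition decomposes ::
  "('g, 'm) monoid_scheme \<Rightarrow> ('g \<Rightarrow> 'k::field mat) list \<Rightarrow> ('g \<Rightarrow> 'k mat) \<Rightarrow> bool" where
  "decomposes G \<rho>s \<sigma> \<longleftrightarrow>
     (\<forall>\<rho>\<in>set \<rho>s. irreducible_rep G \<rho>) \<and> rep_iso G (dsum \<rho>s) \<sigma>"

text \<open>The multiplicity of an isomorphism class \<open>E\<close> of irreducible representations in \<open>\<sigma>\<close>.\<close>

definition mult_of ::
  "('g, 'm) monoid_scheme \<Rightarrow> ('g \<Rightarrow> 'k::field mat) set \<Rightarrow> ('g \<Rightarrow> 'k mat) \<Rightarrow> nat" where
  "mult_of G E \<sigma> =
     (THE k. \<exists>\<rho>s. decomposes G \<rho>s \<sigma> \<and> k = length (filter (\<lambda>\<rho>. \<rho> \<in> E) \<rho>s))"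

text \<open>
  Modules that are not given by matrices occur as \<open>U / U0\<close>, where \<open>U0 \<subseteq> U\<close> are spaces of
  functions stable under an action \<open>act\<close>. The predicate \<open>carries G U U0 act \<rho>\<close> says that \<open>\<rho>\<close>
  is this module written in some basis: \<open>T\<close> induces an isomorphism of \<open>U / U0\<close> with the
  space of \<open>\<rho>\<close>.
\<close>

definition carries ::
  "('g, 'm) monoid_scheme \<Rightarrow> ('i \<Rightarrow> 'k::field) set \<Rightarrow> ('i \<Rightarrow> 'k) set
     \<Rightarrow> ('g \<Rightarrow> ('i \<Rightarrow> 'k) \<Rightarrow> ('i \<Rightarrow> 'k)) \<Rightarrow> ('g \<Rightarrow> 'k mat) \<Rightarrow> bool" where
  "carries G U U0 act \<rho> \<longleftrightarrow> is_rep G \<rho> \<and>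
     (\<exists>T. T ` U = carrier_vec (rep_dim G \<rho>) \<and>
          (\<forall>f\<in>U. \<forall>h\<in>U. T (\<lambda>i. f i + h i) = T f + T h) \<and>
          (\<forall>a. \<forall>f\<in>U. T (\<lambda>i. a * f i) = a \<cdot>\<^sub>v T f) \<and>
          {f \<in> U. T f = 0\<^sub>v (rep_dim G \<rho>)} = U0 \<and>
          (\<forall>g\<in>carrier G. \<forall>f\<in>U. T (act g f) = \<rho> g *\<^sub>v T f))"

definition left_regular :: "('g, 'm) monoid_scheme \<Rightarrow> 'g \<Rightarrow> ('g \<Rightarrow> 'k::field) \<Rightarrow> ('g \<Rightarrow> 'k)" where
  "left_regular G g f = (\<lambda>u. if u \<in> carrier G then f (inv\<^bsub>G\<^esub> g \<otimes>\<^bsub>G\<^esub> u) else 0)"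

definition triv_rep :: "'g \<Rightarrow> 'k::field mat" where
  "triv_rep = (\<lambda>_. 1\<^sub>m 1)"

definition lin_char :: "('g, 'm) monoid_scheme \<Rightarrow> ('g \<Rightarrow> 'k::field mat) \<Rightarrow> bool" where
  "lin_char G \<chi> \<longleftrightarrow> is_rep G \<chi> \<and> rep_dim G \<chi> = 1"

definition char_ker :: "('g, 'm) monoid_scheme \<Rightarrow> ('g \<Rightarrow> 'k::field mat) \<Rightarrow> 'g set" where
  "char_ker G \<chi> = {z \<in> carrier G. \<chi> z = 1\<^sub>m (rep_dim G \<chi>)}"


section \<open>The set $M(\Gamma)$, the elements $S_{H,H'}$ and bipositivity\<close>

definition centr :: "('g, 'm) monoid_scheme \<Rightarrow> 'g \<Rightarrow> ('g, 'm) monoid_scheme" where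
  "centr \<Gamma> x = \<Gamma>\<lparr>carrier := {z \<in> carrier \<Gamma>. z \<otimes>\<^bsub>\<Gamma>\<^esub> x = x \<otimes>\<^bsub>\<Gamma>\<^esub> z}\<rparr>"

type_synonym 'g mpair = "'g \<times> ('g \<Rightarrow> complex mat)"

text \<open>
  \<open>M_class \<Gamma> x \<rho>\<close> is the set of all pairs \<open>(x', \<rho>')\<close> which are \<open>\<Gamma>\<close>-conjugate to \<open>(x, \<rho>)\<close>,
  \<open>\<rho>'\<close> being taken up to isomorphism.
\<close>

definition M_class :: "('g, 'm) monoid_scheme \<Rightarrow> 'g \<Rightarrow> ('g \<Rightarrow> complex mat) \<Rightarrow> 'g mpair set" where
  "M_class \<Gamma> x \<rho> = {(x', \<rho>'). \<exists>g\<in>carrier \<Gamma>. x' = g \<otimes>\<^bsub>\<Gamma>\<^esub> x \<otimes>\<^bsub>\<Gamma>\<^esub> inv\<^bsub>\<Gamma>\<^esub> g \<and>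
     rep_iso (centr \<Gamma> x') (\<lambda>z. \<rho> (inv\<^bsub>\<Gamma>\<^esub> g \<otimes>\<^bsub>\<Gamma>\<^esub> z \<otimes>\<^bsub>\<Gamma>\<^esub> g)) \<rho>'}"

definition M_set :: "('g, 'm) monoid_scheme \<Rightarrow> 'g mpair set set" where
  "M_set \<Gamma> = {M_class \<Gamma> x \<rho> | x \<rho>. x \<in> carrier \<Gamma> \<and> irreducible_rep (centr \<Gamma> x) \<rho>}"

text \<open>A representative of an element of \<open>M_set \<Gamma>\<close>; nothing below depends on the choice.\<close>

definition m_elt :: "'g mpair set \<Rightarrow> 'g" where
  "m_elt m = fst (SOME p. p \<in> m)"

definition m_rep :: "'g mpair set \<Rightarrow> 'g \<Rightarrow> complex mat" where
  "m_rep m = snd (SOME p. p \<in> m)"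

text \<open>Functions supported on \<open>X\<close>: for finite \<open>X\<close> the vector space with basis \<open>X\<close>.\<close>

definition free_space :: "'i set \<Rightarrow> ('i \<Rightarrow> 'k::zero) set" where
  "free_space X = {f. \<forall>i. i \<notin> X \<longrightarrow> f i = 0}"

definition coset_fix :: "('g, 'm) monoid_scheme \<Rightarrow> 'g set \<Rightarrow> 'g \<Rightarrow> 'g set set" where
  "coset_fix \<Gamma> H x = {A \<in> lcosets\<^bsub>\<Gamma>\<^esub> H. x <#\<^bsub>\<Gamma>\<^esub> A = A}"

text \<open>The map of free vector spaces induced by \<open>p\<close>.\<close>

definition pushforward :: "'i set \<Rightarrow> ('i \<Rightarrow> 'j) \<Rightarrow> ('i \<Rightarrow> 'k::comm_monoid_add) \<Rightarrow> ('j \<Rightarrow> 'k)" where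
  "pushforward X p f = (\<lambda>j. \<Sum>i | i \<in> X \<and> p i = j. f i)"

text \<open>The map $\Gamma/H \to \Gamma/H'$ is \<open>A \<mapsto> A H'\<close>.\<close>

definition perm_image ::
  "('g, 'm) monoid_scheme \<Rightarrow> 'g set \<Rightarrow> 'g set \<Rightarrow> 'g \<Rightarrow> ('g set \<Rightarrow> complex) set" where
  "perm_image \<Gamma> H H' x =
     pushforward (coset_fix \<Gamma> H x) (\<lambda>A. A <#>\<^bsub>\<Gamma>\<^esub> H') ` free_space (coset_fix \<Gamma> H x)"

text \<open>The linear extension of left translation, basis vector \<open>A\<close> going to \<open>z A\<close>.\<close>

definition perm_act ::
  "('g, 'm) monoid_scheme \<Rightarrow> 'g set set \<Rightarrow> 'g \<Rightarrow> ('g set \<Rightarrow> complex) \<Rightarrow> ('g set \<Rightarrow> complex)" where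
  "perm_act \<Gamma> Y z f = (\<lambda>A. if A \<in> Y then f (inv\<^bsub>\<Gamma>\<^esub> z <#\<^bsub>\<Gamma>\<^esub> A) else 0)"

definition N_mult ::
  "('g, 'm) monoid_scheme \<Rightarrow> 'g set \<Rightarrow> 'g set \<Rightarrow> 'g \<Rightarrow> ('g \<Rightarrow> complex mat) \<Rightarrow> nat" where
  "N_mult \<Gamma> H H' x \<rho> =
     (THE k. \<exists>\<sigma>. carries (centr \<Gamma> x) (perm_image \<Gamma> H H' x) {\<lambda>_. 0}
                    (perm_act \<Gamma> (coset_fix \<Gamma> H' x)) \<sigma> \<and>
                 k = mult_of (centr \<Gamma> x) (iso_class (centr \<Gamma> x) \<rho>) \<sigma>)"

definition S_elt :: "('g, 'm) monoid_scheme \<Rightarrow> 'g set \<Rightarrow> 'g set \<Rightarrow> ('g mpair set \<Rightarrow> complex)" where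
  "S_elt \<Gamma> H H' =
     (\<lambda>m. if m \<in> M_set \<Gamma> then of_nat (N_mult \<Gamma> H H' (m_elt m) (m_rep m)) else 0)"

definition M_pairing ::
  "('g, 'm) monoid_scheme \<Rightarrow> 'g \<Rightarrow> ('g \<Rightarrow> complex mat) \<Rightarrow> 'g \<Rightarrow> ('g \<Rightarrow> complex mat) \<Rightarrow> complex" where
  "M_pairing \<Gamma> x \<rho> x' \<rho>' =
     inverse (of_nat (card (carrier (centr \<Gamma> x)))) * inverse (of_nat (card (carrier (centr \<Gamma> x')))) *
     (\<Sum>g | g \<in> carrier \<Gamma> \<and>
            x \<otimes>\<^bsub>\<Gamma>\<^esub> (g \<otimes>\<^bsub>\<Gamma>\<^esub> x' \<otimes>\<^bsub>\<Gamma>\<^esub> inv\<^bsub>\<Gamma>\<^esub> g) = (g \<otimes>\<^bsub>\<Gamma>\<^esub> x' \<otimes>\<^bsub>\<Gamma>\<^esub> inv\<^bsub>\<Gamma>\<^esub> g) \<otimes>\<^bsub>\<Gamma>\<^esub> x.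
        cnj (tr (\<rho>' (inv\<^bsub>\<Gamma>\<^esub> g \<otimes>\<^bsub>\<Gamma>\<^esub> x \<otimes>\<^bsub>\<Gamma>\<^esub> g))) * tr (\<rho> (g \<otimes>\<^bsub>\<Gamma>\<^esub> x' \<otimes>\<^bsub>\<Gamma>\<^esub> inv\<^bsub>\<Gamma>\<^esub> g)))"

definition fourier ::
  "('g, 'm) monoid_scheme \<Rightarrow> ('g mpair set \<Rightarrow> complex) \<Rightarrow> ('g mpair set \<Rightarrow> complex)" where
  "fourier \<Gamma> f = (\<lambda>m'. if m' \<in> M_set \<Gamma>
     then \<Sum>m\<in>M_set \<Gamma>. f m * M_pairing \<Gamma> (m_elt m) (m_rep m) (m_elt m') (m_rep m') else 0)"

definition M_nonneg :: "('g, 'm) monoid_scheme \<Rightarrow> ('g mpair set \<Rightarrow> complex) set" where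
  "M_nonneg \<Gamma> = {f \<in> free_space (M_set \<Gamma>). \<forall>m\<in>M_set \<Gamma>. f m \<in> \<real>\<^sub>\<ge>\<^sub>0}"

definition bipositive :: "('g, 'm) monoid_scheme \<Rightarrow> ('g mpair set \<Rightarrow> complex) \<Rightarrow> bool" where
  "bipositive \<Gamma> f \<longleftrightarrow> f \<in> M_nonneg \<Gamma> \<and> fourier \<Gamma> f \<in> M_nonneg \<Gamma>"


section \<open>Hecke algebra, Kazhdan--Lusztig basis and cells\<close>

text \<open>
  \<open>W\<close> is a finite Coxeter group with set of simple reflections \<open>S\<close>. Laurent polynomials in
  \<open>v\<close> are the group ring of the integers, and an element of the Hecke algebra is the family
  of its coefficients in the basis \<open>T\<^sub>w\<close>, normalised by $(T_s - v)(T_s + v^{-1}) = 0$.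
\<close>

type_synonym laurent = "int \<Rightarrow>\<^sub>0 int"

abbreviation vpow :: "int \<Rightarrow> laurent" where
  "vpow k \<equiv> Poly_Mapping.single k 1"

definition lbar :: "laurent \<Rightarrow> laurent" where
  "lbar p = Poly_Mapping.map_key uminus p"

definition at_one :: "laurent \<Rightarrow> rat" where
  "at_one p = (\<Sum>k\<in>Poly_Mapping.keys p. of_int (Poly_Mapping.lookup p k))"

definition len :: "('w, 'm) monoid_scheme \<Rightarrow> 'w set \<Rightarrow> 'w \<Rightarrow> nat" where
  "len W S w = (LEAST k. \<exists>ss. set ss \<subseteq> S \<and> length ss = k \<and>
                              foldr (\<lambda>s u. s \<otimes>\<^bsub>W\<^esub> u) ss \<one>\<^bsub>W\<^esub> = w)"

definition T_left ::
  "('w, 'm) monoid_scheme \<Rightarrow> 'w set \<Rightarrow> 'w \<Rightarrow> ('w \<Rightarrow> laurent) \<Rightarrow> ('w \<Rightarrow> laurent)" where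
  "T_left W S s h = (\<lambda>u. if u \<in> carrier W
     then h (s \<otimes>\<^bsub>W\<^esub> u) +
          (if len W S (s \<otimes>\<^bsub>W\<^esub> u) < len W S u then (vpow 1 - vpow (-1)) * h u else 0)
     else 0)"

definition T_right ::
  "('w, 'm) monoid_scheme \<Rightarrow> 'w set \<Rightarrow> 'w \<Rightarrow> ('w \<Rightarrow> laurent) \<Rightarrow> ('w \<Rightarrow> laurent)" where
  "T_right W S s h = (\<lambda>u. if u \<in> carrier W
     then h (u \<otimes>\<^bsub>W\<^esub> s) +
          (if len W S (u \<otimes>\<^bsub>W\<^esub> s) < len W S u then (vpow 1 - vpow (-1)) * h u else 0)
     else 0)"

text \<open>
  The bar involution of the Hecke algebra: semilinear for $v \mapsto v^{-1}$, with
  $T_1 \mapsto T_1$ and $T_s h \mapsto T_s^{-1} \bar h$, where $T_s^{-1} = T_s - (v - v^{-1})$.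
\<close>

definition is_bar ::
  "('w, 'm) monoid_scheme \<Rightarrow> 'w set \<Rightarrow> (('w \<Rightarrow> laurent) \<Rightarrow> ('w \<Rightarrow> laurent)) \<Rightarrow> bool" where
  "is_bar W S \<beta> \<longleftrightarrow>
     \<beta> ` free_space (carrier W) \<subseteq> free_space (carrier W) \<and>
     (\<forall>h\<in>free_space (carrier W). \<forall>k\<in>free_space (carrier W).
        \<beta> (\<lambda>u. h u + k u) = (\<lambda>u. \<beta> h u + \<beta> k u)) \<and>
     (\<forall>p. \<forall>h\<in>free_space (carrier W). \<beta> (\<lambda>u. p * h u) = (\<lambda>u. lbar p * \<beta> h u)) \<and>
     \<beta> (\<lambda>u. if u = \<one>\<^bsub>W\<^esub> then 1 else 0) = (\<lambda>u. if u = \<one>\<^bsub>W\<^esub> then 1 else 0) \<and>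
     (\<forall>s\<in>S. \<forall>h\<in>free_space (carrier W).
        \<beta> (T_left W S s h) = (\<lambda>u. T_left W S s (\<beta> h) u - (vpow 1 - vpow (-1)) * \<beta> h u))"

text \<open>
  The Kazhdan--Lusztig basis element $c_w$: bar invariant and congruent to $T_w$ modulo
  $\bigoplus_y v^{-1}\mathbf{Z}[v^{-1}] T_y$.
\<close>

definition kl_basis :: "('w, 'm) monoid_scheme \<Rightarrow> 'w set \<Rightarrow> 'w \<Rightarrow> ('w \<Rightarrow> laurent)" where
  "kl_basis W S w = (THE h. h \<in> free_space (carrier W) \<and> (\<exists>\<beta>. is_bar W S \<beta> \<and> \<beta> h = h) \<and>
     h w = 1 \<and> (\<forall>y\<in>carrier W - {w}. \<forall>k\<ge>0. Poly_Mapping.lookup (h y) k = 0))"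

definition kl_occurs :: "('w, 'm) monoid_scheme \<Rightarrow> 'w set \<Rightarrow> 'w \<Rightarrow> ('w \<Rightarrow> laurent) \<Rightarrow> bool" where
  "kl_occurs W S x h \<longleftrightarrow>
     (\<exists>d. h = (\<lambda>u. \<Sum>z\<in>carrier W. d z * kl_basis W S z u) \<and> d x \<noteq> 0)"

text \<open>
  \<open>c\<^sub>x\<close> occurs in $c_s c_y$, respectively in $c_y c_s$, for some simple reflection \<open>s\<close>; here
  $c_s = T_s + v^{-1}$.
\<close>

definition left_arrow :: "('w, 'm) monoid_scheme \<Rightarrow> 'w set \<Rightarrow> 'w \<Rightarrow> 'w \<Rightarrow> bool" where
  "left_arrow W S x y \<longleftrightarrow> x \<in> carrier W \<and> y \<in> carrier W \<and>
     (\<exists>s\<in>S. kl_occurs W S x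
        (\<lambda>u. T_left W S s (kl_basis W S y) u + vpow (-1) * kl_basis W S y u))"

definition right_arrow :: "('w, 'm) monoid_scheme \<Rightarrow> 'w set \<Rightarrow> 'w \<Rightarrow> 'w \<Rightarrow> bool" where
  "right_arrow W S x y \<longleftrightarrow> x \<in> carrier W \<and> y \<in> carrier W \<and>
     (\<exists>s\<in>S. kl_occurs W S x
        (\<lambda>u. T_right W S s (kl_basis W S y) u + vpow (-1) * kl_basis W S y u))"

definition le_L :: "('w, 'm) monoid_scheme \<Rightarrow> 'w set \<Rightarrow> 'w \<Rightarrow> 'w \<Rightarrow> bool" where
  "le_L W S = rtranclp (left_arrow W S)"

definition le_LR :: "('w, 'm) monoid_scheme \<Rightarrow> 'w set \<Rightarrow> 'w \<Rightarrow> 'w \<Rightarrow> bool" where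
  "le_LR W S = rtranclp (\<lambda>x y. left_arrow W S x y \<or> right_arrow W S x y)"

definition cells :: "('w, 'm) monoid_scheme \<Rightarrow> ('w \<Rightarrow> 'w \<Rightarrow> bool) \<Rightarrow> 'w set set" where
  "cells W pre = {{y \<in> carrier W. pre x y \<and> pre y x} | x. x \<in> carrier W}"

text \<open>The span in $\mathbf{Q}[W]$ of the specialisations at \<open>v = 1\<close> of the $c_y$, \<open>y \<in> Y\<close>.\<close>

definition kl_span :: "('w, 'm) monoid_scheme \<Rightarrow> 'w set \<Rightarrow> 'w set \<Rightarrow> ('w \<Rightarrow> rat) set" where
  "kl_span W S Y = {\<lambda>u. \<Sum>y\<in>Y. d y * at_one (kl_basis W S y u) | d. True}"

definition below :: "('w, 'm) monoid_scheme \<Rightarrow> ('w \<Rightarrow> 'w \<Rightarrow> bool) \<Rightarrow> 'w set \<Rightarrow> 'w set" where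
  "below W pre X = {y \<in> carrier W. \<exists>x\<in>X. pre y x}"

text \<open>
  \<open>\<sigma>\<close> is the representation of \<open>W\<close> (by left multiplication) carried by the cell \<open>X\<close>, left or
  two-sided according to the preorder \<open>pre\<close>.
\<close>

definition cell_rep ::
  "('w, 'm) monoid_scheme \<Rightarrow> 'w set \<Rightarrow> ('w \<Rightarrow> 'w \<Rightarrow> bool) \<Rightarrow> 'w set \<Rightarrow> ('w \<Rightarrow> rat mat) \<Rightarrow> bool" where
  "cell_rep W S pre X \<sigma> \<longleftrightarrow>
     carries W (kl_span W S (below W pre X)) (kl_span W S (below W pre X - X)) (left_regular W) \<sigma>"

definition family_of ::
  "('w, 'm) monoid_scheme \<Rightarrow> 'w set \<Rightarrow> 'w set \<Rightarrow> ('w \<Rightarrow> rat mat) set set" where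
  "family_of W S X = {E \<in> Irr W. \<exists>\<sigma>. cell_rep W S (le_LR W S) X \<sigma> \<and> 0 < mult_of W E \<sigma>}"

definition families :: "('w, 'm) monoid_scheme \<Rightarrow> 'w set \<Rightarrow> ('w \<Rightarrow> rat mat) set set set" where
  "families W S = family_of W S ` cells W (le_LR W S)"

definition constructible ::
  "('w, 'm) monoid_scheme \<Rightarrow> 'w set \<Rightarrow> ('w \<Rightarrow> rat mat) set set \<Rightarrow> ('w \<Rightarrow> rat mat) \<Rightarrow> bool" where
  "constructible W S c \<sigma> \<longleftrightarrow>
     (\<exists>X\<in>cells W (le_LR W S). family_of W S X = c \<and>
        (\<exists>L\<in>cells W (le_L W S). L \<subseteq> X \<and> cell_rep W S (le_L W S) L \<sigma>))"

definition in_R ::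
  "('w, 'm) monoid_scheme \<Rightarrow> ('w \<Rightarrow> rat mat) set set \<Rightarrow> ('w \<Rightarrow> rat mat) \<Rightarrow> bool" where
  "in_R W c \<E> \<longleftrightarrow> (\<exists>\<rho>s. decomposes W \<rho>s \<E> \<and> (\<forall>\<rho>\<in>set \<rho>s. \<exists>E\<in>c. \<rho> \<in> E))"


section \<open>Irreducible Weyl groups\<close>

text \<open>
  \<open>a i j\<close> is the value of the \<open>i\<close>-th simple coroot on the \<open>j\<close>-th simple root, \<open>i, j < r\<close>.
  The Weyl group is realised on the rational span of the roots, in the basis of simple roots.
\<close>

definition irreducible_cartan :: "nat \<Rightarrow> (nat \<Rightarrow> nat \<Rightarrow> int) \<Rightarrow> bool" where
  "irreducible_cartan r a \<longleftrightarrow> 0 < r \<and>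
     (\<forall>i<r. a i i = 2) \<and>
     (\<forall>i<r. \<forall>j<r. i \<noteq> j \<longrightarrow> a i j \<le> 0) \<and>
     (\<exists>d :: nat \<Rightarrow> rat. (\<forall>i<r. 0 < d i) \<and>
        (\<forall>i<r. \<forall>j<r. d i * of_int (a i j) = d j * of_int (a j i)) \<and>
        (\<forall>x :: nat \<Rightarrow> rat. (\<exists>i<r. x i \<noteq> 0) \<longrightarrow>
           0 < (\<Sum>i<r. \<Sum>j<r. d i * of_int (a i j) * x i * x j))) \<and>
     (\<forall>J. J \<subset> {..<r} \<and> J \<noteq> {} \<longrightarrow> (\<exists>i\<in>J. \<exists>j\<in>{..<r} - J. a i j \<noteq> 0))"

definition simple_reflection :: "nat \<Rightarrow> (nat \<Rightarrow> nat \<Rightarrow> int) \<Rightarrow> nat \<Rightarrow> rat mat" where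
  "simple_reflection r a i =
     mat r r (\<lambda>(k, j). (if k = j then 1 else 0) - (if k = i then of_int (a i j) else 0))"

definition simple_reflections :: "nat \<Rightarrow> (nat \<Rightarrow> nat \<Rightarrow> int) \<Rightarrow> rat mat set" where
  "simple_reflections r a = simple_reflection r a ` {..<r}"

definition gl_group :: "nat \<Rightarrow> rat mat monoid" where
  "gl_group r = \<lparr>carrier = {A \<in> carrier_mat r r. invertible_mat A}, mult = (*), one = 1\<^sub>m r\<rparr>"

definition weyl_group :: "nat \<Rightarrow> (nat \<Rightarrow> nat \<Rightarrow> int) \<Rightarrow> rat mat monoid" where
  "weyl_group r a = (gl_group r)\<lparr>carrier := generate (gl_group r) (simple_reflections r a)\<rparr>"

text \<open>
  The coinvariant algebra, in the form of polynomial functions on the reflection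
  representation modulo the ideal generated by the invariants of positive degree.
\<close>

definition hpoly :: "nat \<Rightarrow> nat \<Rightarrow> (rat vec \<Rightarrow> rat) set" where
  "hpoly r d = {\<lambda>x. if x \<in> carrier_vec r
       then \<Sum>e | (\<forall>i\<ge>r. e i = 0) \<and> (\<Sum>i<r. e i) = d. coef e * (\<Prod>i<r. (x $ i) ^ e i)
       else 0 | coef :: (nat \<Rightarrow> nat) \<Rightarrow> rat. True}"

definition poly_act ::
  "nat \<Rightarrow> rat mat monoid \<Rightarrow> rat mat \<Rightarrow> (rat vec \<Rightarrow> rat) \<Rightarrow> (rat vec \<Rightarrow> rat)" where
  "poly_act r W w f = (\<lambda>x. if x \<in> carrier_vec r then f (inv\<^bsub>W\<^esub> w *\<^sub>v x) else 0)"

definition coinv_ideal :: "nat \<Rightarrow> rat mat monoid \<Rightarrow> nat \<Rightarrow> (rat vec \<Rightarrow> rat) set" where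
  "coinv_ideal r W d = {\<lambda>x. \<Sum>j<m. f j x * g j x | (m :: nat) f g. \<forall>j<m. \<exists>k. 1 \<le> k \<and> k \<le> d \<and>
     f j \<in> hpoly r k \<and> (\<forall>w\<in>carrier W. poly_act r W w (f j) = f j) \<and> g j \<in> hpoly r (d - k)}"

definition b_invariant :: "nat \<Rightarrow> rat mat monoid \<Rightarrow> (rat mat \<Rightarrow> rat mat) set \<Rightarrow> nat" where
  "b_invariant r W E = (LEAST d. \<exists>\<sigma>.
     carries W (hpoly r d) (coinv_ideal r W d) (poly_act r W) \<sigma> \<and> 0 < mult_of W E \<sigma>)"

definition special ::
  "nat \<Rightarrow> rat mat monoid \<Rightarrow> (rat mat \<Rightarrow> rat mat) set set \<Rightarrow> (rat mat \<Rightarrow> rat mat) set \<Rightarrow> bool" where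
  "special r W c E \<longleftrightarrow>
     E \<in> c \<and> (\<forall>E'\<in>c. E' \<noteq> E \<longrightarrow> b_invariant r W E < b_invariant r W E')"


section \<open>Representations of symmetric groups attached to partitions\<close>

definition is_partition :: "nat \<Rightarrow> nat list \<Rightarrow> bool" where
  "is_partition n \<xi> \<longleftrightarrow> sorted_wrt (\<ge>) \<xi> \<and> 0 \<notin> set \<xi> \<and> sum_list \<xi> = n"

text \<open>The (row, column) of the \<open>j\<close>-th box, \<open>j \<ge> 0\<close>, of a diagram filled row by row.\<close>

fun box :: "nat list \<Rightarrow> nat \<Rightarrow> nat \<times> nat" where
  "box [] j = (0, j)"
| "box (l # ls) j = (if j < l then (0, j) else (let (p, q) = box ls (j - l) in (Suc p, q)))"

definition row_stab :: "nat \<Rightarrow> nat list \<Rightarrow> (nat \<Rightarrow> nat) set" where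
  "row_stab n \<xi> = {p. p permutes {1..n} \<and> (\<forall>i\<in>{1..n}. fst (box \<xi> (p i - 1)) = fst (box \<xi> (i - 1)))}"

definition col_stab :: "nat \<Rightarrow> nat list \<Rightarrow> (nat \<Rightarrow> nat) set" where
  "col_stab n \<xi> = {p. p permutes {1..n} \<and> (\<forall>i\<in>{1..n}. snd (box \<xi> (p i - 1)) = snd (box \<xi> (i - 1)))}"

definition young_symmetrizer :: "nat \<Rightarrow> nat list \<Rightarrow> (nat \<Rightarrow> nat) \<Rightarrow> 'k::field_char_0" where
  "young_symmetrizer n \<xi> u =
     (\<Sum>(p, q)\<in>row_stab n \<xi> \<times> col_stab n \<xi>. if p \<circ> q = u then of_int (sign q) else 0)"

definition young_ideal :: "nat \<Rightarrow> nat list \<Rightarrow> ((nat \<Rightarrow> nat) \<Rightarrow> 'k::field_char_0) set" where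
  "young_ideal n \<xi> = {\<lambda>u. if u permutes {1..n}
       then \<Sum>g | g permutes {1..n}. f g * young_symmetrizer n \<xi> (inv' g \<circ> u) else 0
     | f :: (nat \<Rightarrow> nat) \<Rightarrow> 'k. True}"

text \<open>
  \<open>\<rho>\<close> is the irreducible representation of the symmetric group attached to the partition
  \<open>\<xi>\<close> of \<open>n\<close>, namely the left ideal generated by a Young symmetrizer; \<open>[n]\<close> gives the trivial
  representation.
\<close>

definition is_specht :: "nat \<Rightarrow> nat list \<Rightarrow> ((nat \<Rightarrow> nat) \<Rightarrow> 'k::field_char_0 mat) \<Rightarrow> bool" where
  "is_specht n \<xi> \<rho> \<longleftrightarrow>
     carries (sym_group n) (young_ideal n \<xi>) {\<lambda>_. 0} (left_regular (sym_group n)) \<rho>"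

definition sgn_rep :: "(nat \<Rightarrow> nat) \<Rightarrow> complex mat" where
  "sgn_rep p = mat 1 1 (\<lambda>_. of_int (sign p))"


section \<open>The spaces $V$ and the collections $\mathcal{F}(V)$\<close>

text \<open>
  A vector of $V = \mathbf{F}_2^D$ is identified with the set of those \<open>i \<in> {1..D}\<close> for which
  its coordinate at the basis vector $e_i$ is \<open>1\<close>; addition is symmetric difference.
  \<open>lin2 f\<close> is the linear map with $e_k \mapsto$ \<open>f k\<close>.
\<close>

definition lin2 :: "(nat \<Rightarrow> 'b set) \<Rightarrow> nat set \<Rightarrow> 'b set" where
  "lin2 f I = {b. odd (card {k \<in> I. b \<in> f k})}"

definition V_form :: "nat set \<Rightarrow> nat set \<Rightarrow> nat" where
  "V_form I J = card {(i, j). i \<in> I \<and> j \<in> J \<and> (i = j + 1 \<or> j = i + 1)} mod 2"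

definition V_ind :: "nat \<Rightarrow> nat \<Rightarrow> nat set" where
  "V_ind D \<delta> = {i \<in> {1..D}. i mod 2 = \<delta>}"

definition V_group :: "nat \<Rightarrow> nat \<Rightarrow> nat set monoid" where
  "V_group D \<delta> = \<lparr>carrier = Pow (V_ind D \<delta>), mult = (\<lambda>x y. sym_diff x y), one = {}\<rparr>"

definition T_map :: "nat \<Rightarrow> nat set \<Rightarrow> nat set" where
  "T_map i = lin2 (\<lambda>k. if k + 2 \<le> i then {k} else if i \<le> k then {k + 2} else {i - 1, i, i + 1})"

inductive F_coll :: "nat \<Rightarrow> nat set set \<Rightarrow> bool" where
  zero: "even D \<Longrightarrow> F_coll D {{}}"
| step: "F_coll D X' \<Longrightarrow> i \<in> {1..D + 2} \<Longrightarrow>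
           F_coll (D + 2) (T_map i ` X' \<union> (\<lambda>x. sym_diff (T_map i x) {i}) ` X')"

definition V_perp :: "nat \<Rightarrow> nat \<Rightarrow> nat set set \<Rightarrow> nat set set" where
  "V_perp D \<delta> L = {y \<in> Pow (V_ind D (1 - \<delta>)). \<forall>z\<in>L. V_form y z = 0}"

text \<open>A subspace over $\mathbf{F}_2$ is the same as a subgroup.\<close>

definition Theta_V :: "nat \<Rightarrow> nat \<Rightarrow> (nat set set \<times> nat set set) set" where
  "Theta_V D \<delta> = {(L, L'). subgroup L (V_group D \<delta>) \<and> subgroup L' (V_group D \<delta>) \<and>
     F_coll D {sym_diff x y | x y. x \<in> L \<and> y \<in> V_perp D \<delta> L'}}"

text \<open>The pair consisting of an element of $V^\delta$ and a character of $V^\delta$ attached to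
  \<open>I \<in> V\<close>.\<close>

definition V_pair :: "nat \<Rightarrow> nat \<Rightarrow> nat set \<Rightarrow> nat set mpair" where
  "V_pair D \<delta> I = (I \<inter> V_ind D \<delta>, \<lambda>x. mat 1 1 (\<lambda>_. (-1) ^ V_form x (I \<inter> V_ind D (1 - \<delta>))))"


section \<open>Imbeddings for types B, C and D\<close>

definition signed_perms :: "nat \<Rightarrow> (int \<Rightarrow> int) monoid" where
  "signed_perms n = \<lparr>carrier = {w. w permutes {- int n..int n} \<and> (\<forall>i. w (- i) = - w i)},
                     mult = (\<circ>), one = id\<rparr>"

definition even_signed_perms :: "nat \<Rightarrow> (int \<Rightarrow> int) monoid" where
  "even_signed_perms n =
     (signed_perms n)\<lparr>carrier := {w \<in> carrier (signed_perms n). even (card {i \<in> {1..int n}. w i < 0})}\<rparr>"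

definition gens_A :: "nat \<Rightarrow> (int \<Rightarrow> int) set" where
  "gens_A n = (\<lambda>i. transpose i (i + 1) \<circ> transpose (- i) (- (i + 1))) ` {1..<int n}"

definition gens_B :: "nat \<Rightarrow> (int \<Rightarrow> int) set" where
  "gens_B n = insert (transpose 1 (-1)) (gens_A n)"

definition gens_D :: "nat \<Rightarrow> (int \<Rightarrow> int) set" where
  "gens_D n = insert (transpose 1 (-2) \<circ> transpose 2 (-1)) (gens_A n)"

text \<open>
  The character of the hyperoctahedral group attached to \<open>(\<xi>; \<eta>)\<close>, \<open>\<xi>\<close> a partition of \<open>k\<close>,
  \<open>\<eta>\<close> a partition of \<open>n - k\<close>: it is induced from the stabilizer $B_k \times B_{n-k}$ of
  \<open>{\<plusminus>1, \<dots>, \<plusminus>k}\<close>, the signs acting trivially on the first factor and by the product of all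
  signs on the second one. \<open>\<alpha>\<close> and \<open>\<beta>\<close> are the representations of the symmetric groups
  attached to \<open>\<xi>\<close> and \<open>\<eta>\<close>.
\<close>

definition BB_subgroup :: "nat \<Rightarrow> nat \<Rightarrow> (int \<Rightarrow> int) set" where
  "BB_subgroup n k = {w \<in> carrier (signed_perms n). w ` {- int k..int k} = {- int k..int k}}"

definition perm_fst :: "nat \<Rightarrow> (int \<Rightarrow> int) \<Rightarrow> nat \<Rightarrow> nat" where
  "perm_fst k w = (\<lambda>i. if i \<in> {1..k} then nat \<bar>w (int i)\<bar> else i)"

definition perm_snd :: "nat \<Rightarrow> nat \<Rightarrow> (int \<Rightarrow> int) \<Rightarrow> nat \<Rightarrow> nat" where
  "perm_snd n k w = (\<lambda>i. if i \<in> {1..n - k} then nat \<bar>w (int (i + k))\<bar> - k else i)"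

definition bipartition_char ::
  "nat \<Rightarrow> nat \<Rightarrow> ((nat \<Rightarrow> nat) \<Rightarrow> rat mat) \<Rightarrow> ((nat \<Rightarrow> nat) \<Rightarrow> rat mat) \<Rightarrow> (int \<Rightarrow> int) \<Rightarrow> rat" where
  "bipartition_char n k \<alpha> \<beta> w =
     inverse (of_nat (card (BB_subgroup n k))) *
     (\<Sum>x | x \<in> carrier (signed_perms n) \<and> inv' x \<circ> w \<circ> x \<in> BB_subgroup n k.
        let y = inv' x \<circ> w \<circ> x in
        tr (\<alpha> (perm_fst k y)) * tr (\<beta> (perm_snd n k y)) * (\<Prod>i\<in>{int k + 1..int n}. of_int (sgn (y i))))"

text \<open>
  \<open>E\<close> is the class of the representation (in type D: the restriction of the representation)
  attached to \<open>(\<xi>; \<eta>)\<close>, where \<open>\<phi>\<close> identifies \<open>W\<close> with a group of signed permutations.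
\<close>

definition bipartition_label ::
  "('w, 'm) monoid_scheme \<Rightarrow> ('w \<Rightarrow> int \<Rightarrow> int) \<Rightarrow> nat \<Rightarrow> ('w \<Rightarrow> rat mat) set \<Rightarrow>
     nat list \<Rightarrow> nat list \<Rightarrow> bool" where
  "bipartition_label W \<phi> n E \<xi> \<eta> \<longleftrightarrow>
     (\<exists>k \<alpha> \<beta>. k \<le> n \<and> is_partition k \<xi> \<and> is_partition (n - k) \<eta> \<and>
        is_specht k \<xi> \<alpha> \<and> is_specht (n - k) \<eta> \<beta> \<and>
        (\<exists>\<rho>\<in>E. \<forall>w\<in>carrier W. tr (\<rho> w) = bipartition_char n k \<alpha> \<beta> (\<phi> w)))"

text \<open>
  The row of a symbol attached to \<open>\<xi>\<close>, written (in increasing order) with \<open>m\<close> parts; since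
  \<open>\<xi>\<close> is a decreasing list without zeros, its \<open>i\<close>-th part in increasing order, \<open>0 \<le> i < m\<close>, is
  \<open>\<xi> ! (m - 1 - i)\<close> or \<open>0\<close>.
\<close>

definition symbol_row :: "nat \<Rightarrow> nat list \<Rightarrow> nat set" where
  "symbol_row m \<xi> =
     (\<lambda>i. (if m - 1 - i < length \<xi> then \<xi> ! (m - 1 - i) else 0) + i) ` {..<m}"

text \<open>
  The imbedding \<open>c \<rightarrow> V\<close>. The list \<open>zs\<close> consists of the entries occurring exactly once
  in the symbols of the elements of the family; the vector \<open>y E\<close> is the coordinate form of
  the even set $x_E$.
\<close>

definition imbedding_BC ::
  "('w, 'm) monoid_scheme \<Rightarrow> 'w set \<Rightarrow> ('w \<Rightarrow> rat mat) set set \<Rightarrow> nat \<Rightarrow>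
     (('w \<Rightarrow> rat mat) set \<Rightarrow> nat set) \<Rightarrow> bool" where
  "imbedding_BC W S c D y \<longleftrightarrow>
     (\<exists>n m \<phi> zs. 2 \<le> n \<and> n \<le> m \<and> \<phi> \<in> iso W (signed_perms n) \<and> \<phi> ` S = gens_B n \<and>
        length zs = D + 1 \<and>
        (\<forall>E\<in>c. \<exists>\<xi> \<eta>. bipartition_label W \<phi> n E \<xi> \<eta> \<and>
           zs = sorted_list_of_set (sym_diff (symbol_row (m + 1) \<xi>) (symbol_row m \<eta>)) \<and>
           y E \<subseteq> {1..D} \<and>
           lin2 (\<lambda>i. {zs ! (i - 1), zs ! i}) (y E) =
             sym_diff (set zs \<inter> symbol_row m \<eta>) {zs ! i | i. odd i \<and> i < D}))"

definition imbedding_D ::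
  "('w, 'm) monoid_scheme \<Rightarrow> 'w set \<Rightarrow> ('w \<Rightarrow> rat mat) set set \<Rightarrow> nat \<Rightarrow>
     (('w \<Rightarrow> rat mat) set \<Rightarrow> nat set) \<Rightarrow> bool" where
  "imbedding_D W S c D y \<longleftrightarrow>
     (\<exists>n m \<phi> zs. 4 \<le> n \<and> n \<le> m \<and> \<phi> \<in> iso W (even_signed_perms n) \<and> \<phi> ` S = gens_D n \<and>
        length zs = D + 2 \<and>
        (\<forall>E\<in>c. \<exists>\<xi> \<eta>. \<xi> \<noteq> \<eta> \<and> bipartition_label W \<phi> n E \<xi> \<eta> \<and>
           zs = sorted_list_of_set (sym_diff (symbol_row m \<xi>) (symbol_row m \<eta>)) \<and>
           last zs \<in> symbol_row m \<xi> \<and>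
           y E \<subseteq> {1..D} \<and>
           lin2 (\<lambda>i. {zs ! (i - 1), zs ! i}) (y E) =
             sym_diff (set zs \<inter> symbol_row m \<eta>) {zs ! i | i. even i \<and> i \<le> D}))"


section \<open>Imbeddings for exceptional types\<close>

text \<open>
  \<open>p\<close> numbers the simple reflections in such a way that \<open>B i j\<close> is the number of bonds
  (\<open>3\<close> in type $G_2$) between the nodes \<open>i\<close> and \<open>j\<close> of the Dynkin diagram; arrows are ignored.
\<close>

definition dynkin_numbering ::
  "nat \<Rightarrow> (nat \<Rightarrow> nat \<Rightarrow> int) \<Rightarrow> nat \<Rightarrow> (nat \<Rightarrow> nat \<Rightarrow> int) \<Rightarrow> (nat \<Rightarrow> nat) \<Rightarrow> bool" where
  "dynkin_numbering r a n B p \<longleftrightarrow> r = n \<and> bij_betw p {..<n} {..<n} \<and>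
     (\<forall>i<n. \<forall>j<n. i \<noteq> j \<longrightarrow> a (p i) (p j) * a (p j) (p i) = B i j)"

text \<open>A chain \<open>0, \<dots>, n - 2\<close>, with the node \<open>n - 1\<close> joined to the node \<open>2\<close>.\<close>

definition E_bonds :: "nat \<Rightarrow> nat \<Rightarrow> nat \<Rightarrow> int" where
  "E_bonds n i j = (if (\<exists>k. k + 2 < n \<and> {i, j} = {k, k + 1}) \<or> {i, j} = {2, n - 1} then 1 else 0)"

definition F_bonds :: "nat \<Rightarrow> nat \<Rightarrow> int" where
  "F_bonds i j = (if {i, j} = {1, 2} then 2 else if {i, j} = {0, 1} \<or> {i, j} = {2, 3} then 1 else 0)"

definition exceptional :: "nat \<Rightarrow> (nat \<Rightarrow> nat \<Rightarrow> int) \<Rightarrow> bool" where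
  "exceptional r a \<longleftrightarrow>
     (\<exists>p. (\<exists>n\<in>{6, 7, 8}. dynkin_numbering r a n (E_bonds n) p) \<or>
          dynkin_numbering r a 4 F_bonds p \<or> dynkin_numbering r a 2 (\<lambda>_ _. 3) p)"

definition has_dim :: "('w, 'm) monoid_scheme \<Rightarrow> ('w \<Rightarrow> rat mat) set \<Rightarrow> nat \<Rightarrow> bool" where
  "has_dim W E d \<longleftrightarrow> (\<exists>\<rho>\<in>E. rep_dim W \<rho> = d)"

definition has_trace :: "('w \<Rightarrow> rat mat) set \<Rightarrow> 'w \<Rightarrow> rat \<Rightarrow> bool" where
  "has_trace E w t \<longleftrightarrow> (\<exists>\<rho>\<in>E. tr (\<rho> w) = t)"

abbreviation g2 :: "nat \<Rightarrow> nat" where "g2 \<equiv> transpose 1 2"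
abbreviation g2' :: "nat \<Rightarrow> nat" where "g2' \<equiv> transpose 1 2 \<circ> transpose 3 4"
abbreviation g3 :: "nat \<Rightarrow> nat" where "g3 \<equiv> cycle_of_list [1, 2, 3]"
abbreviation g4 :: "nat \<Rightarrow> nat" where "g4 \<equiv> cycle_of_list [1, 2, 3, 4]"
abbreviation g5 :: "nat \<Rightarrow> nat" where "g5 \<equiv> cycle_of_list [1, 2, 3, 4, 5]"
abbreviation g6 :: "nat \<Rightarrow> nat" where "g6 \<equiv> cycle_of_list [1, 2, 3] \<circ> transpose 4 5"

text \<open>The characters $\epsilon''$ and $\epsilon'$ of the centralizer of $g_2'$ in \<open>S\<^sub>N\<close>, \<open>N = 4, 5\<close>.\<close>

definition eps2_g2' :: "nat \<Rightarrow> ((nat \<Rightarrow> nat) \<Rightarrow> complex mat) \<Rightarrow> bool" where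
  "eps2_g2' N \<chi> \<longleftrightarrow> lin_char (centr (sym_group N) g2') \<chi> \<and>
     char_ker (centr (sym_group N) g2') \<chi> = {id, transpose 1 2, transpose 3 4, g2'}"

definition eps1_g2' :: "nat \<Rightarrow> ((nat \<Rightarrow> nat) \<Rightarrow> complex mat) \<Rightarrow> bool" where
  "eps1_g2' N \<chi> \<longleftrightarrow> lin_char (centr (sym_group N) g2') \<chi> \<and>
     char_ker (centr (sym_group N) g2') \<chi> =
       {id, g2', transpose 1 3 \<circ> transpose 2 4, transpose 1 4 \<circ> transpose 2 3}"

text \<open>
  In the following definitions \<open>j\<close> gives a representative \<open>(x, \<rho>)\<close> of the element of
  $M(S_N)$ attached to an element of the family \<open>c\<close>.
\<close>

definition imbedding_3 ::
  "'e set \<Rightarrow> 'e \<Rightarrow> ('e \<Rightarrow> (nat \<Rightarrow> nat) mpair) \<Rightarrow> bool" where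
  "imbedding_3 c Ec j \<longleftrightarrow>
     (\<exists>E1 E2. c = {Ec, E1, E2} \<and> j E1 = (g2, triv_rep) \<and> j E2 = (id, sgn_rep))"

definition imbedding_4 ::
  "('w, 'm) monoid_scheme \<Rightarrow> ('w \<Rightarrow> rat mat) set set \<Rightarrow> ('w \<Rightarrow> rat mat) set \<Rightarrow>
     (('w \<Rightarrow> rat mat) set \<Rightarrow> (nat \<Rightarrow> nat) mpair) \<Rightarrow> bool" where
  "imbedding_4 W c Ec j \<longleftrightarrow>
     (\<exists>E1 E2 E3. c = {Ec, E1, E2, E3} \<and> has_dim W E1 2 \<and> has_dim W E2 1 \<and> has_dim W E3 1 \<and>
        j E1 = (g2, triv_rep) \<and>
        (\<exists>\<rho>. is_specht 3 [2, 1] \<rho> \<and> j E2 = (id, \<rho>)) \<and>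
        j E3 = (g3, triv_rep))"

definition imbedding_5 ::
  "('w, 'm) monoid_scheme \<Rightarrow> 'w set \<Rightarrow> ('w \<Rightarrow> rat mat) set set \<Rightarrow> ('w \<Rightarrow> rat mat) set \<Rightarrow>
     (('w \<Rightarrow> rat mat) set \<Rightarrow> (nat \<Rightarrow> nat) mpair) \<Rightarrow> bool" where
  "imbedding_5 W S c Ec j \<longleftrightarrow>
     (\<exists>E1 E2 E3 E4. c = {Ec, E1, E2, E3, E4} \<and>
        {map (\<lambda>E. mult_of W E \<sigma>) [Ec, E1, E2, E3, E4] | \<sigma>. constructible W S c \<sigma>} =
          {[1, 1, 1, 0, 0], [1, 0, 1, 1, 0], [1, 2, 0, 0, 1]} \<and>
        (\<exists>\<rho>. is_specht 3 [2, 1] \<rho> \<and> j E1 = (id, \<rho>)) \<and>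
        j E2 = (g2, triv_rep) \<and>
        j E3 = (g3, triv_rep) \<and>
        j E4 = (id, sgn_rep))"

text \<open>
  Type $F_4$. The elements of the family are, in Kondo's notation, characterised as follows,
  \<open>s\<close> being a simple reflection at an end of the Dynkin diagram and \<open>V\<close> the reflection
  representation: $12_1$ and $16_1$ by the dimension; $6_2$ is the exterior square of \<open>V\<close>, so
  has character $\frac12(\mathrm{tr}(w)^2 - \mathrm{tr}(w^2))$, and $6_1$ is the other
  6-dimensional element; $1_3$, $9_3$, $4_4$ have trace \<open>-1\<close>, \<open>-3\<close>, \<open>-2\<close> at \<open>s\<close>, while $1_2$,
  $9_2$, $4_3$ have trace \<open>1\<close>, \<open>3\<close>, \<open>2\<close>, and $4_1$ has trace \<open>0\<close>. Both choices of \<open>s\<close> (in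
  terms of root systems: \<open>s\<close> long or \<open>s\<close> short) are allowed; the graph automorphism
  interchanges them.
\<close>

definition imbedding_11 ::
  "rat mat monoid \<Rightarrow> (rat mat \<Rightarrow> rat mat) set set \<Rightarrow> rat mat \<Rightarrow>
     ((rat mat \<Rightarrow> rat mat) set \<Rightarrow> (nat \<Rightarrow> nat) mpair) \<Rightarrow> bool" where
  "imbedding_11 W c s j \<longleftrightarrow> (\<forall>E\<in>c.
     (has_dim W E 12 \<longrightarrow> j E = (id, triv_rep)) \<and>
     (has_dim W E 9 \<and> has_trace E s (-3) \<longrightarrow> (\<exists>\<rho>. is_specht 4 [3, 1] \<rho> \<and> j E = (id, \<rho>))) \<and>
     (has_dim W E 6 \<and> (\<exists>\<rho>\<in>E. \<forall>w\<in>carrier W. tr (\<rho> w) = ((tr w)^2 - tr (w * w)) / 2) \<longrightarrow>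
        (\<exists>\<rho>. is_specht 4 [2, 2] \<rho> \<and> j E = (id, \<rho>))) \<and>
     (has_dim W E 1 \<and> has_trace E s (-1) \<longrightarrow> (\<exists>\<rho>. is_specht 4 [2, 1, 1] \<rho> \<and> j E = (id, \<rho>))) \<and>
     (has_dim W E 16 \<longrightarrow> j E = (g2, triv_rep)) \<and>
     (has_dim W E 9 \<and> has_trace E s 3 \<longrightarrow> j E = (g2', triv_rep)) \<and>
     (has_dim W E 4 \<and> has_trace E s (-2) \<longrightarrow>
        (\<exists>\<chi>. lin_char (centr (sym_group 4) g2) \<chi> \<and> \<chi> (transpose 1 2) = 1\<^sub>m 1 \<and>
             \<chi> (transpose 3 4) = - 1\<^sub>m 1 \<and> j E = (g2, \<chi>))) \<and>
     (has_dim W E 6 \<and> \<not> (\<exists>\<rho>\<in>E. \<forall>w\<in>carrier W. tr (\<rho> w) = ((tr w)^2 - tr (w * w)) / 2) \<longrightarrow>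
        j E = (g3, triv_rep)) \<and>
     (has_dim W E 4 \<and> has_trace E s 2 \<longrightarrow> j E = (g4, triv_rep)) \<and>
     (has_dim W E 4 \<and> has_trace E s 0 \<longrightarrow> (\<exists>\<chi>. eps2_g2' 4 \<chi> \<and> j E = (g2', \<chi>))) \<and>
     (has_dim W E 1 \<and> has_trace E s 1 \<longrightarrow> (\<exists>\<chi>. eps1_g2' 4 \<chi> \<and> j E = (g2', \<chi>))))"

definition imbedding_17 ::
  "('w, 'm) monoid_scheme \<Rightarrow> ('w \<Rightarrow> rat mat) set set \<Rightarrow>
     (('w \<Rightarrow> rat mat) set \<Rightarrow> (nat \<Rightarrow> nat) mpair) \<Rightarrow> bool" where
  "imbedding_17 W c j \<longleftrightarrow> (\<forall>E\<in>c.
     (has_dim W E 4480 \<longrightarrow> j E = (id, triv_rep)) \<and>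
     (has_dim W E 5670 \<longrightarrow> (\<exists>\<rho>. is_specht 5 [4, 1] \<rho> \<and> j E = (id, \<rho>))) \<and>
     (has_dim W E 4536 \<longrightarrow> (\<exists>\<rho>. is_specht 5 [3, 2] \<rho> \<and> j E = (id, \<rho>))) \<and>
     (has_dim W E 1680 \<longrightarrow> (\<exists>\<rho>. is_specht 5 [3, 1, 1] \<rho> \<and> j E = (id, \<rho>))) \<and>
     (has_dim W E 1400 \<longrightarrow> (\<exists>\<rho>. is_specht 5 [2, 2, 1] \<rho> \<and> j E = (id, \<rho>))) \<and>
     (has_dim W E 70 \<longrightarrow> (\<exists>\<rho>. is_specht 5 [2, 1, 1, 1] \<rho> \<and> j E = (id, \<rho>))) \<and>
     (has_dim W E 7168 \<longrightarrow> j E = (g2, triv_rep)) \<and>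
     (has_dim W E 5600 \<longrightarrow>
        (\<exists>\<rho>. irreducible_rep (centr (sym_group 5) g2) \<rho> \<and>
             rep_dim (centr (sym_group 5) g2) \<rho> = 2 \<and> \<rho> g2 = 1\<^sub>m 2 \<and> j E = (g2, \<rho>))) \<and>
     (has_dim W E 448 \<longrightarrow>
        (\<exists>\<chi>. lin_char (centr (sym_group 5) g2) \<chi> \<and> \<chi> g2 = 1\<^sub>m 1 \<and>
             \<chi> (transpose 3 4) = - 1\<^sub>m 1 \<and> j E = (g2, \<chi>))) \<and>
     (has_dim W E 3150 \<longrightarrow> j E = (g3, triv_rep)) \<and>
     (has_dim W E 1134 \<longrightarrow>
        (\<exists>\<chi>. lin_char (centr (sym_group 5) g3) \<chi> \<and> \<chi> g3 = 1\<^sub>m 1 \<and>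
             \<chi> (transpose 4 5) = - 1\<^sub>m 1 \<and> j E = (g3, \<chi>))) \<and>
     (has_dim W E 4200 \<longrightarrow> j E = (g2', triv_rep)) \<and>
     (has_dim W E 2688 \<longrightarrow> (\<exists>\<chi>. eps2_g2' 5 \<chi> \<and> j E = (g2', \<chi>))) \<and>
     (has_dim W E 168 \<longrightarrow> (\<exists>\<chi>. eps1_g2' 5 \<chi> \<and> j E = (g2', \<chi>))) \<and>
     (has_dim W E 2016 \<longrightarrow> j E = (g6, triv_rep)) \<and>
     (has_dim W E 1344 \<longrightarrow> j E = (g4, triv_rep)) \<and>
     (has_dim W E 420 \<longrightarrow> j E = (g5, triv_rep)))"

definition imbedding_exc ::
  "nat \<Rightarrow> (nat \<Rightarrow> nat \<Rightarrow> int) \<Rightarrow> (rat mat \<Rightarrow> rat mat) set set \<Rightarrow> nat \<Rightarrow>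
     ((rat mat \<Rightarrow> rat mat) set \<Rightarrow> (nat \<Rightarrow> nat) mpair) \<Rightarrow> bool" where
  "imbedding_exc r a c N j \<longleftrightarrow>
     (let W = weyl_group r a; S = simple_reflections r a in
      \<exists>Ec. special r W c Ec \<and> j Ec = (id, triv_rep) \<and>
        (card c = 2 \<and> N = 2 \<and> (\<forall>E\<in>c. E \<noteq> Ec \<longrightarrow> j E = (id, sgn_rep)) \<or>
         card c = 3 \<and> N = 2 \<and> imbedding_3 c Ec j \<or>
         card c = 4 \<and> N = 3 \<and> imbedding_4 W c Ec j \<or>
         card c = 5 \<and> N = 3 \<and> imbedding_5 W S c Ec j \<or>
         card c = 11 \<and> N = 4 \<and>
           (\<exists>p. dynkin_numbering r a 4 F_bonds p \<and> imbedding_11 W c (simple_reflection r a (p 0)) j) \<or>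
         card c = 17 \<and> N = 5 \<and> imbedding_17 W c j))"

definition conjugates :: "('g, 'm) monoid_scheme \<Rightarrow> 'g set \<Rightarrow> 'g set set" where
  "conjugates G H = {(\<lambda>h. g \<otimes>\<^bsub>G\<^esub> h \<otimes>\<^bsub>G\<^esub> inv\<^bsub>G\<^esub> g) ` H | g. g \<in> carrier G}"

definition young_subgroups :: "nat \<Rightarrow> nat list \<Rightarrow> (nat \<Rightarrow> nat) set set" where
  "young_subgroups N \<xi> = conjugates (sym_group N) (row_stab N \<xi>)"

definition dihedral_subgroups :: "nat \<Rightarrow> (nat \<Rightarrow> nat) set set" where
  "dihedral_subgroups N = (if N \<in> {4, 5} then conjugates (sym_group N)
     {p. p permutes {1..N} \<and> (\<forall>i>4. p i = i) \<and>
         (\<forall>i\<in>{1..4}. p ((transpose 1 4 \<circ> transpose 2 3) i) = (transpose 1 4 \<circ> transpose 2 3) (p i))}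
   else {})"

definition young_types :: "nat \<Rightarrow> nat list set" where
  "young_types N =
     (if N = 3 then {[2, 1]}
      else if N = 4 then {[3, 1], [2, 2], [2, 1, 1]}
      else if N = 5 then {[4, 1], [3, 2], [3, 1, 1], [2, 2, 1], [2, 1, 1, 1]}
      else {})"

definition F_hat :: "nat \<Rightarrow> (nat \<Rightarrow> nat) set set" where
  "F_hat N = {{id}, carrier (sym_group N)} \<union> \<Union> (young_subgroups N ` young_types N) \<union>
             dihedral_subgroups N"

definition Theta_exc :: "nat \<Rightarrow> nat \<Rightarrow> ((nat \<Rightarrow> nat) set \<times> (nat \<Rightarrow> nat) set) set" where
  "Theta_exc card_c N =
     {(H, H'). H \<in> F_hat N \<and> H' \<in> F_hat N \<and> H \<lhd> (sym_group N)\<lparr>carrier := H'\<rparr>}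
     - (if card_c \<in> {2, 4, 11, 17} then {({id}, {id})} else {})
     - {{id}} \<times> dihedral_subgroups N"


section \<open>The group attached to a family, and new representations\<close>

text \<open>
  The group attached to a family matters only up to isomorphism, so a group \<open>G0\<close> in which
  elements of the family have representatives \<open>j E\<close> is transported to \<open>\<Gamma>\<close> by an isomorphism.
\<close>

definition transported ::
  "('h, 'n) monoid_scheme \<Rightarrow> 'e set \<Rightarrow> ('e \<Rightarrow> 'h mpair) \<Rightarrow> ('h set \<times> 'h set) set \<Rightarrow>
   ('g, 'm) monoid_scheme \<Rightarrow> ('e \<Rightarrow> 'g mpair set) \<Rightarrow> ('g set \<times> 'g set) set \<Rightarrow> bool" where
  "transported G0 c j \<Theta>0 \<Gamma> \<iota> \<Theta> \<longleftrightarrow>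
     (\<exists>h\<in>iso G0 \<Gamma>.
        (\<forall>E\<in>c. \<iota> E = M_class \<Gamma> (h (fst (j E))) (\<lambda>g. snd (j E) (inv_into (carrier G0) h g))) \<and>
        \<Theta> = (\<lambda>(H, H'). (h ` H, h ` H')) ` \<Theta>0)"

text \<open>
  \<open>family_group r a c \<Gamma> \<iota> \<Theta>\<close>: \<open>\<Gamma>\<close> is the group $\mathcal{G}_c$ attached to the family \<open>c\<close>, \<open>\<iota>\<close> is
  the imbedding $c \to M(\mathcal{G}_c)$ and \<open>\<Theta>\<close> is $\Theta_c$.
\<close>

definition family_group ::
  "nat \<Rightarrow> (nat \<Rightarrow> nat \<Rightarrow> int) \<Rightarrow> (rat mat \<Rightarrow> rat mat) set set \<Rightarrow> ('g, 'm) monoid_scheme \<Rightarrow>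
   ((rat mat \<Rightarrow> rat mat) set \<Rightarrow> 'g mpair set) \<Rightarrow> ('g set \<times> 'g set) set \<Rightarrow> bool" where
  "family_group r a c \<Gamma> \<iota> \<Theta> \<longleftrightarrow>
     (card c = 1 \<and> transported (sym_group 1) c (\<lambda>_. (id, triv_rep)) {({id}, {id})} \<Gamma> \<iota> \<Theta>) \<or>
     (card c > 1 \<and>
       (\<exists>D \<delta> y. \<delta> \<in> {0, 1} \<and>
          (imbedding_BC (weyl_group r a) (simple_reflections r a) c D y \<or>
           imbedding_D (weyl_group r a) (simple_reflections r a) c D y) \<and>
          transported (V_group D \<delta>) c (\<lambda>E. V_pair D \<delta> (y E)) (Theta_V D \<delta>) \<Gamma> \<iota> \<Theta>)) \<or>
     (card c > 1 \<and> exceptional r a \<and>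
       (\<exists>N j. imbedding_exc r a c N j \<and>
          transported (sym_group N) c j (Theta_exc (card c) N) \<Gamma> \<iota> \<Theta>))"

definition underline ::
  "('w, 'm) monoid_scheme \<Rightarrow> ('w \<Rightarrow> rat mat) set set \<Rightarrow> (('w \<Rightarrow> rat mat) set \<Rightarrow> 'g mpair set) \<Rightarrow>
     ('w \<Rightarrow> rat mat) \<Rightarrow> ('g mpair set \<Rightarrow> complex)" where
  "underline W c \<iota> \<E> =
     (\<lambda>m. if m \<in> \<iota> ` c then of_nat (mult_of W (the_inv_into c \<iota> m) \<E>) else 0)"

text \<open>
  A representation in $\mathcal{R}_c$ is determined up to isomorphism by its multiplicities,
  that is by \<open>underline\<close>; so being isomorphic to $E_{H,H'}$ means to satisfy the equation
  defining $E_{H,H'}$.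
\<close>

definition new_rep ::
  "('w, 'm) monoid_scheme \<Rightarrow> ('w \<Rightarrow> rat mat) set set \<Rightarrow> ('g, 'n) monoid_scheme \<Rightarrow>
   (('w \<Rightarrow> rat mat) set \<Rightarrow> 'g mpair set) \<Rightarrow> ('g set \<times> 'g set) set \<Rightarrow> ('w \<Rightarrow> rat mat) \<Rightarrow> bool" where
  "new_rep W c \<Gamma> \<iota> \<Theta> \<E> \<longleftrightarrow> in_R W c \<E> \<and> (\<exists>(H, H')\<in>\<Theta>. underline W c \<iota> \<E> = S_elt \<Gamma> H H')"

end

theory Submission
  imports Defs "Jordan_Normal_Form.Spectral_Radius"
begin

text \<open>
  Only the transform needs an argument, since the coefficients of $S_{H,H'}$ are multiplicities.
  Fix $(y, \rho') \in M(\Gamma)$. For $x \in \Gamma$ the image of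
  $\mathbf{C}[(\Gamma/H)^x] \to \mathbf{C}[(\Gamma/H')^x]$ is the permutation module on the set
  $Y_x$ of the cosets $uH'$ with $u^{-1} x u \in H$; since $H$ is normal in $H'$, this condition
  depends on the coset only (\<open>mem_image_cosets\<close>). The value of the character of this module at
  $y$ is therefore the number of $A \in Y_x$ with $y A = A$ (\<open>carries_tr\<close>). On the other hand it
  is the sum over $\rho$ of the multiplicity of $\rho$ times $\mathrm{tr}(y, \rho)$. So the sum
  over all $(x, \rho)$ in the transform, after writing a sum over conjugacy classes as a sum over
  group elements, collapses (\<open>sum_contributions\<close>, \<open>fourier_S_elt\<close>) to
  \[ |Z(y)|^{-1} \sum_{x \in Z(y)} \overline{\mathrm{tr}(x, \rho')} \; |\{A \in Y_x : y A = A\}| . \]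
  Summing over $A = uH'$ first, the elements $x$ which count for $A$ are those of the subgroup
  $K_A = Z(y) \cap u H u^{-1}$ of $Z(y)$, and $\sum_{x \in K_A} \mathrm{tr}(x, \rho')$ is
  $|K_A|$ times the dimension of the space of $K_A$-invariants of $\rho'$, hence nonnegative
  (\<open>sum_character_nonneg\<close>, \<open>fourier_coefficient_nonneg\<close>).

  Multiplicities are numbers of summands of a given class in a decomposition into irreducible
  representations. That they exist and are given by characters rests on complete reducibility
  (\<open>complete_reducibility\<close>) and on Schur orthogonality (\<open>character_orthogonality\<close>), which are
  proved first, for representations by matrices.

  If $\mathcal{E}$ is a new representation, $\underline{\mathcal{E}}$ equals some $S_{H,H'}$ with
  $(H, H') \in \Theta_c$, so it remains to see that such pairs consist of a subgroup and a normal
  subgroup of it. For exceptional types normality is part of the definition of $\Theta_c$. For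
  classical types the group is abelian and one needs $\mathcal{L} \subset \mathcal{L}'$: all
  members of $\mathcal{F}(V)$ are isotropic (\<open>F_coll_isotropic\<close>), so $\mathcal{L}$ is orthogonal
  to $\mathcal{L}'^{\,!}$, and the pairing of $V^\delta$ with $V^{1-\delta}$ is perfect
  (\<open>V_perp_separates\<close>).
\<close>

section \<open>Matrices and subspaces\<close>

lemma tr_mult_comm:
  fixes A B :: "'k::comm_semiring_0 mat"
  assumes "A \<in> carrier_mat n m" "B \<in> carrier_mat m n"
  shows "tr (A * B) = tr (B * A)"
proof -
  have "tr (A * B) = (\<Sum>i<n. \<Sum>j<m. A $$ (i, j) * B $$ (j, i))"
    using assms by (auto simp: tr_def scalar_prod_def lessThan_atLeast0 intro!: sum.cong)
  also have "\<dots> = (\<Sum>j<m. \<Sum>i<n. B $$ (j, i) * A $$ (i, j))"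
    by (subst sum.swap) (simp add: mult.commute)
  also have "\<dots> = tr (B * A)"
    using assms by (auto simp: tr_def scalar_prod_def lessThan_atLeast0 intro!: sum.cong)
  finally show ?thesis .
qed

lemma tr_one [simp]: "tr (1\<^sub>m n :: 'k::semiring_1 mat) = of_nat n"
  by (simp add: tr_def)

lemma tr_four_block_diag:
  fixes A B :: "'k::comm_monoid_add mat"
  assumes A: "A \<in> carrier_mat n n" and B: "B \<in> carrier_mat m m"
  shows "tr (four_block_mat A (0\<^sub>m n m) (0\<^sub>m m n) B) = tr A + tr B"
proof -
  let ?F = "four_block_mat A (0\<^sub>m n m) (0\<^sub>m m n) B"
  have "tr ?F = (\<Sum>i\<in>{..<n} \<union> {n..<n+m}. ?F $$ (i, i))"
    using A B by (simp add: tr_def) (rule sum.cong, auto)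
  also have "\<dots> = (\<Sum>i<n. ?F $$ (i, i)) + (\<Sum>i\<in>{n..<n+m}. ?F $$ (i, i))"
    by (rule sum.union_disjoint) auto
  also have "(\<Sum>i<n. ?F $$ (i, i)) = tr A"
    using A B by (auto simp: tr_def intro!: sum.cong)
  also have "(\<Sum>i\<in>{n..<n+m}. ?F $$ (i, i)) = (\<Sum>i\<in>{0..<m}. ?F $$ (i + n, i + n))"
    using sum.shift_bounds_nat_ivl[of "\<lambda>i. ?F $$ (i, i)" 0 n m] by (simp add: add.commute)
  also have "\<dots> = tr B"
    using A B by (auto simp: tr_def lessThan_atLeast0 intro!: sum.cong)
  finally show ?thesis .
qed

lemma mult_mat_unit_vec:
  fixes A :: "'k::semiring_1 mat"
  assumes "A \<in> carrier_mat n m" "j < m"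
  shows "A *\<^sub>v unit_vec m j = col A j"
  using assms by (intro eq_vecI) auto

lemma mat_eqI_mult_vec:
  fixes A B :: "'k::semiring_1 mat"
  assumes A: "A \<in> carrier_mat n m" and B: "B \<in> carrier_mat n m"
    and "\<And>v. v \<in> carrier_vec m \<Longrightarrow> A *\<^sub>v v = B *\<^sub>v v"
  shows "A = B"
proof (rule mat_col_eqI)
  show "dim_row A = dim_row B" "dim_col A = dim_col B" using A B by auto
  fix j assume "j < dim_col B"
  then show "col A j = col B j"
    using assms(3)[of "unit_vec m j"] A B by (simp add: mult_mat_unit_vec)
qed

text \<open>The columns of the inverse are preimages of the unit vectors. That a matrix with a two-sided
  inverse is square follows by taking traces (\<open>two_sided_inverse_square\<close>).\<close>

lemma inverse_of_bijective:
  fixes X :: "'k::comm_ring_1 mat"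
  assumes X: "X \<in> carrier_mat n m"
    and inj: "\<And>v. v \<in> carrier_vec m \<Longrightarrow> X *\<^sub>v v = 0\<^sub>v n \<Longrightarrow> v = 0\<^sub>v m"
    and surj: "\<And>w. w \<in> carrier_vec n \<Longrightarrow> \<exists>v\<in>carrier_vec m. X *\<^sub>v v = w"
  obtains Q where "Q \<in> carrier_mat m n" "X * Q = 1\<^sub>m n" "Q * X = 1\<^sub>m m"
proof -
  obtain f where f: "\<And>w. w \<in> carrier_vec n \<Longrightarrow> f w \<in> carrier_vec m \<and> X *\<^sub>v f w = w"
    using surj by metis
  define Q where "Q = mat m n (\<lambda>(k, i). f (unit_vec n i) $ k)"
  have Q: "Q \<in> carrier_mat m n" by (simp add: Q_def)
  have colQ: "col Q i = f (unit_vec n i)" if "i < n" for i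
    using that f[of "unit_vec n i"] by (intro eq_vecI) (auto simp: Q_def)
  have XQ: "X * Q = 1\<^sub>m n"
  proof (rule mat_col_eqI)
    fix j assume "j < dim_col (1\<^sub>m n :: 'k mat)"
    then have j: "j < n" by simp
    show "col (X * Q) j = col (1\<^sub>m n) j"
      using j col_mult2[OF X Q j] f[of "unit_vec n j"] by (simp add: colQ)
  qed (use X Q in auto)
  have "Q * X = 1\<^sub>m m"
  proof (rule mat_eqI_mult_vec)
    show "Q * X \<in> carrier_mat m m" using Q X by auto
    fix v :: "'k vec" assume v: "v \<in> carrier_vec m"
    have QXv: "(Q * X) *\<^sub>v v \<in> carrier_vec m" using Q X v by auto
    have "X *\<^sub>v ((Q * X) *\<^sub>v v) = (X * Q) *\<^sub>v (X *\<^sub>v v)"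
      using Q X v by (simp add: assoc_mult_mat_vec)
    also have "\<dots> = X *\<^sub>v v" using X v by (simp add: XQ)
    finally have "X *\<^sub>v ((Q * X) *\<^sub>v v - v) = 0\<^sub>v n"
      using mult_minus_distrib_mat_vec[OF X QXv v] X v by simp
    then have z: "(Q * X) *\<^sub>v v - v = 0\<^sub>v m" using inj QXv v by auto
    have "(Q * X) *\<^sub>v v = v"
    proof (rule eq_vecI)
      fix i assume "i < dim_vec v"
      then have i: "i < m" using v by auto
      have "((Q * X) *\<^sub>v v - v) $ i = 0" using z i by simp
      then show "((Q * X) *\<^sub>v v) $ i = v $ i" using i v QXv by auto
    qed (use Q v in auto)
    then show "(Q * X) *\<^sub>v v = 1\<^sub>m m *\<^sub>v v" using v by simp
  qed simp
  with Q XQ that show ?thesis by blast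
qed

lemma two_sided_inverse_square:
  fixes X Q :: "'k::field_char_0 mat"
  assumes "X \<in> carrier_mat n m" "Q \<in> carrier_mat m n" "X * Q = 1\<^sub>m n" "Q * X = 1\<^sub>m m"
  shows "n = m"
  using tr_mult_comm[OF assms(1,2)] assms(3,4) by simp

lemma invertible_matI:
  assumes "X \<in> carrier_mat n n" "Q \<in> carrier_mat n n" "X * Q = 1\<^sub>m n" "Q * X = 1\<^sub>m n"
  shows "invertible_mat X"
  using assms by (auto simp: invertible_mat_def inverts_mat_def square_mat.simps)

lemma invertible_matE:
  assumes "invertible_mat X" "X \<in> carrier_mat n n"
  obtains Q where "Q \<in> carrier_mat n n" "X * Q = 1\<^sub>m n" "Q * X = 1\<^sub>m n"
proof -
  obtain Q where Q: "X * Q = 1\<^sub>m (dim_row X)" "Q * X = 1\<^sub>m (dim_row Q)"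
    using assms(1) by (auto simp: invertible_mat_def inverts_mat_def)
  have "dim_col Q = n" using arg_cong[OF Q(1), of dim_col] assms(2) by simp
  moreover have "dim_row Q = n" using arg_cong[OF Q(2), of dim_col] assms(2) by simp
  ultimately show ?thesis using Q assms(2) by (intro that[of Q]) auto
qed

text \<open>One step of the construction of a basis of \<open>U\<close>. The columns of \<open>B\<close> are independent
  vectors of \<open>U\<close>, with the rows of \<open>C\<close> as dual functionals. Subtracting from \<open>u\<close> its projection
  \<open>B C u\<close> leaves a nonzero vector \<open>w\<close> of \<open>U\<close> killed by \<open>C\<close>, which is the new column.\<close>

lemma extend_partial_basis:
  fixes B C :: "'k::field mat"
  assumes U: "lin_subspace n U"
    and B: "B \<in> carrier_mat n k" and C: "C \<in> carrier_mat k n" and CB: "C * B = 1\<^sub>m k"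
    and BU: "\<And>v. v \<in> carrier_vec k \<Longrightarrow> B *\<^sub>v v \<in> U"
    and u: "u \<in> U" "B *\<^sub>v (C *\<^sub>v u) \<noteq> u"
  shows "\<exists>B'\<in>carrier_mat n (Suc k). \<exists>C'\<in>carrier_mat (Suc k) n.
           C' * B' = 1\<^sub>m (Suc k) \<and> (\<forall>v\<in>carrier_vec (Suc k). B' *\<^sub>v v \<in> U)"
proof -
  have UD: "U \<subseteq> carrier_vec n" "\<And>v w. v \<in> U \<Longrightarrow> w \<in> U \<Longrightarrow> v + w \<in> U"
      "\<And>a v. v \<in> U \<Longrightarrow> a \<cdot>\<^sub>v v \<in> U"
    using U by (auto simp: lin_subspace_def)
  have uc: "u \<in> carrier_vec n" using u UD by auto
  define D where "D = 1\<^sub>m n - B * C"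
  have D: "D \<in> carrier_mat n n" using B C by (auto simp: D_def)
  have Dv: "D *\<^sub>v v = v - B *\<^sub>v (C *\<^sub>v v)" if "v \<in> carrier_vec n" for v
    using that B C by (simp add: D_def minus_mult_distrib_mat_vec[of _ n n] assoc_mult_mat_vec)
  have "C * (B * C) = C" using assoc_mult_mat[OF C B C] CB C by simp
  then have CD: "C * D = 0\<^sub>m k n"
    using B C mult_minus_distrib_mat[of C k n "1\<^sub>m n" n "B * C"] by (simp add: D_def)
  have "B * C * B = B" using assoc_mult_mat[OF B C B] CB B by simp
  then have DB: "D * B = 0\<^sub>m n k"
    using B C minus_mult_distrib_mat[of "1\<^sub>m n" n n "B * C" B k] by (simp add: D_def)
  have "D * D = D - B * C * D"
    using D B C minus_mult_distrib_mat[of "1\<^sub>m n" n n "B * C" D n] by (simp add: D_def[symmetric])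
  also have "B * C * D = 0\<^sub>m n n" using assoc_mult_mat[OF B C D] CD B by simp
  finally have DD: "D * D = D" using D by (auto intro!: eq_matI)
  define w where "w = D *\<^sub>v u"
  have wc: "w \<in> carrier_vec n" using D uc by (auto simp: w_def)
  have "w = u + (-1) \<cdot>\<^sub>v (B *\<^sub>v (C *\<^sub>v u))"
    using B C uc by (intro eq_vecI) (auto simp: w_def Dv)
  then have wU: "w \<in> U" using UD u BU C uc by auto
  have w0: "w \<noteq> 0\<^sub>v n"
  proof
    assume "w = 0\<^sub>v n"
    have "u = B *\<^sub>v (C *\<^sub>v u)"
    proof (rule eq_vecI)
      fix i assume "i < dim_vec (B *\<^sub>v (C *\<^sub>v u))"
      then have i: "i < n" using B by auto
      have "w $ i = u $ i - (B *\<^sub>v (C *\<^sub>v u)) $ i" using i B uc by (simp add: w_def Dv)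
      then show "u $ i = (B *\<^sub>v (C *\<^sub>v u)) $ i" using \<open>w = 0\<^sub>v n\<close> i by simp
    qed (use uc B in auto)
    then show False using u by simp
  qed
  \<comment> \<open>The new functional is the \<open>l\<close>-th coordinate of \<open>D\<close>, scaled to be \<open>1\<close> at \<open>w\<close>.\<close>
  obtain l where l: "l < n" "w $ l \<noteq> 0"
  proof (rule ccontr)
    assume "\<not> thesis"
    then have "w = 0\<^sub>v n" using that wc by (intro eq_vecI) auto
    then show False using w0 by simp
  qed
  have Dw: "D *\<^sub>v w = w" using D uc by (simp add: w_def DD flip: assoc_mult_mat_vec)
  have Cw: "C *\<^sub>v w = 0\<^sub>v k"
    using C D uc by (simp add: w_def CD flip: assoc_mult_mat_vec) (auto intro!: eq_vecI)
  define c where "c = (1 / w $ l) \<cdot>\<^sub>v row D l"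
  have cc: "c \<in> carrier_vec n" using D by (auto simp: c_def)
  have cw: "c \<bullet> w = 1"
  proof -
    have "row D l \<bullet> w = w $ l" using Dw l D by (metis index_mult_mat_vec carrier_matD(1))
    then show ?thesis using l wc D by (simp add: c_def)
  qed
  have cB: "c \<bullet> col B j = 0" if "j < k" for j
  proof -
    have "row D l \<bullet> col B j = (D * B) $$ (l, j)" using that l D B by simp
    then show ?thesis using that l DB B D by (simp add: c_def)
  qed
  define B' where "B' = mat n (Suc k) (\<lambda>(i, j). if j < k then B $$ (i, j) else w $ i)"
  define C' where "C' = mat (Suc k) n (\<lambda>(i, j). if i < k then C $$ (i, j) else c $ j)"
  have B': "B' \<in> carrier_mat n (Suc k)" and C': "C' \<in> carrier_mat (Suc k) n"
    by (auto simp: B'_def C'_def)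
  have cols: "col B' j = (if j < k then col B j else w)" if "j < Suc k" for j
    using that B wc by (intro eq_vecI) (auto simp: B'_def)
  have rows: "row C' i = (if i < k then row C i else c)" if "i < Suc k" for i
    using that C cc by (intro eq_vecI) (auto simp: C'_def)
  have "C' * B' = 1\<^sub>m (Suc k)"
  proof (rule eq_matI)
    fix i j assume "i < dim_row (1\<^sub>m (Suc k) :: 'k mat)" "j < dim_col (1\<^sub>m (Suc k) :: 'k mat)"
    then have ij: "i < Suc k" "j < Suc k" by auto
    have 1: "row C i \<bullet> col B j = (if i = j then 1 else 0)" if "i < k" "j < k"
      using that arg_cong[OF CB, of "\<lambda>M. M $$ (i, j)"] B C by simp
    have 2: "row C i \<bullet> w = 0" if "i < k"
      using that arg_cong[OF Cw, of "\<lambda>v. v $ i"] C by simp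
    show "(C' * B') $$ (i, j) = 1\<^sub>m (Suc k) $$ (i, j)"
      using ij B' C' 1 2 cw cB by (auto simp: cols rows less_Suc_eq)
  qed (use B' C' in auto)
  moreover have "B' *\<^sub>v v \<in> U" if v: "v \<in> carrier_vec (Suc k)" for v
  proof -
    define v0 where "v0 = vec k (\<lambda>j. v $ j)"
    have "B' *\<^sub>v v = B *\<^sub>v v0 + (v $ k) \<cdot>\<^sub>v w"
      using v B wc
      by (intro eq_vecI) (auto simp: B'_def v0_def scalar_prod_def intro!: sum.cong)
    then show ?thesis using UD BU wU by (auto simp: v0_def)
  qed
  ultimately show ?thesis using B' C' by blast
qed

text \<open>The columns of \<open>B\<close> are a basis of \<open>U\<close> and \<open>B * C\<close> is a projection onto \<open>U\<close>. The basis is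
  extended one vector at a time; this stops at the latest when it has \<open>n\<close> members, because a
  one-sided inverse of a square matrix is two-sided.\<close>

lemma subspace_basis:
  fixes U :: "'k::field vec set"
  assumes U: "lin_subspace n U"
  obtains k B C where "B \<in> carrier_mat n k" "C \<in> carrier_mat k n" "C * B = 1\<^sub>m k"
    "\<forall>v\<in>carrier_vec k. B *\<^sub>v v \<in> U" "\<forall>u\<in>U. B *\<^sub>v (C *\<^sub>v u) = u"
proof -
  let ?part = "\<lambda>k B C. B \<in> carrier_mat n k \<and> C \<in> carrier_mat k n \<and> C * B = 1\<^sub>m k \<and>
                 (\<forall>v\<in>carrier_vec k. B *\<^sub>v v \<in> U)"
  have extend: "\<exists>k B C. ?part k B C \<and> (\<forall>u\<in>U. B *\<^sub>v (C *\<^sub>v u) = u)" if "k \<le> n" "?part k B C" for k B C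
    using that
  proof (induction k arbitrary: B C rule: inc_induct)
    case base
    then have "B * C = 1\<^sub>m n" using mat_mult_left_right_inverse[of C n B] by blast
    moreover have "U \<subseteq> carrier_vec n" using U by (simp add: lin_subspace_def)
    ultimately have "B *\<^sub>v (C *\<^sub>v u) = u" if "u \<in> U" for u
      using base that assoc_mult_mat_vec[of B n n C n u] by auto
    then have "?part n B C \<and> (\<forall>u\<in>U. B *\<^sub>v (C *\<^sub>v u) = u)" using base by simp
    then show ?case by (intro exI)
  next
    case (step k)
    show ?case
    proof (cases "\<forall>u\<in>U. B *\<^sub>v (C *\<^sub>v u) = u")
      case False
      then obtain u where u: "u \<in> U" "B *\<^sub>v (C *\<^sub>v u) \<noteq> u" by blast
      obtain B' C' where "?part (Suc k) B' C'"
        using extend_partial_basis[OF U _ _ _ _ u, of k] step.prems by blast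
      then show ?thesis by (rule step.IH)
    next
      case True
      with step.prems have "?part k B C \<and> (\<forall>u\<in>U. B *\<^sub>v (C *\<^sub>v u) = u)" by simp
      then show ?thesis by (intro exI)
    qed
  qed
  have start: "?part 0 (0\<^sub>m n 0) (0\<^sub>m 0 n)"
  proof -
    have "(0\<^sub>m n 0 :: 'k mat) *\<^sub>v v = 0\<^sub>v n" if "v \<in> carrier_vec 0" for v :: "'k vec"
      using that by (intro eq_vecI) (auto simp: scalar_prod_def)
    moreover have "(0\<^sub>m 0 n * 0\<^sub>m n 0 :: 'k mat) = 1\<^sub>m 0" by (rule eq_matI) auto
    ultimately show ?thesis using U by (auto simp: lin_subspace_def)
  qed
  obtain k B C where "?part k B C \<and> (\<forall>u\<in>U. B *\<^sub>v (C *\<^sub>v u) = u)"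
    using extend[OF le0 start] by (elim exE) (rule that, assumption)
  then show thesis using that[of B k C] by simp
qed

lemma mult_mat_zero_vec:
  fixes X :: "'k::semiring_0 mat"
  assumes "X \<in> carrier_mat n m"
  shows "X *\<^sub>v 0\<^sub>v m = 0\<^sub>v n"
  using assms by (intro eq_vecI) auto

lemma lin_subspace_kernel:
  fixes X :: "'k::field mat"
  assumes X: "X \<in> carrier_mat n m"
  shows "lin_subspace m {v \<in> carrier_vec m. X *\<^sub>v v = 0\<^sub>v n}"
  unfolding lin_subspace_def
proof (intro conjI ballI allI)
  show "0\<^sub>v m \<in> {v \<in> carrier_vec m. X *\<^sub>v v = 0\<^sub>v n}"
    using mult_mat_zero_vec[OF X] by simp
  fix v assume v: "v \<in> {v \<in> carrier_vec m. X *\<^sub>v v = 0\<^sub>v n}"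
  show "a \<cdot>\<^sub>v v \<in> {v \<in> carrier_vec m. X *\<^sub>v v = 0\<^sub>v n}" for a
  proof -
    have "X *\<^sub>v (a \<cdot>\<^sub>v v) = a \<cdot>\<^sub>v 0\<^sub>v n" using v mult_mat_vec[OF X, of v a] by simp
    also have "\<dots> = 0\<^sub>v n" by (rule eq_vecI) simp_all
    finally show ?thesis using v by simp
  qed
  fix w assume w: "w \<in> {v \<in> carrier_vec m. X *\<^sub>v v = 0\<^sub>v n}"
  show "v + w \<in> {v \<in> carrier_vec m. X *\<^sub>v v = 0\<^sub>v n}"
    using v w mult_add_distrib_mat_vec[OF X] by simp
qed auto

lemma lin_subspace_range:
  fixes X :: "'k::field mat"
  assumes X: "X \<in> carrier_mat n m"
  shows "lin_subspace n ((*\<^sub>v) X ` carrier_vec m)"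
  unfolding lin_subspace_def
proof (intro conjI ballI allI)
  show "0\<^sub>v n \<in> (*\<^sub>v) X ` carrier_vec m"
    using mult_mat_zero_vec[OF X] by (intro image_eqI[of _ _ "0\<^sub>v m"]) auto
  fix v assume "v \<in> (*\<^sub>v) X ` carrier_vec m"
  then obtain v' where v': "v = X *\<^sub>v v'" "v' \<in> carrier_vec m" by auto
  show "a \<cdot>\<^sub>v v \<in> (*\<^sub>v) X ` carrier_vec m" for a
    using v' mult_mat_vec[OF X, of v' a] by (intro image_eqI[of _ _ "a \<cdot>\<^sub>v v'"]) auto
  fix w assume "w \<in> (*\<^sub>v) X ` carrier_vec m"
  then obtain w' where w': "w = X *\<^sub>v w'" "w' \<in> carrier_vec m" by auto
  show "v + w \<in> (*\<^sub>v) X ` carrier_vec m"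
    using v' w' mult_add_distrib_mat_vec[OF X, of v' w']
    by (intro image_eqI[of _ _ "v' + w'"]) auto
qed (use X in auto)

text \<open>An idempotent is the projection onto its range, so a basis \<open>B\<close> of the range and the
  coordinates \<open>C\<close> of the projected vector factor it.\<close>

lemma idempotent_splits:
  fixes E :: "'k::field mat"
  assumes E: "E \<in> carrier_mat n n" and EE: "E * E = E"
  obtains k B C where "B \<in> carrier_mat n k" "C \<in> carrier_mat k n" "C * B = 1\<^sub>m k" "B * C = E"
proof -
  obtain k B C where B: "B \<in> carrier_mat n k" and C: "C \<in> carrier_mat k n" and CB: "C * B = 1\<^sub>m k"
    and BU: "\<forall>v\<in>carrier_vec k. B *\<^sub>v v \<in> (*\<^sub>v) E ` carrier_vec n"
    and BC: "\<forall>u\<in>(*\<^sub>v) E ` carrier_vec n. B *\<^sub>v (C *\<^sub>v u) = u"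
    using subspace_basis[OF lin_subspace_range[OF E]] .
  have EB: "E * B = B"
  proof (rule mat_eqI_mult_vec)
    fix v :: "'k vec" assume v: "v \<in> carrier_vec k"
    obtain u where u: "u \<in> carrier_vec n" "B *\<^sub>v v = E *\<^sub>v u" using BU v by blast
    have "(E * B) *\<^sub>v v = E *\<^sub>v (E *\<^sub>v u)"
      using assoc_mult_mat_vec[OF E B v] by (simp only: u(2))
    also have "\<dots> = (E * E) *\<^sub>v u" using assoc_mult_mat_vec[OF E E u(1)] by (simp only:)
    finally show "(E * B) *\<^sub>v v = B *\<^sub>v v" by (simp only: EE u(2))
  qed (use E B in auto)
  have BCE: "B * (C * E) = E"
  proof (rule mat_eqI_mult_vec)
    fix v :: "'k vec" assume v: "v \<in> carrier_vec n"
    have "(B * (C * E)) *\<^sub>v v = B *\<^sub>v (C *\<^sub>v (E *\<^sub>v v))"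
      using assoc_mult_mat_vec[OF B mult_carrier_mat[OF C E] v] assoc_mult_mat_vec[OF C E v]
      by (simp only:)
    then show "(B * (C * E)) *\<^sub>v v = E *\<^sub>v v" using BC v by simp
  qed (use B C E in auto)
  show thesis
    using that[OF B mult_carrier_mat[OF C E] _ BCE] assoc_mult_mat[OF C E B]
    by (simp only: EB CB)
qed

text \<open>The trace of an idempotent \<open>B * C\<close> is that of \<open>C * B = 1\<close>, that is, its rank.\<close>

lemma tr_idempotent:
  fixes E :: "'k::field mat"
  assumes "E \<in> carrier_mat n n" "E * E = E"
  shows "\<exists>k. tr E = of_nat k"
proof -
  obtain k B C where "B \<in> carrier_mat n k" "C \<in> carrier_mat k n" "C * B = 1\<^sub>m k" "B * C = E"
    using idempotent_splits[OF assms] .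
  then show ?thesis using tr_mult_comm[of B n k C] by auto
qed

text \<open>The dimensions are arguments because the summands do not determine them when \<open>S\<close> is empty.\<close>

definition mat_sum :: "nat \<Rightarrow> nat \<Rightarrow> ('i \<Rightarrow> 'k::comm_monoid_add mat) \<Rightarrow> 'i set \<Rightarrow> 'k mat" where
  "mat_sum n m F S = mat n m (\<lambda>ij. \<Sum>s\<in>S. F s $$ ij)"

lemma mat_sum_carrier [simp]: "mat_sum n m F S \<in> carrier_mat n m"
  and mat_sum_dim [simp]: "dim_row (mat_sum n m F S) = n" "dim_col (mat_sum n m F S) = m"
  by (auto simp: mat_sum_def)

lemma mat_sum_cong:
  "S = S' \<Longrightarrow> (\<And>s. s \<in> S' \<Longrightarrow> F s = F' s) \<Longrightarrow> mat_sum n m F S = mat_sum n m F' S'"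
  by (simp add: mat_sum_def)

lemma mat_sum_reindex: "bij_betw h S S' \<Longrightarrow> mat_sum n m F S' = mat_sum n m (\<lambda>s. F (h s)) S"
  unfolding mat_sum_def by (subst sum.reindex_bij_betw[of h S S', symmetric]) auto

lemma mult_mat_sum:
  fixes F :: "'i \<Rightarrow> 'k::semiring_0 mat"
  assumes "A \<in> carrier_mat l n" "\<And>s. s \<in> S \<Longrightarrow> F s \<in> carrier_mat n m"
  shows "A * mat_sum n m F S = mat_sum l m (\<lambda>s. A * F s) S"
proof (rule eq_matI)
  fix i j assume ij: "i < dim_row (mat_sum l m (\<lambda>s. A * F s) S)" "j < dim_col (mat_sum l m (\<lambda>s. A * F s) S)"
  have "(A * mat_sum n m F S) $$ (i, j) = (\<Sum>k = 0..<n. \<Sum>s\<in>S. A $$ (i, k) * F s $$ (k, j))"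
    using ij assms(1) by (simp add: scalar_prod_def mat_sum_def sum_distrib_left)
  also have "\<dots> = (\<Sum>s\<in>S. \<Sum>k = 0..<n. A $$ (i, k) * F s $$ (k, j))" by (rule sum.swap)
  also have "\<dots> = (\<Sum>s\<in>S. (A * F s) $$ (i, j))"
    using ij assms(1) by (intro sum.cong refl) (simp add: scalar_prod_def carrier_matD[OF assms(2)])
  finally show "(A * mat_sum n m F S) $$ (i, j) = mat_sum l m (\<lambda>s. A * F s) S $$ (i, j)"
    using ij by (simp add: mat_sum_def)
qed (use assms in auto)

lemma mat_sum_mult:
  fixes F :: "'i \<Rightarrow> 'k::semiring_0 mat"
  assumes "A \<in> carrier_mat m l" "\<And>s. s \<in> S \<Longrightarrow> F s \<in> carrier_mat n m"
  shows "mat_sum n m F S * A = mat_sum n l (\<lambda>s. F s * A) S"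
proof (rule eq_matI)
  fix i j assume ij: "i < dim_row (mat_sum n l (\<lambda>s. F s * A) S)" "j < dim_col (mat_sum n l (\<lambda>s. F s * A) S)"
  have "(mat_sum n m F S * A) $$ (i, j) = (\<Sum>k = 0..<m. \<Sum>s\<in>S. F s $$ (i, k) * A $$ (k, j))"
    using ij assms(1) by (simp add: scalar_prod_def mat_sum_def sum_distrib_right)
  also have "\<dots> = (\<Sum>s\<in>S. \<Sum>k = 0..<m. F s $$ (i, k) * A $$ (k, j))" by (rule sum.swap)
  also have "\<dots> = (\<Sum>s\<in>S. (F s * A) $$ (i, j))"
    using ij assms(1) by (intro sum.cong refl) (simp add: scalar_prod_def carrier_matD[OF assms(2)])
  finally show "(mat_sum n m F S * A) $$ (i, j) = mat_sum n l (\<lambda>s. F s * A) S $$ (i, j)"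
    using ij by (simp add: mat_sum_def)
qed (use assms in auto)

lemma tr_mat_sum:
  assumes "\<And>s. s \<in> S \<Longrightarrow> F s \<in> carrier_mat n n"
  shows "tr (mat_sum n n F S) = (\<Sum>s\<in>S. tr (F s))"
proof -
  have "tr (mat_sum n n F S) = (\<Sum>s\<in>S. \<Sum>i<n. F s $$ (i, i))"
    unfolding tr_def mat_sum_def by simp (rule sum.swap)
  also have "\<dots> = (\<Sum>s\<in>S. tr (F s))"
    by (intro sum.cong refl) (simp add: tr_def carrier_matD[OF assms])
  finally show ?thesis .
qed

lemma mat_sum_const:
  fixes A :: "'k::semiring_1 mat"
  assumes "A \<in> carrier_mat n m"
  shows "mat_sum n m (\<lambda>_. A) S = of_nat (card S) \<cdot>\<^sub>m A"
proof (rule eq_matI)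
  fix i j assume "i < dim_row (of_nat (card S) \<cdot>\<^sub>m A)" "j < dim_col (of_nat (card S) \<cdot>\<^sub>m A)"
  then have ij: "i < n" "j < m" using assms by auto
  have "mat_sum n m (\<lambda>_. A) S $$ (i, j) = (\<Sum>s\<in>S. A $$ (i, j))"
    using ij by (simp only: mat_sum_def index_mat(1) split)
  also have "\<dots> = of_nat (card S) * A $$ (i, j)" by (rule sum_constant)
  finally show "mat_sum n m (\<lambda>_. A) S $$ (i, j) = (of_nat (card S) \<cdot>\<^sub>m A) $$ (i, j)"
    using ij assms by auto
qed (use assms in auto)

section \<open>Isomorphisms of representations and Schur's lemma\<close>

lemma is_repD:
  assumes "is_rep G \<rho>"
  shows "g \<in> carrier G \<Longrightarrow> \<rho> g \<in> carrier_mat (rep_dim G \<rho>) (rep_dim G \<rho>)"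
    and "\<rho> \<one>\<^bsub>G\<^esub> = 1\<^sub>m (rep_dim G \<rho>)"
    and "g \<in> carrier G \<Longrightarrow> h \<in> carrier G \<Longrightarrow> \<rho> (g \<otimes>\<^bsub>G\<^esub> h) = \<rho> g * \<rho> h"
  using assms by (auto simp: is_rep_def)

lemma is_repI:
  assumes "\<And>g. g \<in> carrier G \<Longrightarrow> \<rho> g \<in> carrier_mat n n" "\<rho> \<one>\<^bsub>G\<^esub> = 1\<^sub>m n"
    and "\<And>g h. g \<in> carrier G \<Longrightarrow> h \<in> carrier G \<Longrightarrow> \<rho> (g \<otimes>\<^bsub>G\<^esub> h) = \<rho> g * \<rho> h"
  shows "is_rep G \<rho>" "rep_dim G \<rho> = n"
  using assms by (auto simp: is_rep_def rep_dim_def)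

lemma irreducible_repD:
  assumes "irreducible_rep G \<rho>"
  shows "is_rep G \<rho>" "0 < rep_dim G \<rho>"
    and "lin_subspace (rep_dim G \<rho>) U \<Longrightarrow>
         (\<And>g v. g \<in> carrier G \<Longrightarrow> v \<in> U \<Longrightarrow> \<rho> g *\<^sub>v v \<in> U) \<Longrightarrow>
         U = {0\<^sub>v (rep_dim G \<rho>)} \<or> U = carrier_vec (rep_dim G \<rho>)"
  using assms by (auto simp: irreducible_rep_def)

context group
begin

lemma is_rep_inv:
  assumes "is_rep G \<rho>" "g \<in> carrier G"
  shows "\<rho> g * \<rho> (inv g) = 1\<^sub>m (rep_dim G \<rho>)" "\<rho> (inv g) * \<rho> g = 1\<^sub>m (rep_dim G \<rho>)"
  using is_repD(3)[OF assms(1), of g "inv g"] is_repD(3)[OF assms(1), of "inv g" g]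
    is_repD(2)[OF assms(1)] assms(2) by auto

lemma rep_isoI:
  fixes \<rho> \<sigma> :: "'a \<Rightarrow> 'k::field_char_0 mat"
  assumes \<rho>: "is_rep G \<rho>" and \<sigma>: "is_rep G \<sigma>"
    and P: "P \<in> carrier_mat (rep_dim G \<sigma>) (rep_dim G \<rho>)"
    and Q: "Q \<in> carrier_mat (rep_dim G \<rho>) (rep_dim G \<sigma>)"
    and inv: "P * Q = 1\<^sub>m (rep_dim G \<sigma>)" "Q * P = 1\<^sub>m (rep_dim G \<rho>)"
    and int: "\<And>g. g \<in> carrier G \<Longrightarrow> P * \<rho> g = \<sigma> g * P"
  shows "rep_iso G \<rho> \<sigma>"
proof -
  have "rep_dim G \<sigma> = rep_dim G \<rho>" by (rule two_sided_inverse_square[OF P Q inv])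
  then show ?thesis
    using assms by (auto simp: rep_iso_def intro!: bexI[of _ P] invertible_matI[of P _ Q])
qed

lemma rep_isoE:
  fixes \<rho> \<sigma> :: "'a \<Rightarrow> 'k::field mat"
  assumes "rep_iso G \<rho> \<sigma>"
  obtains P Q where "P \<in> carrier_mat (rep_dim G \<rho>) (rep_dim G \<rho>)"
    "Q \<in> carrier_mat (rep_dim G \<rho>) (rep_dim G \<rho>)"
    "P * Q = 1\<^sub>m (rep_dim G \<rho>)" "Q * P = 1\<^sub>m (rep_dim G \<rho>)"
    "\<And>g. g \<in> carrier G \<Longrightarrow> P * \<rho> g = \<sigma> g * P"
    "is_rep G \<rho>" "is_rep G \<sigma>" "rep_dim G \<sigma> = rep_dim G \<rho>"
  using assms unfolding rep_iso_def by (metis invertible_matE)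

lemma rep_iso_refl:
  fixes \<rho> :: "'a \<Rightarrow> 'k::field_char_0 mat"
  assumes "is_rep G \<rho>"
  shows "rep_iso G \<rho> \<rho>"
  by (rule rep_isoI[of _ _ "1\<^sub>m (rep_dim G \<rho>)" "1\<^sub>m (rep_dim G \<rho>)"])
    (use assms is_repD(1)[OF assms] left_mult_one_mat right_mult_one_mat in \<open>fastforce+\<close>)

lemma rep_iso_sym:
  fixes \<rho> \<sigma> :: "'a \<Rightarrow> 'k::field_char_0 mat"
  assumes "rep_iso G \<rho> \<sigma>"
  shows "rep_iso G \<sigma> \<rho>"
proof -
  let ?n = "rep_dim G \<rho>"
  obtain P Q where PQ: "P \<in> carrier_mat ?n ?n" "Q \<in> carrier_mat ?n ?n" "P * Q = 1\<^sub>m ?n"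
    "Q * P = 1\<^sub>m ?n" and int: "\<And>g. g \<in> carrier G \<Longrightarrow> P * \<rho> g = \<sigma> g * P"
    and reps: "is_rep G \<rho>" "is_rep G \<sigma>" and dim: "rep_dim G \<sigma> = ?n"
    using rep_isoE[OF assms] by blast
  have "Q * \<sigma> g = \<rho> g * Q" if g: "g \<in> carrier G" for g
  proof -
    have c: "\<rho> g \<in> carrier_mat ?n ?n" "\<sigma> g \<in> carrier_mat ?n ?n"
      using is_repD(1)[OF reps(1) g] is_repD(1)[OF reps(2) g] dim by auto
    have "Q * \<sigma> g = Q * (\<sigma> g * (P * Q))" using c PQ by simp
    also have "\<dots> = Q * ((P * \<rho> g) * Q)" using c PQ int[OF g] by (simp add: assoc_mult_mat[of _ ?n ?n])
    also have "\<dots> = (Q * P) * (\<rho> g * Q)"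
      using c PQ(1,2) by (simp add: assoc_mult_mat[of _ ?n ?n _ ?n _ ?n] del: PQ)
    also have "\<dots> = \<rho> g * Q" using c PQ by (simp only: PQ) simp
    finally show ?thesis .
  qed
  then show ?thesis using PQ reps dim by (intro rep_isoI[of _ _ Q P]) auto
qed

lemma rep_iso_trans:
  fixes \<rho> \<sigma> \<tau> :: "'a \<Rightarrow> 'k::field_char_0 mat"
  assumes "rep_iso G \<rho> \<sigma>" "rep_iso G \<sigma> \<tau>"
  shows "rep_iso G \<rho> \<tau>"
proof -
  let ?n = "rep_dim G \<rho>"
  obtain P Q where PQ: "P \<in> carrier_mat ?n ?n" "Q \<in> carrier_mat ?n ?n" "P * Q = 1\<^sub>m ?n"
    "Q * P = 1\<^sub>m ?n" and int: "\<And>g. g \<in> carrier G \<Longrightarrow> P * \<rho> g = \<sigma> g * P"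
    and reps: "is_rep G \<rho>" "is_rep G \<sigma>" and dim: "rep_dim G \<sigma> = ?n"
    using rep_isoE[OF assms(1)] by blast
  obtain P' Q' where PQ': "P' \<in> carrier_mat ?n ?n" "Q' \<in> carrier_mat ?n ?n" "P' * Q' = 1\<^sub>m ?n"
    "Q' * P' = 1\<^sub>m ?n" and int': "\<And>g. g \<in> carrier G \<Longrightarrow> P' * \<sigma> g = \<tau> g * P'"
    and reps': "is_rep G \<tau>" and dim': "rep_dim G \<tau> = ?n"
    using rep_isoE[OF assms(2)] dim by metis
  note assoc = assoc_mult_mat[of _ ?n ?n _ ?n _ ?n]
  have "(P' * P) * \<rho> g = \<tau> g * (P' * P)" if g: "g \<in> carrier G" for g
  proof -
    have c: "\<rho> g \<in> carrier_mat ?n ?n" "\<sigma> g \<in> carrier_mat ?n ?n" "\<tau> g \<in> carrier_mat ?n ?n"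
      using is_repD(1)[OF reps(1) g] is_repD(1)[OF reps(2) g] is_repD(1)[OF reps' g] dim dim' by auto
    have "(P' * P) * \<rho> g = P' * (P * \<rho> g)" using c PQ PQ' by (simp add: assoc)
    also have "\<dots> = (P' * \<sigma> g) * P" using c PQ PQ' by (simp add: int[OF g] assoc)
    also have "\<dots> = \<tau> g * (P' * P)" using c PQ PQ' by (simp add: int'[OF g] assoc)
    finally show ?thesis .
  qed
  moreover have "(P' * P) * (Q * Q') = 1\<^sub>m ?n"
  proof -
    have "(P' * P) * (Q * Q') = P' * ((P * Q) * Q')" using PQ(1,2) PQ'(1,2) by (simp add: assoc)
    then show ?thesis using PQ PQ' by simp
  qed
  moreover have "(Q * Q') * (P' * P) = 1\<^sub>m ?n"
  proof -
    have "(Q * Q') * (P' * P) = Q * ((Q' * P') * P)" using PQ(1,2) PQ'(1,2) by (simp add: assoc)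
    then show ?thesis using PQ PQ' by simp
  qed
  ultimately show ?thesis
    using PQ(1,2) PQ'(1,2) reps reps' dim dim' by (intro rep_isoI[of _ _ "P' * P" "Q * Q'"]) auto
qed

lemma rep_iso_cong:
  fixes \<rho> \<sigma> :: "'a \<Rightarrow> 'k::field_char_0 mat"
  assumes "is_rep G \<rho>" and "\<And>g. g \<in> carrier G \<Longrightarrow> \<sigma> g = \<rho> g"
  shows "rep_iso G \<rho> \<sigma>"
proof -
  let ?n = "rep_dim G \<rho>"
  have "is_rep G \<sigma>" "rep_dim G \<sigma> = ?n"
    by (rule is_repI; use assms is_repD[OF assms(1)] in simp)+
  then show ?thesis
    using assms is_repD(1)[OF assms(1)] left_mult_one_mat right_mult_one_mat
    by (intro rep_isoI[of _ _ "1\<^sub>m ?n" "1\<^sub>m ?n"]) fastforce+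
qed

lemma rep_iso_tr:
  fixes \<rho> \<sigma> :: "'a \<Rightarrow> 'k::field mat"
  assumes "rep_iso G \<rho> \<sigma>" "g \<in> carrier G"
  shows "tr (\<rho> g) = tr (\<sigma> g)"
proof -
  let ?n = "rep_dim G \<rho>"
  obtain P Q where PQ: "P \<in> carrier_mat ?n ?n" "Q \<in> carrier_mat ?n ?n" "P * Q = 1\<^sub>m ?n"
    "Q * P = 1\<^sub>m ?n" and int: "\<And>g. g \<in> carrier G \<Longrightarrow> P * \<rho> g = \<sigma> g * P"
    and reps: "is_rep G \<rho>" "is_rep G \<sigma>" and dim: "rep_dim G \<sigma> = ?n"
    using rep_isoE[OF assms(1)] by blast
  have c: "\<rho> g \<in> carrier_mat ?n ?n" "\<sigma> g \<in> carrier_mat ?n ?n"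
    using is_repD(1)[OF reps(1) assms(2)] is_repD(1)[OF reps(2) assms(2)] dim by auto
  have "tr (\<rho> g) = tr ((Q * P) * \<rho> g)" using c PQ by simp
  also have "\<dots> = tr (Q * (P * \<rho> g))" using c PQ(1,2) by (simp add: assoc_mult_mat[of _ ?n ?n])
  also have "\<dots> = tr ((P * \<rho> g) * Q)" using c PQ by (intro tr_mult_comm[of _ ?n ?n]) auto
  also have "\<dots> = tr (\<sigma> g * (P * Q))" using c PQ(1,2) by (simp add: int[OF assms(2)] assoc_mult_mat[of _ ?n ?n])
  also have "\<dots> = tr (\<sigma> g)" using c PQ by simp
  finally show ?thesis .
qed

text \<open>Schur's lemma: the kernel and the range of \<open>X\<close> are invariant subspaces, so \<open>X\<close> vanishes or is
  bijective.\<close>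

lemma intertwiner_zero_or_iso:
  fixes \<rho> \<sigma> :: "'a \<Rightarrow> 'k::field_char_0 mat"
  assumes \<rho>: "irreducible_rep G \<rho>" and \<sigma>: "irreducible_rep G \<sigma>"
    and X: "X \<in> carrier_mat (rep_dim G \<rho>) (rep_dim G \<sigma>)"
    and int: "\<And>g. g \<in> carrier G \<Longrightarrow> X * \<sigma> g = \<rho> g * X"
  shows "X = 0\<^sub>m (rep_dim G \<rho>) (rep_dim G \<sigma>) \<or>
         (\<exists>Q\<in>carrier_mat (rep_dim G \<sigma>) (rep_dim G \<rho>).
            X * Q = 1\<^sub>m (rep_dim G \<rho>) \<and> Q * X = 1\<^sub>m (rep_dim G \<sigma>)) \<and> rep_iso G \<sigma> \<rho>"
proof (cases "X = 0\<^sub>m (rep_dim G \<rho>) (rep_dim G \<sigma>)")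
  case False
  let ?n = "rep_dim G \<rho>" and ?m = "rep_dim G \<sigma>"
  let ?K = "{v \<in> carrier_vec ?m. X *\<^sub>v v = 0\<^sub>v ?n}" and ?R = "(*\<^sub>v) X ` carrier_vec ?m"
  have r: "is_rep G \<rho>" "is_rep G \<sigma>" using irreducible_repD[OF \<rho>] irreducible_repD[OF \<sigma>] by auto
  note c = is_repD(1)[OF r(1)] is_repD(1)[OF r(2)]
  have comm: "X *\<^sub>v (\<sigma> g *\<^sub>v v) = \<rho> g *\<^sub>v (X *\<^sub>v v)" if "g \<in> carrier G" "v \<in> carrier_vec ?m" for g v
    using arg_cong[OF int[OF that(1)], of "\<lambda>M. M *\<^sub>v v"] that c[of g] X
    by (simp add: assoc_mult_mat_vec[of _ ?n ?m _ ?m] assoc_mult_mat_vec[of _ ?n ?n _ ?m])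
  have zero: "Y *\<^sub>v 0\<^sub>v k = 0\<^sub>v l" if "Y \<in> carrier_mat l k" for Y :: "'k mat" and k l
    using that by (intro eq_vecI) auto
  have "?K = {0\<^sub>v ?m} \<or> ?K = carrier_vec ?m"
  proof (rule irreducible_repD(3)[OF \<sigma> lin_subspace_kernel[OF X]])
    fix g v assume g: "g \<in> carrier G" and v: "v \<in> ?K"
    have "X *\<^sub>v (\<sigma> g *\<^sub>v v) = 0\<^sub>v ?n" using comm[OF g, of v] v zero[OF c(1)[OF g]] by simp
    then show "\<sigma> g *\<^sub>v v \<in> ?K" using c[OF g] v by auto
  qed
  moreover have "?K \<noteq> carrier_vec ?m"
  proof
    assume K: "?K = carrier_vec ?m"
    have "X = 0\<^sub>m ?n ?m"
    proof (rule mat_eqI_mult_vec[OF X])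
      fix v :: "'k vec" assume v: "v \<in> carrier_vec ?m"
      have "X *\<^sub>v v = 0\<^sub>v ?n" using K v by blast
      also have "\<dots> = 0\<^sub>m ?n ?m *\<^sub>v v" using v by (intro eq_vecI) auto
      finally show "X *\<^sub>v v = 0\<^sub>m ?n ?m *\<^sub>v v" .
    qed simp
    then show False using False by simp
  qed
  ultimately have K: "?K = {0\<^sub>v ?m}" by blast
  have "?R = {0\<^sub>v ?n} \<or> ?R = carrier_vec ?n"
  proof (rule irreducible_repD(3)[OF \<rho> lin_subspace_range[OF X]])
    fix g v assume g: "g \<in> carrier G" and v: "v \<in> ?R"
    then obtain u where u: "u \<in> carrier_vec ?m" "v = X *\<^sub>v u" by blast
    show "\<rho> g *\<^sub>v v \<in> ?R"
      by (rule image_eqI[of _ _ "\<sigma> g *\<^sub>v u"]) (use comm[OF g u(1)] c[OF g] u in auto)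
  qed
  moreover have "?R \<noteq> {0\<^sub>v ?n}"
  proof
    assume R: "?R = {0\<^sub>v ?n}"
    have "carrier_vec ?m \<subseteq> ?K" using R by blast
    then show False using K \<open>?K \<noteq> carrier_vec ?m\<close> by blast
  qed
  ultimately have R: "?R = carrier_vec ?n" by blast
  obtain Q where Q: "Q \<in> carrier_mat ?m ?n" "X * Q = 1\<^sub>m ?n" "Q * X = 1\<^sub>m ?m"
  proof (rule inverse_of_bijective[OF X])
    show "v = 0\<^sub>v ?m" if "v \<in> carrier_vec ?m" "X *\<^sub>v v = 0\<^sub>v ?n" for v using that K by blast
    show "\<exists>v\<in>carrier_vec ?m. X *\<^sub>v v = w" if "w \<in> carrier_vec ?n" for w
    proof -
      have "w \<in> ?R" using that R by simp
      then show ?thesis by blast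
    qed
  qed
  have "rep_iso G \<sigma> \<rho>" using r X Q int by (intro rep_isoI[of _ _ X Q]) auto
  then show ?thesis using Q by blast
qed simp

text \<open>Subtracting an eigenvalue from \<open>X\<close> leaves an intertwiner that is not injective, so the
  difference vanishes.\<close>

lemma intertwiner_scalar:
  fixes \<rho> :: "'a \<Rightarrow> complex mat"
  assumes \<rho>: "irreducible_rep G \<rho>" and X: "X \<in> carrier_mat (rep_dim G \<rho>) (rep_dim G \<rho>)"
    and int: "\<And>g. g \<in> carrier G \<Longrightarrow> X * \<rho> g = \<rho> g * X"
  obtains a where "X = a \<cdot>\<^sub>m 1\<^sub>m (rep_dim G \<rho>)"
proof -
  let ?n = "rep_dim G \<rho>"
  have r: "is_rep G \<rho>" "0 < ?n" using irreducible_repD[OF \<rho>] by auto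
  note c = is_repD(1)[OF r(1)]
  obtain a where "eigenvalue X a" using spectrum_non_empty[OF X r(2)] by (auto simp: spectrum_def)
  then obtain v where v: "v \<in> carrier_vec ?n" "v \<noteq> 0\<^sub>v ?n" "X *\<^sub>v v = a \<cdot>\<^sub>v v"
    using X by (auto simp: eigenvalue_def eigenvector_def)
  define Y where "Y = X - a \<cdot>\<^sub>m 1\<^sub>m ?n"
  have Y: "Y \<in> carrier_mat ?n ?n" using X by (auto simp: Y_def)
  have "Y * \<rho> g = \<rho> g * Y" if "g \<in> carrier G" for g
  proof -
    have "(a \<cdot>\<^sub>m 1\<^sub>m ?n) * \<rho> g = \<rho> g * (a \<cdot>\<^sub>m 1\<^sub>m ?n)"
      using mult_smult_assoc_mat[of "1\<^sub>m ?n" ?n ?n "\<rho> g" ?n a]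
        mult_smult_distrib[of "\<rho> g" ?n ?n "1\<^sub>m ?n" ?n a] c[OF that] by simp
    then show ?thesis
      using int[OF that] c[OF that] X
      by (simp add: Y_def minus_mult_distrib_mat[of _ ?n ?n] mult_minus_distrib_mat[of _ ?n ?n])
  qed
  then have "Y = 0\<^sub>m ?n ?n \<or> (\<exists>Q\<in>carrier_mat ?n ?n. Y * Q = 1\<^sub>m ?n \<and> Q * Y = 1\<^sub>m ?n)"
    using intertwiner_zero_or_iso[OF \<rho> \<rho> Y] by blast
  then have "Y = 0\<^sub>m ?n ?n"
  proof (elim disjE conjE bexE)
    fix Q assume Q: "Q \<in> carrier_mat ?n ?n" "Q * Y = 1\<^sub>m ?n"
    have "Y *\<^sub>v v = 0\<^sub>v ?n"
      using v X by (auto simp: Y_def minus_mult_distrib_mat_vec[of _ ?n ?n] intro!: eq_vecI)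
    then have "(Q * Y) *\<^sub>v v = Q *\<^sub>v 0\<^sub>v ?n" using assoc_mult_mat_vec[OF Q(1) Y v(1)] by (simp only:)
    also have "\<dots> = 0\<^sub>v ?n" using mult_mat_zero_vec[OF Q(1)] .
    finally have "1\<^sub>m ?n *\<^sub>v v = 0\<^sub>v ?n" by (simp only: Q(2))
    then show ?thesis using v by simp
  qed
  have "X = a \<cdot>\<^sub>m 1\<^sub>m ?n"
  proof (rule eq_matI)
    fix i j assume "i < dim_row (a \<cdot>\<^sub>m 1\<^sub>m ?n)" "j < dim_col (a \<cdot>\<^sub>m 1\<^sub>m ?n)"
    then show "X $$ (i, j) = (a \<cdot>\<^sub>m 1\<^sub>m ?n) $$ (i, j)"
      using arg_cong[OF \<open>Y = 0\<^sub>m ?n ?n\<close>, of "\<lambda>M. M $$ (i, j)"] X by (simp add: Y_def)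
  qed (use X in auto)
  then show ?thesis using that by blast
qed

end

locale fin_group = group G for G :: "('a, 'b) monoid_scheme" (structure) +
  assumes fin: "finite (carrier G)"
begin

lemma bij_betw_left_mult: "g \<in> carrier G \<Longrightarrow> bij_betw ((\<otimes>) g) (carrier G) (carrier G)"
  by (rule bij_betw_byWitness[where f' = "(\<otimes>) (inv g)"]) (auto simp: m_assoc[symmetric])

text \<open>Averaging a matrix over the group yields an intertwiner: multiplication by \<open>h\<close> permutes the
  summands.\<close>

lemma averaged_intertwiner:
  fixes \<rho> \<sigma> :: "'a \<Rightarrow> 'k::field mat"
  assumes \<rho>: "is_rep G \<rho>" and \<sigma>: "is_rep G \<sigma>"
    and X: "X \<in> carrier_mat (rep_dim G \<rho>) (rep_dim G \<sigma>)" and h: "h \<in> carrier G"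
  defines "S \<equiv> mat_sum (rep_dim G \<rho>) (rep_dim G \<sigma>) (\<lambda>g. \<rho> g * X * \<sigma> (inv g)) (carrier G)"
  shows "S * \<sigma> h = \<rho> h * S"
proof -
  let ?n = "rep_dim G \<rho>" and ?m = "rep_dim G \<sigma>"
  note c = is_repD(1)[OF \<rho>] is_repD(1)[OF \<sigma>]
  have sc: "\<rho> g * X * \<sigma> (inv g) \<in> carrier_mat ?n ?m" if "g \<in> carrier G" for g
    using c(1)[OF that] c(2)[of "inv g"] X that by auto
  have "S * \<sigma> h = mat_sum ?n ?m (\<lambda>g. \<rho> g * X * \<sigma> (inv g) * \<sigma> h) (carrier G)"
    unfolding S_def using c(2)[OF h] sc by (subst mat_sum_mult[of "\<sigma> h" ?m ?m _ _ ?n]) auto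
  also have "\<dots> = mat_sum ?n ?m (\<lambda>g. \<rho> (h \<otimes> g) * X * \<sigma> (inv (h \<otimes> g)) * \<sigma> h) (carrier G)"
    by (rule mat_sum_reindex[OF bij_betw_left_mult[OF h]])
  also have "\<dots> = mat_sum ?n ?m (\<lambda>g. \<rho> h * (\<rho> g * X * \<sigma> (inv g))) (carrier G)"
  proof (rule mat_sum_cong[OF refl])
    fix g assume g: "g \<in> carrier G"
    have "\<sigma> (inv (h \<otimes> g)) * \<sigma> h = \<sigma> (inv g)"
      using g h is_repD(3)[OF \<sigma>, of "inv (h \<otimes> g)" h] by (simp add: inv_mult_group m_assoc)
    moreover have "\<rho> (h \<otimes> g) * X = \<rho> h * (\<rho> g * X)"
      using c(1)[OF g] c(1)[OF h] X g h by (simp add: is_repD(3)[OF \<rho>] assoc_mult_mat[of _ ?n ?n _ ?n _ ?m])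
    moreover have "A * B * s1 * s2 = A * (B * (s1 * s2))"
      if "A \<in> carrier_mat ?n ?n" "B \<in> carrier_mat ?n ?m" "s1 \<in> carrier_mat ?m ?m" "s2 \<in> carrier_mat ?m ?m"
      for A B s1 s2 :: "'k mat"
      using that assoc_mult_mat[of "A * B" ?n ?m s1 ?m s2 ?m] assoc_mult_mat[of A ?n ?n B ?m "s1 * s2" ?m]
      by auto
    from this[of "\<rho> h" "\<rho> g * X" "\<sigma> (inv (h \<otimes> g))" "\<sigma> h"]
    have "\<rho> h * (\<rho> g * X) * \<sigma> (inv (h \<otimes> g)) * \<sigma> h = \<rho> h * (\<rho> g * X * (\<sigma> (inv (h \<otimes> g)) * \<sigma> h))"
      using c(1)[OF g] c(1)[OF h] X c(2)[of "inv (h \<otimes> g)"] c(2)[OF h] g h by auto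
    ultimately show "\<rho> (h \<otimes> g) * X * \<sigma> (inv (h \<otimes> g)) * \<sigma> h = \<rho> h * (\<rho> g * X * \<sigma> (inv g))"
      by (simp only:)
  qed
  also have "\<dots> = \<rho> h * S"
    unfolding S_def using c(1)[OF h] sc by (subst mult_mat_sum[of "\<rho> h" ?n ?n _ _ ?m]) auto
  finally show ?thesis .
qed

end

section \<open>Complete reducibility\<close>

definition block_rep :: "('g \<Rightarrow> 'k::field mat) \<Rightarrow> nat \<Rightarrow> ('g \<Rightarrow> 'k mat) \<Rightarrow> nat \<Rightarrow> 'g \<Rightarrow> 'k mat" where
  "block_rep \<sigma> n \<tau> m = (\<lambda>g. four_block_mat (\<sigma> g) (0\<^sub>m n m) (0\<^sub>m m n) (\<tau> g))"

lemma dsum_append: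
  assumes "dsum \<rho>s g \<in> carrier_mat n n" "dsum \<sigma>s g \<in> carrier_mat m m"
  shows "dsum (\<rho>s @ \<sigma>s) g = block_rep (dsum \<rho>s) n (dsum \<sigma>s) m g"
  using assms by (simp add: dsum_def block_rep_def diag_block_mat_append Let_def)

lemma dsum_Cons:
  "dsum (\<rho> # \<rho>s) g = four_block_mat (\<rho> g) (0\<^sub>m (dim_row (\<rho> g)) (dim_col (dsum \<rho>s g)))
     (0\<^sub>m (dim_row (dsum \<rho>s g)) (dim_col (\<rho> g))) (dsum \<rho>s g)"
  by (simp add: dsum_def Let_def)

lemma four_block_empty:
  assumes "X \<in> carrier_mat n m"
  shows "four_block_mat X (0\<^sub>m n 0) (0\<^sub>m 0 m) (0\<^sub>m 0 0) = X"
  using assms by (intro eq_matI) auto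

context group
begin

lemma tr_dsum:
  assumes "\<And>\<rho>. \<rho> \<in> set \<rho>s \<Longrightarrow> is_rep G \<rho>" "g \<in> carrier G"
  shows "(\<exists>n. dsum \<rho>s g \<in> carrier_mat n n) \<and> tr (dsum \<rho>s g) = (\<Sum>\<rho>\<leftarrow>\<rho>s. tr (\<rho> g))"
  using assms(1)
proof (induction \<rho>s)
  case Nil
  then show ?case by (auto simp: dsum_def tr_def intro!: exI[of _ 0])
next
  case (Cons \<rho> \<rho>s)
  then obtain n where n: "dsum \<rho>s g \<in> carrier_mat n n" "tr (dsum \<rho>s g) = (\<Sum>\<rho>\<leftarrow>\<rho>s. tr (\<rho> g))"
    by auto
  have c: "\<rho> g \<in> carrier_mat (rep_dim G \<rho>) (rep_dim G \<rho>)"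
    using Cons.prems assms(2) by (intro is_repD(1)) simp_all
  have "dsum (\<rho> # \<rho>s) g = four_block_mat (\<rho> g) (0\<^sub>m (rep_dim G \<rho>) n) (0\<^sub>m n (rep_dim G \<rho>)) (dsum \<rho>s g)"
    using n c unfolding dsum_Cons by simp
  then show ?case
    using tr_four_block_diag[OF c n(1)] n(2) four_block_carrier_mat[OF c n(1)] by auto
qed

lemma is_rep_block:
  fixes \<sigma> \<tau> :: "'a \<Rightarrow> 'k::field mat"
  assumes \<sigma>: "is_rep G \<sigma>" "rep_dim G \<sigma> = n" and \<tau>: "is_rep G \<tau>" "rep_dim G \<tau> = m"
  shows "is_rep G (block_rep \<sigma> n \<tau> m)" "rep_dim G (block_rep \<sigma> n \<tau> m) = n + m"
proof -
  note c = is_repD(1)[OF \<sigma>(1), unfolded \<sigma>(2)] is_repD(1)[OF \<tau>(1), unfolded \<tau>(2)]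
  have 1: "block_rep \<sigma> n \<tau> m g \<in> carrier_mat (n + m) (n + m)" if "g \<in> carrier G" for g
    using c[OF that] by (simp add: block_rep_def)
  have 2: "block_rep \<sigma> n \<tau> m \<one> = 1\<^sub>m (n + m)"
    using is_repD(2)[OF \<sigma>(1)] is_repD(2)[OF \<tau>(1)] \<sigma>(2) \<tau>(2) by (simp add: block_rep_def)
  have 3: "block_rep \<sigma> n \<tau> m (g \<otimes> h) = block_rep \<sigma> n \<tau> m g * block_rep \<sigma> n \<tau> m h"
    if g: "g \<in> carrier G" and h: "h \<in> carrier G" for g h
    unfolding block_rep_def
    using c[OF g] c[OF h] is_repD(3)[OF \<sigma>(1) g h] is_repD(3)[OF \<tau>(1) g h]
    by (subst mult_four_block_mat[of _ n n _ m _ m _ _ n _ m]) auto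
  show "is_rep G (block_rep \<sigma> n \<tau> m)" "rep_dim G (block_rep \<sigma> n \<tau> m) = n + m"
    using is_repI[of G "block_rep \<sigma> n \<tau> m" "n + m"] 1 2 3 by blast+
qed

text \<open>A decomposition \<open>1 = A1 D1 + A2 D2\<close> of the identity into complementary projections
  that are compatible with the action turns \<open>\<sigma>\<close> into block diagonal form.\<close>

lemma block_rep_iso:
  fixes \<sigma> \<tau>1 \<tau>2 :: "'a \<Rightarrow> 'k::field_char_0 mat"
  assumes \<sigma>: "is_rep G \<sigma>" "rep_dim G \<sigma> = n"
    and \<tau>1: "is_rep G \<tau>1" "rep_dim G \<tau>1 = k1" and \<tau>2: "is_rep G \<tau>2" "rep_dim G \<tau>2 = k2"
    and A: "A1 \<in> carrier_mat n k1" "A2 \<in> carrier_mat n k2"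
    and D: "D1 \<in> carrier_mat k1 n" "D2 \<in> carrier_mat k2 n"
    and DA: "D1 * A1 = 1\<^sub>m k1" "D2 * A2 = 1\<^sub>m k2" "D1 * A2 = 0\<^sub>m k1 k2" "D2 * A1 = 0\<^sub>m k2 k1"
    and AD: "A1 * D1 + A2 * D2 = 1\<^sub>m n"
    and int: "\<And>g. g \<in> carrier G \<Longrightarrow> A1 * \<tau>1 g = \<sigma> g * A1"
      "\<And>g. g \<in> carrier G \<Longrightarrow> A2 * \<tau>2 g = \<sigma> g * A2"
  shows "rep_iso G (block_rep \<tau>1 k1 \<tau>2 k2) \<sigma>"
proof -
  \<comment> \<open>\<open>P\<close> is \<open>A1\<close> next to \<open>A2\<close> and \<open>Q\<close> is \<open>D1\<close> above \<open>D2\<close>; empty blocks make them block matrices.\<close>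
  define P where "P = four_block_mat A1 A2 (0\<^sub>m 0 k1) (0\<^sub>m 0 k2)"
  define Q where "Q = four_block_mat D1 (0\<^sub>m k1 0) D2 (0\<^sub>m k2 0)"
  note block = is_rep_block[OF \<tau>1 \<tau>2]
  have P: "P \<in> carrier_mat n (k1 + k2)" and Q: "Q \<in> carrier_mat (k1 + k2) n"
    using A D by (auto simp: P_def Q_def)
  have "P * Q = four_block_mat (A1 * D1 + A2 * D2) (0\<^sub>m n 0) (0\<^sub>m 0 n) (0\<^sub>m 0 0)"
    unfolding P_def Q_def using A D
    by (subst mult_four_block_mat[of _ n k1 _ k2 _ 0 _ _ n _ 0]) (auto intro!: cong_four_block_mat eq_matI)
  then have PQ: "P * Q = 1\<^sub>m n" by (simp add: AD four_block_empty)
  have "Q * P = four_block_mat (D1 * A1) (D1 * A2) (D2 * A1) (D2 * A2)"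
    unfolding P_def Q_def using A D
    by (subst mult_four_block_mat[of _ k1 n _ 0 _ k2 _ _ k1 _ k2]) (auto intro!: cong_four_block_mat eq_matI simp: scalar_prod_def)
  then have QP: "Q * P = 1\<^sub>m (k1 + k2)" by (simp add: DA)
  have "P * block_rep \<tau>1 k1 \<tau>2 k2 g = \<sigma> g * P" if g: "g \<in> carrier G" for g
  proof -
    note c = is_repD(1)[OF \<tau>1(1) g] is_repD(1)[OF \<tau>2(1) g] is_repD(1)[OF \<sigma>(1) g]
    have "P * block_rep \<tau>1 k1 \<tau>2 k2 g =
        four_block_mat (A1 * \<tau>1 g) (A2 * \<tau>2 g) (0\<^sub>m 0 k1) (0\<^sub>m 0 k2)"
      unfolding P_def block_rep_def using A c \<tau>1 \<tau>2
      by (subst mult_four_block_mat[of _ n k1 _ k2 _ 0 _ _ k1 _ k2]) (auto intro!: cong_four_block_mat)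
    also have "\<dots> = four_block_mat (\<sigma> g) (0\<^sub>m n 0) (0\<^sub>m 0 n) (0\<^sub>m 0 0) * P"
      unfolding P_def using A c \<sigma> int[OF g]
      by (subst mult_four_block_mat[of _ n n _ 0 _ 0 _ _ k1 _ k2])
        (auto intro!: cong_four_block_mat eq_matI simp: scalar_prod_def)
    finally show ?thesis using four_block_empty[OF c(3)] \<sigma>(2) by simp
  qed
  then show ?thesis
    using block \<sigma> P Q PQ QP by (intro rep_isoI[of _ _ P Q]) auto
qed

end

context fin_group
begin

lemma card_carrier_nonzero: "(of_nat (card (carrier G)) :: 'k::field_char_0) \<noteq> 0"
  using fin one_closed by (auto simp: card_eq_0_iff)

text \<open>The idea of Maschke's theorem: the average of an arbitrary projection onto an invariant subspace
  is a projection onto it that commutes with the group.\<close>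

lemma commuting_idempotent:
  fixes \<sigma> :: "'a \<Rightarrow> 'k::field_char_0 mat"
  assumes \<sigma>: "is_rep G \<sigma>" and dim: "0 < rep_dim G \<sigma>" and red: "\<not> irreducible_rep G \<sigma>"
  obtains E where "E \<in> carrier_mat (rep_dim G \<sigma>) (rep_dim G \<sigma>)" "E * E = E"
    "E \<noteq> 0\<^sub>m (rep_dim G \<sigma>) (rep_dim G \<sigma>)" "E \<noteq> 1\<^sub>m (rep_dim G \<sigma>)"
    "\<forall>g\<in>carrier G. E * \<sigma> g = \<sigma> g * E"
proof -
  let ?n = "rep_dim G \<sigma>" and ?N = "of_nat (card (carrier G)) :: 'k"
  obtain U where U: "lin_subspace ?n U" "\<forall>g\<in>carrier G. \<forall>v\<in>U. \<sigma> g *\<^sub>v v \<in> U"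
    "U \<noteq> {0\<^sub>v ?n}" "U \<noteq> carrier_vec ?n"
    using assms unfolding irreducible_rep_def by blast
  obtain k B C where B: "B \<in> carrier_mat ?n k" and C: "C \<in> carrier_mat k ?n" and CB: "C * B = 1\<^sub>m k"
    and BU: "\<forall>v\<in>carrier_vec k. B *\<^sub>v v \<in> U" and BC: "\<forall>u\<in>U. B *\<^sub>v (C *\<^sub>v u) = u"
    using subspace_basis[OF U(1)] .
  define X where "X = B * C"
  have X: "X \<in> carrier_mat ?n ?n" using B C by (auto simp: X_def)
  define S where "S = mat_sum ?n ?n (\<lambda>g. \<sigma> g * X * \<sigma> (inv g)) (carrier G)"
  have S: "S \<in> carrier_mat ?n ?n" by (simp add: S_def)
  note c = is_repD(1)[OF \<sigma>]
  note assoc = assoc_mult_mat[of _ ?n ?n _ ?n _ ?n]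
  have Xfix: "X *\<^sub>v u = u" if "u \<in> U" for u
  proof -
    have "u \<in> carrier_vec ?n" using that U(1) by (auto simp: lin_subspace_def)
    then show ?thesis using assoc_mult_mat_vec[OF B C] BC that by (simp add: X_def)
  qed
  have XU: "X *\<^sub>v v \<in> U" if "v \<in> carrier_vec ?n" for v
    using assoc_mult_mat_vec[OF B C that] BU mult_mat_vec_carrier[OF C that] by (simp add: X_def)
  have XsX: "X * (\<sigma> g * X) = \<sigma> g * X" if g: "g \<in> carrier G" for g
  proof (rule mat_eqI_mult_vec)
    show sX: "\<sigma> g * X \<in> carrier_mat ?n ?n" using c[OF g] X by auto
    then show "X * (\<sigma> g * X) \<in> carrier_mat ?n ?n" using X by auto
    fix v :: "'k vec" assume v: "v \<in> carrier_vec ?n"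
    have "(X * (\<sigma> g * X)) *\<^sub>v v = X *\<^sub>v ((\<sigma> g * X) *\<^sub>v v)" by (rule assoc_mult_mat_vec[OF X sX v])
    also have "(\<sigma> g * X) *\<^sub>v v = \<sigma> g *\<^sub>v (X *\<^sub>v v)" by (rule assoc_mult_mat_vec[OF c[OF g] X v])
    also have "X *\<^sub>v (\<sigma> g *\<^sub>v (X *\<^sub>v v)) = \<sigma> g *\<^sub>v (X *\<^sub>v v)" using Xfix XU[OF v] U(2) g by blast
    also have "\<dots> = (\<sigma> g * X) *\<^sub>v v" by (rule assoc_mult_mat_vec[OF c[OF g] X v, symmetric])
    finally show "(X * (\<sigma> g * X)) *\<^sub>v v = (\<sigma> g * X) *\<^sub>v v" .
  qed
  have term_c: "\<sigma> g * X * \<sigma> (inv g) \<in> carrier_mat ?n ?n" if "g \<in> carrier G" for g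
    using c[OF that] c[of "inv g"] X that by auto
  have XS: "X * S = S"
  proof -
    have "X * S = mat_sum ?n ?n (\<lambda>g. X * (\<sigma> g * X * \<sigma> (inv g))) (carrier G)"
      unfolding S_def using X term_c by (rule mult_mat_sum)
    also have "\<dots> = S" unfolding S_def
    proof (rule mat_sum_cong[OF refl])
      fix g assume g: "g \<in> carrier G"
      have "X * (\<sigma> g * X * \<sigma> (inv g)) = X * (\<sigma> g * X) * \<sigma> (inv g)"
        using c[OF g] c[of "inv g"] X g by (intro assoc[symmetric]) auto
      then show "X * (\<sigma> g * X * \<sigma> (inv g)) = \<sigma> g * X * \<sigma> (inv g)" by (simp only: XsX[OF g])
    qed
    finally show ?thesis .
  qed
  have SX: "S * X = ?N \<cdot>\<^sub>m X"
  proof -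
    have "S * X = mat_sum ?n ?n (\<lambda>g. \<sigma> g * X * \<sigma> (inv g) * X) (carrier G)"
      unfolding S_def using X term_c by (rule mat_sum_mult)
    also have "\<dots> = mat_sum ?n ?n (\<lambda>_. X) (carrier G)"
    proof (rule mat_sum_cong[OF refl])
      fix g assume g: "g \<in> carrier G"
      have i: "inv g \<in> carrier G" using g by simp
      have "\<sigma> g * X * \<sigma> (inv g) * X = \<sigma> g * (X * (\<sigma> (inv g) * X))"
        using assoc[OF mult_carrier_mat[OF c[OF g] X] c[OF i] X]
          assoc[OF c[OF g] X mult_carrier_mat[OF c[OF i] X]] by (simp only:)
      also have "\<dots> = \<sigma> g * (\<sigma> (inv g) * X)" by (simp only: XsX[OF i])
      also have "\<dots> = (\<sigma> g * \<sigma> (inv g)) * X" using c[OF g] c[OF i] X by (intro assoc[symmetric])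
      also have "\<dots> = X" using is_rep_inv(1)[OF \<sigma> g] X by simp
      finally show "\<sigma> g * X * \<sigma> (inv g) * X = X" .
    qed
    also have "\<dots> = ?N \<cdot>\<^sub>m X" by (rule mat_sum_const[OF X])
    finally show ?thesis .
  qed
  define E where "E = inverse ?N \<cdot>\<^sub>m S"
  have E: "E \<in> carrier_mat ?n ?n" using S by (simp add: E_def)
  have XE: "X * E = E" using mult_smult_distrib[OF X S] XS by (simp add: E_def)
  have EX: "E * X = X"
    using mult_smult_assoc_mat[OF S X, of "inverse ?N"] SX card_carrier_nonzero[where 'k='k]
    by (simp add: E_def) (rule eq_matI, auto)
  have EE: "E * E = E" using assoc[OF E X E] XE EX by simp
  have "E \<noteq> 0\<^sub>m ?n ?n"
  proof
    assume "E = 0\<^sub>m ?n ?n"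
    then have X0: "X = 0\<^sub>m ?n ?n" using EX X by simp
    have "u = 0\<^sub>v ?n" if "u \<in> U" for u
    proof -
      have "u \<in> carrier_vec ?n" using that U(1) by (auto simp: lin_subspace_def)
      then have "0\<^sub>m ?n ?n *\<^sub>v u = 0\<^sub>v ?n" by (intro eq_vecI) auto
      then show ?thesis using Xfix[OF that] X0 by simp
    qed
    then show False using U(1,3) by (auto simp: lin_subspace_def)
  qed
  moreover have "E \<noteq> 1\<^sub>m ?n"
  proof
    assume "E = 1\<^sub>m ?n"
    then have "X = 1\<^sub>m ?n" using XE X by simp
    then have "carrier_vec ?n \<subseteq> U" using XU by auto
    then show False using U(1,4) by (auto simp: lin_subspace_def)
  qed
  moreover have "\<forall>g\<in>carrier G. E * \<sigma> g = \<sigma> g * E"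
  proof
    fix g assume g: "g \<in> carrier G"
    show "E * \<sigma> g = \<sigma> g * E"
      using averaged_intertwiner[OF \<sigma> \<sigma> X g] mult_smult_assoc_mat[OF S c[OF g]]
        mult_smult_distrib[OF c[OF g] S] by (simp add: E_def S_def[symmetric])
  qed
  ultimately show thesis using that E EE by blast
qed

end

lemma mult_block_diag:
  fixes A A' D D' :: "'k::semiring_1 mat"
  assumes "A \<in> carrier_mat n n" "A' \<in> carrier_mat n n" "D \<in> carrier_mat m m" "D' \<in> carrier_mat m m"
  shows "four_block_mat A (0\<^sub>m n m) (0\<^sub>m m n) D * four_block_mat A' (0\<^sub>m n m) (0\<^sub>m m n) D' =
    four_block_mat (A * A') (0\<^sub>m n m) (0\<^sub>m m n) (D * D')"
  using mult_four_block_mat[OF assms(1) zero_carrier_mat zero_carrier_mat assms(3)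
      assms(2) zero_carrier_mat zero_carrier_mat assms(4)] assms by simp

context fin_group
begin

lemma decomposes_block:
  fixes \<sigma> :: "'a \<Rightarrow> 'k::field_char_0 mat"
  assumes \<sigma>: "is_rep G \<sigma>" "rep_dim G \<sigma> = n"
    and B: "B1 \<in> carrier_mat n k1" "B2 \<in> carrier_mat n k2"
    and C: "C1 \<in> carrier_mat k1 n" "C2 \<in> carrier_mat k2 n"
    and CB: "C1 * B1 = 1\<^sub>m k1" "C2 * B2 = 1\<^sub>m k2" "C1 * B2 = 0\<^sub>m k1 k2" "C2 * B1 = 0\<^sub>m k2 k1"
    and BC: "B1 * C1 + B2 * C2 = 1\<^sub>m n"
    and \<sigma>1: "is_rep G \<sigma>1" "rep_dim G \<sigma>1 = k1" and \<sigma>2: "is_rep G \<sigma>2" "rep_dim G \<sigma>2 = k2"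
    and int: "\<And>g. g \<in> carrier G \<Longrightarrow> B1 * \<sigma>1 g = \<sigma> g * B1"
      "\<And>g. g \<in> carrier G \<Longrightarrow> B2 * \<sigma>2 g = \<sigma> g * B2"
    and dec: "decomposes G \<rho>s1 \<sigma>1" "decomposes G \<rho>s2 \<sigma>2"
  shows "decomposes G (\<rho>s1 @ \<rho>s2) \<sigma>"
proof -
  have iso: "rep_iso G (block_rep \<sigma>1 k1 \<sigma>2 k2) \<sigma>"
    by (rule block_rep_iso[OF \<sigma> \<sigma>1 \<sigma>2 B C CB BC int])
  have iso1: "rep_iso G (dsum \<rho>s1) \<sigma>1" and iso2: "rep_iso G (dsum \<rho>s2) \<sigma>2"
    using dec by (auto simp: decomposes_def)
  have d1: "is_rep G (dsum \<rho>s1)" "rep_dim G (dsum \<rho>s1) = k1"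
    using iso1 \<sigma>1 by (auto simp: rep_iso_def)
  have d2: "is_rep G (dsum \<rho>s2)" "rep_dim G (dsum \<rho>s2) = k2"
    using iso2 \<sigma>2 by (auto simp: rep_iso_def)
  obtain P1 Q1 where P1: "P1 \<in> carrier_mat k1 k1" "Q1 \<in> carrier_mat k1 k1" "P1 * Q1 = 1\<^sub>m k1"
    "Q1 * P1 = 1\<^sub>m k1" and i1: "\<And>g. g \<in> carrier G \<Longrightarrow> P1 * dsum \<rho>s1 g = \<sigma>1 g * P1"
    using rep_isoE[OF iso1, unfolded d1(2)] by blast
  obtain P2 Q2 where P2: "P2 \<in> carrier_mat k2 k2" "Q2 \<in> carrier_mat k2 k2" "P2 * Q2 = 1\<^sub>m k2"
    "Q2 * P2 = 1\<^sub>m k2" and i2: "\<And>g. g \<in> carrier G \<Longrightarrow> P2 * dsum \<rho>s2 g = \<sigma>2 g * P2"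
    using rep_isoE[OF iso2, unfolded d2(2)] by blast
  define P where "P = four_block_mat P1 (0\<^sub>m k1 k2) (0\<^sub>m k2 k1) P2"
  define Q where "Q = four_block_mat Q1 (0\<^sub>m k1 k2) (0\<^sub>m k2 k1) Q2"
  have PQ: "P \<in> carrier_mat (k1 + k2) (k1 + k2)" "Q \<in> carrier_mat (k1 + k2) (k1 + k2)"
    using P1 P2 by (auto simp: P_def Q_def)
  have "P * Q = 1\<^sub>m (k1 + k2)"
    unfolding P_def Q_def mult_block_diag[OF P1(1,2) P2(1,2)] P1(3) P2(3) by (rule four_block_one_mat)
  moreover have "Q * P = 1\<^sub>m (k1 + k2)"
    unfolding P_def Q_def mult_block_diag[OF P1(2,1) P2(2,1)] P1(4) P2(4) by (rule four_block_one_mat)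
  moreover have "P * block_rep (dsum \<rho>s1) k1 (dsum \<rho>s2) k2 g = block_rep \<sigma>1 k1 \<sigma>2 k2 g * P"
    if g: "g \<in> carrier G" for g
  proof -
    have c: "dsum \<rho>s1 g \<in> carrier_mat k1 k1" "dsum \<rho>s2 g \<in> carrier_mat k2 k2"
      "\<sigma>1 g \<in> carrier_mat k1 k1" "\<sigma>2 g \<in> carrier_mat k2 k2"
      using is_repD(1)[OF d1(1) g] is_repD(1)[OF d2(1) g] is_repD(1)[OF \<sigma>1(1) g] is_repD(1)[OF \<sigma>2(1) g]
      by (simp_all only: d1(2) d2(2) \<sigma>1(2) \<sigma>2(2))
    show ?thesis
      unfolding P_def block_rep_def mult_block_diag[OF P1(1) c(1) P2(1) c(2)]
        mult_block_diag[OF c(3) P1(1) c(4) P2(1)] i1[OF g] i2[OF g] ..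
  qed
  ultimately have "rep_iso G (block_rep (dsum \<rho>s1) k1 (dsum \<rho>s2) k2) (block_rep \<sigma>1 k1 \<sigma>2 k2)"
    using is_rep_block[OF d1 d2] is_rep_block[OF \<sigma>1 \<sigma>2] PQ by (intro rep_isoI[of _ _ P Q]) auto
  then have "rep_iso G (block_rep (dsum \<rho>s1) k1 (dsum \<rho>s2) k2) \<sigma>" using iso by (rule rep_iso_trans)
  moreover have "rep_iso G (dsum (\<rho>s1 @ \<rho>s2)) (block_rep (dsum \<rho>s1) k1 (dsum \<rho>s2) k2)"
  proof (rule rep_iso_sym, rule rep_iso_cong)
    show "is_rep G (block_rep (dsum \<rho>s1) k1 (dsum \<rho>s2) k2)" by (rule is_rep_block[OF d1 d2])
    fix g assume g: "g \<in> carrier G"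
    show "dsum (\<rho>s1 @ \<rho>s2) g = block_rep (dsum \<rho>s1) k1 (dsum \<rho>s2) k2 g"
      using is_repD(1)[OF d1(1) g] is_repD(1)[OF d2(1) g] d1 d2 by (intro dsum_append) auto
  qed
  ultimately have "rep_iso G (dsum (\<rho>s1 @ \<rho>s2)) \<sigma>" using rep_iso_trans by blast
  then show ?thesis using dec by (auto simp: decomposes_def)
qed

text \<open>The representation on the range of a commuting projection \<open>B * C\<close>, in the coordinates given
  by the basis \<open>B\<close>.\<close>

lemma is_rep_summand:
  fixes \<sigma> :: "'a \<Rightarrow> 'k::field mat"
  assumes \<sigma>: "is_rep G \<sigma>" "rep_dim G \<sigma> = n"
    and B: "B \<in> carrier_mat n k" and C: "C \<in> carrier_mat k n" and CB: "C * B = 1\<^sub>m k"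
    and comm: "\<forall>g\<in>carrier G. (B * C) * \<sigma> g = \<sigma> g * (B * C)"
  shows "is_rep G (\<lambda>g. C * (\<sigma> g * B))" "rep_dim G (\<lambda>g. C * (\<sigma> g * B)) = k"
    "g \<in> carrier G \<Longrightarrow> B * (C * (\<sigma> g * B)) = \<sigma> g * B"
proof -
  note c = is_repD(1)[OF \<sigma>(1), unfolded \<sigma>(2)]
  have int: "B * (C * (\<sigma> g * B)) = \<sigma> g * B" if g: "g \<in> carrier G" for g
  proof -
    have "B * (C * (\<sigma> g * B)) = (B * C) * \<sigma> g * B"
      using assoc_mult_mat[OF B C mult_carrier_mat[OF c[OF g] B]]
        assoc_mult_mat[OF mult_carrier_mat[OF B C] c[OF g] B] by (simp only:)
    also have "\<dots> = \<sigma> g * ((B * C) * B)"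
      using assoc_mult_mat[OF c[OF g] mult_carrier_mat[OF B C] B] by (simp only: comm[rule_format, OF g])
    also have "(B * C) * B = B"
      using assoc_mult_mat[OF B C B] right_mult_one_mat[OF B] by (simp only: CB)
    finally show ?thesis .
  qed
  then show "g \<in> carrier G \<Longrightarrow> B * (C * (\<sigma> g * B)) = \<sigma> g * B" .
  have 1: "C * (\<sigma> g * B) \<in> carrier_mat k k" if "g \<in> carrier G" for g
    by (rule mult_carrier_mat[OF C mult_carrier_mat[OF c[OF that] B]])
  have 2: "C * (\<sigma> \<one> * B) = 1\<^sub>m k"
    by (simp only: is_repD(2)[OF \<sigma>(1)] \<sigma>(2) left_mult_one_mat[OF B] CB)
  have 3: "C * (\<sigma> (g \<otimes> h) * B) = C * (\<sigma> g * B) * (C * (\<sigma> h * B))"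
    if g: "g \<in> carrier G" and h: "h \<in> carrier G" for g h
  proof -
    have "C * (\<sigma> g * B) * (C * (\<sigma> h * B)) = C * (\<sigma> g * (B * (C * (\<sigma> h * B))))"
      using assoc_mult_mat[OF C mult_carrier_mat[OF c[OF g] B] 1[OF h]]
        assoc_mult_mat[OF c[OF g] B 1[OF h]] by (simp only:)
    also have "\<dots> = C * ((\<sigma> g * \<sigma> h) * B)"
      using assoc_mult_mat[OF c[OF g] c[OF h] B] by (simp only: int[OF h])
    finally show ?thesis by (simp only: is_repD(3)[OF \<sigma>(1) g h])
  qed
  show "is_rep G (\<lambda>g. C * (\<sigma> g * B))" "rep_dim G (\<lambda>g. C * (\<sigma> g * B)) = k"
    using is_repI[of G "\<lambda>g. C * (\<sigma> g * B)" k] 1 2 3 by blast+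
qed

text \<open>Maschke's theorem. A reducible \<open>\<sigma>\<close> commutes with an idempotent \<open>E\<close> other than \<open>0\<close> and \<open>1\<close>,
  and then it is the direct sum of its restrictions to the ranges of \<open>E\<close> and \<open>1 - E\<close>, both of
  smaller dimension.\<close>

theorem complete_reducibility:
  fixes \<sigma> :: "'a \<Rightarrow> 'k::field_char_0 mat"
  assumes "is_rep G \<sigma>"
  shows "\<exists>\<rho>s. decomposes G \<rho>s \<sigma>"
  using assms
proof (induction "rep_dim G \<sigma>" arbitrary: \<sigma> rule: less_induct)
  case less
  let ?n = "rep_dim G \<sigma>"
  note \<sigma> = less.prems
  note c = is_repD(1)[OF \<sigma>]
  consider "?n = 0" | "irreducible_rep G \<sigma>" | "0 < ?n" "\<not> irreducible_rep G \<sigma>" by blast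
  then show ?case
  proof cases
    case 1
    have "dsum [] g = \<sigma> g" if "g \<in> carrier G" for g
      using c[OF that] 1 by (intro eq_matI) (auto simp: dsum_def)
    then have "rep_iso G (dsum []) \<sigma>" by (intro rep_iso_sym[OF rep_iso_cong[OF \<sigma>]]) auto
    then have "decomposes G [] \<sigma>" by (simp add: decomposes_def)
    then show ?thesis ..
  next
    case 2
    have "rep_iso G (dsum [\<sigma>]) \<sigma>"
      using rep_iso_refl[OF \<sigma>] by (simp only: dsum_def list.map diag_block_mat_singleton)
    then have "decomposes G [\<sigma>] \<sigma>" using 2 by (simp add: decomposes_def)
    then show ?thesis ..
  next
    case 3
    obtain E where E: "E \<in> carrier_mat ?n ?n" "E * E = E" "E \<noteq> 0\<^sub>m ?n ?n" "E \<noteq> 1\<^sub>m ?n"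
      and comm: "\<forall>g\<in>carrier G. E * \<sigma> g = \<sigma> g * E"
      using commuting_idempotent[OF \<sigma> 3] .
    define F where "F = 1\<^sub>m ?n - E"
    have F: "F \<in> carrier_mat ?n ?n" unfolding F_def by (rule minus_carrier_mat[OF E(1)])
    have EF: "E * F = 0\<^sub>m ?n ?n" and FE: "F * E = 0\<^sub>m ?n ?n"
      using mult_minus_distrib_mat[OF E(1) one_carrier_mat E(1)]
        minus_mult_distrib_mat[OF one_carrier_mat E(1) E(1)] left_mult_one_mat[OF E(1)]
        right_mult_one_mat[OF E(1)] minus_r_inv_mat[OF E(1)]
      by (simp_all only: F_def E(2))
    have FF: "F * F = F"
    proof -
      have "F * F = F - E * F"
        using minus_mult_distrib_mat[OF one_carrier_mat E(1) F] left_mult_one_mat[OF F]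
        by (simp only: F_def)
      then show ?thesis using F unfolding EF by (intro eq_matI) auto
    qed
    have commF: "\<forall>g\<in>carrier G. F * \<sigma> g = \<sigma> g * F"
    proof
      fix g assume g: "g \<in> carrier G"
      have "F * \<sigma> g = \<sigma> g - E * \<sigma> g"
        using minus_mult_distrib_mat[OF one_carrier_mat E(1) c[OF g]] left_mult_one_mat[OF c[OF g]]
        by (simp only: F_def)
      also have "\<dots> = \<sigma> g * F"
        using mult_minus_distrib_mat[OF c[OF g] one_carrier_mat E(1)] right_mult_one_mat[OF c[OF g]]
          comm g by (simp only: F_def)
      finally show "F * \<sigma> g = \<sigma> g * F" .
    qed
    obtain k1 B1 C1 where BC1: "B1 \<in> carrier_mat ?n k1" "C1 \<in> carrier_mat k1 ?n" "C1 * B1 = 1\<^sub>m k1" "B1 * C1 = E"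
      using idempotent_splits[OF E(1,2)] .
    obtain k2 B2 C2 where BC2: "B2 \<in> carrier_mat ?n k2" "C2 \<in> carrier_mat k2 ?n" "C2 * B2 = 1\<^sub>m k2" "B2 * C2 = F"
      using idempotent_splits[OF F FF] .
    have sum: "B1 * C1 + B2 * C2 = 1\<^sub>m ?n" unfolding BC1(4) BC2(4) F_def using E(1) by (intro eq_matI) auto
    have orth: "C * B' = 0\<^sub>m k k'"
      if "B \<in> carrier_mat ?n k" "C \<in> carrier_mat k ?n" "C * B = 1\<^sub>m k"
        "B' \<in> carrier_mat ?n k'" "C' \<in> carrier_mat k' ?n" "C' * B' = 1\<^sub>m k'"
        "(B * C) * (B' * C') = 0\<^sub>m ?n ?n" for B C B' C' :: "'k mat" and k k'
    proof -
      have BC: "B * C \<in> carrier_mat ?n ?n" and BC': "B' * C' \<in> carrier_mat ?n ?n"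
        by (rule mult_carrier_mat[OF that(1,2)], rule mult_carrier_mat[OF that(4,5)])
      have "C * (B * C) = C"
        using assoc_mult_mat[OF that(2,1,2)] left_mult_one_mat[OF that(2)] by (simp only: that(3))
      then have "C * (B' * C') = C * ((B * C) * (B' * C'))"
        using assoc_mult_mat[OF that(2) BC BC'] by (simp only:)
      also have "\<dots> = 0\<^sub>m k ?n" unfolding that(7) by (rule right_mult_zero_mat[OF that(2)])
      finally have 0: "C * (B' * C') = 0\<^sub>m k ?n" .
      have "(B' * C') * B' = B'"
        using assoc_mult_mat[OF that(4,5,4)] right_mult_one_mat[OF that(4)] by (simp only: that(6))
      then have "C * B' = C * (B' * C') * B'"
        using assoc_mult_mat[OF that(2) BC' that(4)] by (simp only:)
      also have "\<dots> = 0\<^sub>m k k'" unfolding 0 by (rule left_mult_zero_mat[OF that(4)])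
      finally show ?thesis .
    qed
    have o1: "C1 * B2 = 0\<^sub>m k1 k2"
      by (rule orth[OF BC1(1-3) BC2(1-3)]) (simp only: BC1(4) BC2(4) EF)
    have o2: "C2 * B1 = 0\<^sub>m k2 k1"
      by (rule orth[OF BC2(1-3) BC1(1-3)]) (simp only: BC1(4) BC2(4) FE)
    define \<sigma>1 where "\<sigma>1 = (\<lambda>g. C1 * (\<sigma> g * B1))"
    define \<sigma>2 where "\<sigma>2 = (\<lambda>g. C2 * (\<sigma> g * B2))"
    note s1 = is_rep_summand[OF \<sigma> refl BC1(1-3), unfolded BC1(4), OF comm, folded \<sigma>1_def]
    note s2 = is_rep_summand[OF \<sigma> refl BC2(1-3), unfolded BC2(4), OF commF, folded \<sigma>2_def]
    have dims: "k1 \<noteq> 0" "k2 \<noteq> 0" "k1 + k2 = ?n"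
    proof -
      have z: "X * Y = 0\<^sub>m ?n ?n" if "X \<in> carrier_mat ?n 0" "Y \<in> carrier_mat 0 ?n" for X Y :: "'k mat"
        using that by (intro eq_matI) (auto simp: scalar_prod_def)
      show "k1 \<noteq> 0" using z[of B1 C1] BC1(1,2) E(3) unfolding BC1(4) by metis
      show "k2 \<noteq> 0"
      proof
        assume "k2 = 0"
        then have "F = 0\<^sub>m ?n ?n" using z[of B2 C2] BC2(1,2) unfolding BC2(4) by metis
        then have "E + 0\<^sub>m ?n ?n = 1\<^sub>m ?n" using sum by (simp only: BC1(4) BC2(4))
        then show False using E(4) right_add_zero_mat[OF E(1)] by (simp only:)
      qed
      have "of_nat (k1 + k2) = (of_nat ?n :: 'k)"
      proof -
        have "tr (B1 * C1 + B2 * C2) = tr (B1 * C1) + tr (B2 * C2)"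
          unfolding BC1(4) BC2(4) using E(1) F by (simp add: tr_def sum.distrib)
        also have "\<dots> = of_nat k1 + of_nat k2"
          by (simp only: tr_mult_comm[OF BC1(1,2)] tr_mult_comm[OF BC2(1,2)] BC1(3) BC2(3) tr_one)
        finally show ?thesis unfolding sum by simp
      qed
      then show "k1 + k2 = ?n" by (simp only: of_nat_eq_iff)
    qed
    have "rep_dim G \<sigma>1 < ?n" "rep_dim G \<sigma>2 < ?n" using s1(2) s2(2) dims by linarith+
    then obtain \<rho>s1 \<rho>s2 where r1: "decomposes G \<rho>s1 \<sigma>1" and r2: "decomposes G \<rho>s2 \<sigma>2"
      using less.hyps[OF _ s1(1)] less.hyps[OF _ s2(1)] by blast
    have "decomposes G (\<rho>s1 @ \<rho>s2) \<sigma>"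
    proof (rule decomposes_block[OF \<sigma> refl BC1(1) BC2(1) BC1(2) BC2(2) BC1(3) BC2(3) o1 o2 sum _ _ _ _ _ _ r1 r2])
      show "is_rep G \<sigma>1" "rep_dim G \<sigma>1 = k1" "is_rep G \<sigma>2" "rep_dim G \<sigma>2 = k2"
        by (rule s1(1,2) s2(1,2))+
      fix g assume g: "g \<in> carrier G"
      show "B1 * \<sigma>1 g = \<sigma> g * B1" "B2 * \<sigma>2 g = \<sigma> g * B2"
        unfolding \<sigma>1_def \<sigma>2_def
        by (rule s1(3)[OF g, unfolded \<sigma>1_def] s2(3)[OF g, unfolded \<sigma>2_def])+
    qed
    then show ?thesis ..
  qed
qed

section \<open>Characters and multiplicities\<close>

text \<open>The sum is that of the diagonal entries \<open>(i, j)\<close> of the averages of the matrix units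
  $E_{ij}$. These averages are intertwiners: they vanish if the representations are not isomorphic,
  and for \<open>\<rho> = \<sigma>\<close> they are scalars, which are found by taking traces.\<close>

lemma character_orthogonality:
  fixes \<rho> \<sigma> :: "'a \<Rightarrow> complex mat"
  assumes \<rho>: "irreducible_rep G \<rho>" and \<sigma>: "irreducible_rep G \<sigma>"
  shows "(\<Sum>g\<in>carrier G. tr (\<sigma> g) * tr (\<rho> (inv g))) =
         (if rep_iso G \<rho> \<sigma> then of_nat (card (carrier G)) else 0)"
proof -
  define unit :: "nat \<Rightarrow> nat \<Rightarrow> nat \<Rightarrow> nat \<Rightarrow> complex mat" where
    "unit n m i j = mat n m (\<lambda>(a, b). if a = i \<and> b = j then 1 else 0)" for n m i j
  define S where "S \<sigma> \<rho> i j = mat_sum (rep_dim G \<sigma>) (rep_dim G \<rho>)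
      (\<lambda>g. \<sigma> g * unit (rep_dim G \<sigma>) (rep_dim G \<rho>) i j * \<rho> (inv g)) (carrier G)"
    for \<sigma> \<rho> :: "'a \<Rightarrow> complex mat" and i j
  have unit_c: "unit n m i j \<in> carrier_mat n m" for n m i j by (simp add: unit_def)
  have entry: "(A * unit n m i j * B) $$ (i, j) = A $$ (i, i) * B $$ (j, j)"
    if "A \<in> carrier_mat n n" "B \<in> carrier_mat m m" "i < n" "j < m" for A B n m i j
  proof -
    have AU: "(A * unit n m i j) $$ (i, b) = (if b = j then A $$ (i, i) else 0)" if b: "b < m" for b
    proof -
      have "(A * unit n m i j) $$ (i, b) = (\<Sum>a\<in>{0..<n}. A $$ (i, a) * (if a = i \<and> b = j then 1 else 0))"
        using \<open>A \<in> carrier_mat n n\<close> \<open>i < n\<close> b by (simp add: unit_def scalar_prod_def)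
      also have "\<dots> = (\<Sum>a\<in>{0..<n}. if a = i then (if b = j then A $$ (i, i) else 0) else 0)"
        by (rule sum.cong) auto
      also have "\<dots> = (if b = j then A $$ (i, i) else 0)" using \<open>i < n\<close> by (simp add: sum.delta)
      finally show ?thesis .
    qed
    have "(Z * B) $$ (i, j) = (\<Sum>b\<in>{0..<m}. Z $$ (i, b) * B $$ (b, j))" if "Z \<in> carrier_mat n m" for Z
      using \<open>B \<in> carrier_mat m m\<close> \<open>i < n\<close> \<open>j < m\<close> that by (simp add: scalar_prod_def)
    from this[OF mult_carrier_mat[OF \<open>A \<in> carrier_mat n n\<close> unit_c]]
    have "(A * unit n m i j * B) $$ (i, j) = (\<Sum>b\<in>{0..<m}. (A * unit n m i j) $$ (i, b) * B $$ (b, j))" .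
    also have "\<dots> = (\<Sum>b\<in>{0..<m}. if b = j then A $$ (i, i) * B $$ (j, j) else 0)"
      by (rule sum.cong) (auto simp: AU)
    also have "\<dots> = A $$ (i, i) * B $$ (j, j)" using \<open>j < m\<close> by (simp add: sum.delta)
    finally show ?thesis .
  qed
  have expand: "(\<Sum>g\<in>carrier G. tr (\<sigma> g) * tr (\<rho> (inv g))) =
      (\<Sum>i<rep_dim G \<sigma>. \<Sum>j<rep_dim G \<rho>. S \<sigma> \<rho> i j $$ (i, j))"
    if "is_rep G \<rho>" "is_rep G \<sigma>" for \<rho> \<sigma> :: "'a \<Rightarrow> complex mat"
  proof -
    let ?n = "rep_dim G \<sigma>" and ?m = "rep_dim G \<rho>"
    have "S \<sigma> \<rho> i j $$ (i, j) = (\<Sum>g\<in>carrier G. \<sigma> g $$ (i, i) * \<rho> (inv g) $$ (j, j))"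
      if "i < ?n" "j < ?m" for i j
    proof -
      have "S \<sigma> \<rho> i j $$ (i, j) =
          (\<Sum>g\<in>carrier G. (\<sigma> g * unit ?n ?m i j * \<rho> (inv g)) $$ (i, j))"
        unfolding S_def mat_sum_def using that by simp
      also have "\<dots> = (\<Sum>g\<in>carrier G. \<sigma> g $$ (i, i) * \<rho> (inv g) $$ (j, j))"
        using that
        by (intro sum.cong refl entry is_repD(1)[OF \<open>is_rep G \<rho>\<close>] is_repD(1)[OF \<open>is_rep G \<sigma>\<close>] inv_closed)
      finally show ?thesis .
    qed
    then have "(\<Sum>i<?n. \<Sum>j<?m. S \<sigma> \<rho> i j $$ (i, j)) =
        (\<Sum>i<?n. \<Sum>j<?m. \<Sum>g\<in>carrier G. \<sigma> g $$ (i, i) * \<rho> (inv g) $$ (j, j))"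
      by simp
    also have "\<dots> = (\<Sum>i<?n. \<Sum>g\<in>carrier G. \<Sum>j<?m. \<sigma> g $$ (i, i) * \<rho> (inv g) $$ (j, j))"
      by (rule sum.cong[OF refl], rule sum.swap)
    also have "\<dots> = (\<Sum>g\<in>carrier G. \<Sum>i<?n. \<Sum>j<?m. \<sigma> g $$ (i, i) * \<rho> (inv g) $$ (j, j))"
      by (rule sum.swap)
    also have "\<dots> = (\<Sum>g\<in>carrier G. tr (\<sigma> g) * tr (\<rho> (inv g)))"
    proof (rule sum.cong[OF refl])
      fix g assume g: "g \<in> carrier G"
      have "dim_row (\<sigma> g) = ?n" "dim_row (\<rho> (inv g)) = ?m"
        using is_repD(1)[OF \<open>is_rep G \<sigma>\<close> g] is_repD(1)[OF \<open>is_rep G \<rho>\<close>, of "inv g"] g by auto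
      then show "(\<Sum>i<?n. \<Sum>j<?m. \<sigma> g $$ (i, i) * \<rho> (inv g) $$ (j, j)) = tr (\<sigma> g) * tr (\<rho> (inv g))"
        by (simp add: tr_def sum_product)
    qed
    finally show ?thesis by simp
  qed
  note r = irreducible_repD(1)[OF \<rho>] irreducible_repD(1)[OF \<sigma>]
  have int: "S \<sigma> \<rho> i j * \<rho> h = \<sigma> h * S \<sigma> \<rho> i j" if "is_rep G \<rho>" "is_rep G \<sigma>" "h \<in> carrier G"
    for \<sigma> \<rho> i j h
    unfolding S_def using that by (intro averaged_intertwiner unit_c)
  have S_c: "S \<sigma> \<rho> i j \<in> carrier_mat (rep_dim G \<sigma>) (rep_dim G \<rho>)" for \<sigma> \<rho> i j
    by (simp add: S_def)
  show ?thesis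
  proof (cases "rep_iso G \<rho> \<sigma>")
    case False
    have "S \<sigma> \<rho> i j = 0\<^sub>m (rep_dim G \<sigma>) (rep_dim G \<rho>)" for i j
      using intertwiner_zero_or_iso[OF \<sigma> \<rho> S_c int[OF r]] False by blast
    then show ?thesis using expand[OF r] False by simp
  next
    case True
    let ?n = "rep_dim G \<rho>"
    have "(\<Sum>g\<in>carrier G. tr (\<sigma> g) * tr (\<rho> (inv g))) = (\<Sum>g\<in>carrier G. tr (\<rho> g) * tr (\<rho> (inv g)))"
      using rep_iso_tr[OF True] by (intro sum.cong) auto
    also have "\<dots> = (\<Sum>i<?n. \<Sum>j<?n. S \<rho> \<rho> i j $$ (i, j))" by (rule expand[OF r(1) r(1)])
    also have "\<dots> = (\<Sum>i<?n. \<Sum>j<?n. if j = i then of_nat (card (carrier G)) / of_nat ?n else 0)"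
    proof (intro sum.cong refl)
      fix i j assume "i \<in> {..<?n}" "j \<in> {..<?n}"
      then have i: "i < ?n" and j: "j < ?n" by auto
      obtain a where a: "S \<rho> \<rho> i j = a \<cdot>\<^sub>m 1\<^sub>m ?n"
        using intertwiner_scalar[OF \<rho> S_c int[OF r(1) r(1)]] by blast
      have tru: "tr (unit ?n ?n i j) = (if i = j then 1 else 0)"
      proof -
        have "tr (unit ?n ?n i j) = (\<Sum>a<?n. if a = i then (if i = j then 1 else 0) else 0)"
          unfolding tr_def unit_def by (auto intro!: sum.cong)
        then show ?thesis using i by (simp add: sum.delta)
      qed
      have "a * of_nat ?n = tr (S \<rho> \<rho> i j)" by (simp add: a tr_def)
      also have "\<dots> = (\<Sum>g\<in>carrier G. tr (\<rho> g * unit ?n ?n i j * \<rho> (inv g)))"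
        unfolding S_def
        by (intro tr_mat_sum mult_carrier_mat[OF mult_carrier_mat[OF _ unit_c]] is_repD(1)[OF r(1)] inv_closed)
      also have "\<dots> = (\<Sum>g\<in>carrier G. if i = j then 1 else 0)"
      proof (rule sum.cong[OF refl])
        fix g assume g: "g \<in> carrier G"
        have c: "\<rho> g \<in> carrier_mat ?n ?n" "\<rho> (inv g) \<in> carrier_mat ?n ?n"
          using is_repD(1)[OF r(1)] g by auto
        have "tr (\<rho> g * unit ?n ?n i j * \<rho> (inv g)) = tr (\<rho> (inv g) * (\<rho> g * unit ?n ?n i j))"
          by (rule tr_mult_comm[OF mult_carrier_mat[OF c(1) unit_c] c(2)])
        also have "\<rho> (inv g) * (\<rho> g * unit ?n ?n i j) = unit ?n ?n i j"
          using assoc_mult_mat[OF c(2) c(1) unit_c[of ?n ?n i j]] is_rep_inv(2)[OF r(1) g]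
            left_mult_one_mat[OF unit_c[of ?n ?n i j]] by (simp only:)
        finally show "tr (\<rho> g * unit ?n ?n i j * \<rho> (inv g)) = (if i = j then 1 else 0)" by (simp only: tru)
      qed
      finally have "a * of_nat ?n = (if i = j then of_nat (card (carrier G)) else 0)" by simp
      then have "(if i = j then a else 0) = (if j = i then of_nat (card (carrier G)) / of_nat ?n else 0)"
        using irreducible_repD(2)[OF \<rho>] by (auto simp: field_simps)
      moreover have "S \<rho> \<rho> i j $$ (i, j) = (if i = j then a else 0)" using i j by (simp add: a)
      ultimately show "S \<rho> \<rho> i j $$ (i, j) = (if j = i then of_nat (card (carrier G)) / of_nat ?n else 0)"
        by (simp only:)
    qed
    also have "\<dots> = of_nat (card (carrier G))"
      using irreducible_repD(2)[OF \<rho>] by (simp add: sum.delta)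
    finally show ?thesis using True by simp
  qed
qed

text \<open>By orthogonality the inner product with the character of \<open>\<rho>\<close> counts the summands isomorphic
  to \<open>\<rho>\<close>. So their number is the same for all decompositions.\<close>

lemma decomposes_character:
  fixes \<rho> \<sigma> :: "'a \<Rightarrow> complex mat"
  assumes \<rho>: "irreducible_rep G \<rho>" and dec: "decomposes G \<rho>s \<sigma>"
  shows "(\<Sum>g\<in>carrier G. tr (\<sigma> g) * tr (\<rho> (inv g))) =
         of_nat (length (filter (\<lambda>\<tau>. \<tau> \<in> iso_class G \<rho>) \<rho>s)) * of_nat (card (carrier G))"
    and "g \<in> carrier G \<Longrightarrow> tr (\<sigma> g) = (\<Sum>\<tau>\<leftarrow>\<rho>s. tr (\<tau> g))"
proof -
  have irr: "\<And>\<tau>. \<tau> \<in> set \<rho>s \<Longrightarrow> irreducible_rep G \<tau>" and iso: "rep_iso G (dsum \<rho>s) \<sigma>"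
    using dec by (auto simp: decomposes_def)
  show tr_sum: "tr (\<sigma> g) = (\<Sum>\<tau>\<leftarrow>\<rho>s. tr (\<tau> g))" if "g \<in> carrier G" for g
    using tr_dsum[of \<rho>s g] irreducible_repD(1)[OF irr] that rep_iso_tr[OF iso that] by simp
  have "(\<Sum>g\<in>carrier G. tr (\<sigma> g) * tr (\<rho> (inv g))) =
      (\<Sum>g\<in>carrier G. (\<Sum>\<tau>\<leftarrow>\<rho>s. tr (\<tau> g)) * tr (\<rho> (inv g)))"
    by (intro sum.cong refl) (simp add: tr_sum)
  also have "\<dots> = (\<Sum>\<tau>\<leftarrow>\<rho>s. \<Sum>g\<in>carrier G. tr (\<tau> g) * tr (\<rho> (inv g)))"
    by (induction \<rho>s) (simp_all add: distrib_right sum.distrib)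
  also have "\<dots> = (\<Sum>\<tau>\<leftarrow>\<rho>s. if rep_iso G \<rho> \<tau> then of_nat (card (carrier G)) else 0)"
    using irr by (intro arg_cong[of _ _ sum_list] map_cong refl character_orthogonality[OF \<rho>])
  also have "\<dots> = of_nat (length (filter (\<lambda>\<tau>. \<tau> \<in> iso_class G \<rho>) \<rho>s)) * of_nat (card (carrier G))"
    by (induction \<rho>s) (simp_all add: iso_class_def algebra_simps)
  finally show "(\<Sum>g\<in>carrier G. tr (\<sigma> g) * tr (\<rho> (inv g))) =
      of_nat (length (filter (\<lambda>\<tau>. \<tau> \<in> iso_class G \<rho>) \<rho>s)) * of_nat (card (carrier G))" .
qed

lemma mult_of_eq_length:
  fixes \<rho> \<sigma> :: "'a \<Rightarrow> complex mat"
  assumes \<rho>: "irreducible_rep G \<rho>" and dec: "decomposes G \<rho>s \<sigma>"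
  shows "mult_of G (iso_class G \<rho>) \<sigma> = length (filter (\<lambda>\<tau>. \<tau> \<in> iso_class G \<rho>) \<rho>s)"
  unfolding mult_of_def
proof (rule the_equality)
  show "\<exists>\<rho>s'. decomposes G \<rho>s' \<sigma> \<and> length (filter (\<lambda>\<tau>. \<tau> \<in> iso_class G \<rho>) \<rho>s) =
      length (filter (\<lambda>\<tau>. \<tau> \<in> iso_class G \<rho>) \<rho>s')"
    using dec by blast
  fix k assume "\<exists>\<rho>s'. decomposes G \<rho>s' \<sigma> \<and> k = length (filter (\<lambda>\<tau>. \<tau> \<in> iso_class G \<rho>) \<rho>s')"
  then obtain \<rho>s' where *: "decomposes G \<rho>s' \<sigma>" "k = length (filter (\<lambda>\<tau>. \<tau> \<in> iso_class G \<rho>) \<rho>s')"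
    by blast
  have "(of_nat k :: complex) = of_nat (length (filter (\<lambda>\<tau>. \<tau> \<in> iso_class G \<rho>) \<rho>s))"
    using decomposes_character(1)[OF \<rho> dec] decomposes_character(1)[OF \<rho> *(1)] *(2)
      card_carrier_nonzero[where 'k=complex] by simp
  then show "k = length (filter (\<lambda>\<tau>. \<tau> \<in> iso_class G \<rho>) \<rho>s)" by (simp only: of_nat_eq_iff)
qed

lemma mult_of_character:
  fixes \<rho> \<sigma> :: "'a \<Rightarrow> complex mat"
  assumes \<rho>: "irreducible_rep G \<rho>" and \<sigma>: "is_rep G \<sigma>"
  shows "of_nat (mult_of G (iso_class G \<rho>) \<sigma>) * of_nat (card (carrier G)) =
         (\<Sum>g\<in>carrier G. tr (\<sigma> g) * tr (\<rho> (inv g)))"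
proof -
  obtain \<rho>s where "decomposes G \<rho>s \<sigma>" using complete_reducibility[OF \<sigma>] ..
  then show ?thesis by (simp only: mult_of_eq_length[OF \<rho>] decomposes_character(1)[OF \<rho>])
qed

text \<open>The average \<open>E\<close> of the matrices \<open>\<rho> g\<close> is the projection onto the space of invariants, so the
  sum is the order of the group times the dimension of this space.\<close>

lemma sum_character_nonneg:
  fixes \<rho> :: "'a \<Rightarrow> complex mat"
  assumes \<rho>: "is_rep G \<rho>"
  shows "(\<Sum>g\<in>carrier G. tr (\<rho> g)) \<in> \<real>\<^sub>\<ge>\<^sub>0"
proof -
  let ?n = "rep_dim G \<rho>" and ?N = "of_nat (card (carrier G)) :: complex"
  define P where "P = mat_sum ?n ?n \<rho> (carrier G)"
  have P: "P \<in> carrier_mat ?n ?n" by (simp add: P_def)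
  note c = is_repD(1)[OF \<rho>]
  have gP: "\<rho> g * P = P" if g: "g \<in> carrier G" for g
  proof -
    have "\<rho> g * P = mat_sum ?n ?n (\<lambda>h. \<rho> g * \<rho> h) (carrier G)"
      unfolding P_def using c[OF g] c by (rule mult_mat_sum)
    also have "\<dots> = mat_sum ?n ?n (\<lambda>h. \<rho> (g \<otimes> h)) (carrier G)"
      using is_repD(3)[OF \<rho> g] by (intro mat_sum_cong) auto
    also have "\<dots> = P" unfolding P_def by (rule mat_sum_reindex[OF bij_betw_left_mult[OF g], symmetric])
    finally show ?thesis .
  qed
  have "P * P = mat_sum ?n ?n (\<lambda>g. \<rho> g * P) (carrier G)"
    using mat_sum_mult[OF P c, of "carrier G"] by (simp add: P_def)
  also have "\<dots> = mat_sum ?n ?n (\<lambda>_. P) (carrier G)" by (intro mat_sum_cong refl gP)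
  also have "\<dots> = ?N \<cdot>\<^sub>m P" by (rule mat_sum_const[OF P])
  finally have PP: "P * P = ?N \<cdot>\<^sub>m P" .
  define E where "E = inverse ?N \<cdot>\<^sub>m P"
  have E: "E \<in> carrier_mat ?n ?n" using P by (simp add: E_def)
  have "E * E = inverse ?N \<cdot>\<^sub>m (inverse ?N \<cdot>\<^sub>m (P * P))"
    using mult_smult_assoc_mat[OF P E, of "inverse ?N"] mult_smult_distrib[OF P P, of "inverse ?N"]
    by (simp add: E_def)
  also have "\<dots> = E"
    using card_carrier_nonzero[where 'k=complex] by (simp add: PP E_def) (rule eq_matI, auto)
  finally obtain k where k: "tr E = of_nat k" using tr_idempotent[OF E] by blast
  have "(\<Sum>g\<in>carrier G. tr (\<rho> g)) = tr P" unfolding P_def using c by (rule tr_mat_sum[symmetric])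
  also have "\<dots> = ?N * tr E"
  proof -
    have "tr E = inverse ?N * tr P" using P by (simp add: E_def tr_def sum_distrib_left)
    then show ?thesis using card_carrier_nonzero[where 'k=complex] by (simp add: field_simps)
  qed
  also have "\<dots> = of_nat (card (carrier G) * k)" by (simp add: k)
  finally show ?thesis by simp
qed

end

section \<open>Permutation modules\<close>

text \<open>The module of functions on a finite set \<open>Y\<close> with an action \<open>\<alpha>\<close>. Functions are composed with the
  inverse, so that the basis vector of \<open>A\<close> goes to that of \<open>\<alpha> g A\<close>.\<close>

locale permutation_module = fin_group G for G :: "('a, 'b) monoid_scheme" (structure) +
  fixes Y :: "'i set" and \<alpha> :: "'a \<Rightarrow> 'i \<Rightarrow> 'i"
    and act :: "'a \<Rightarrow> ('i \<Rightarrow> 'k::field_char_0) \<Rightarrow> ('i \<Rightarrow> 'k)"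
  assumes finite_Y: "finite Y"
    and \<alpha>_closed: "g \<in> carrier G \<Longrightarrow> A \<in> Y \<Longrightarrow> \<alpha> g A \<in> Y"
    and \<alpha>_one: "A \<in> Y \<Longrightarrow> \<alpha> \<one> A = A"
    and \<alpha>_mult: "g \<in> carrier G \<Longrightarrow> h \<in> carrier G \<Longrightarrow> A \<in> Y \<Longrightarrow> \<alpha> (g \<otimes> h) A = \<alpha> g (\<alpha> h A)"
    and act_eq: "g \<in> carrier G \<Longrightarrow> f \<in> free_space Y \<Longrightarrow>
          act g f = (\<lambda>A. if A \<in> Y then f (\<alpha> (inv g) A) else 0)"
begin

definition enum :: "nat \<Rightarrow> 'i" where
  "enum = (SOME e. bij_betw e {..<card Y} Y)"

definition coords :: "('i \<Rightarrow> 'k) \<Rightarrow> 'k vec" where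
  "coords f = vec (card Y) (\<lambda>i. f (enum i))"

definition perm_rep :: "'a \<Rightarrow> 'k mat" where
  "perm_rep g = mat (card Y) (card Y) (\<lambda>(i, j). if \<alpha> (inv g) (enum i) = enum j then 1 else 0)"

lemma enum_bij: "bij_betw enum {..<card Y} Y"
proof -
  have "\<exists>e. bij_betw e {..<card Y} Y"
    using ex_bij_betw_nat_finite[OF finite_Y] by (simp add: atLeast0LessThan)
  then show ?thesis unfolding enum_def by (rule someI_ex)
qed

lemma enum_eq_iff: "i < card Y \<Longrightarrow> j < card Y \<Longrightarrow> enum i = enum j \<longleftrightarrow> i = j"
  using enum_bij by (auto simp: bij_betw_def inj_on_def)

lemma enum_in: "i < card Y \<Longrightarrow> enum i \<in> Y"
  using enum_bij by (auto simp: bij_betw_def)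

lemma enum_surj: "A \<in> Y \<Longrightarrow> \<exists>i<card Y. enum i = A"
  using enum_bij by (metis bij_betw_def image_iff lessThan_iff)

lemma sum_enum_delta:
  fixes h :: "nat \<Rightarrow> 'k"
  assumes "A \<in> Y" "\<And>k. k < card Y \<Longrightarrow> enum k = A \<Longrightarrow> h k = c"
  shows "(\<Sum>k<card Y. if A = enum k then h k else 0) = c"
proof -
  obtain k0 where k0: "k0 < card Y" "enum k0 = A" using enum_surj assms(1) by blast
  have "(\<Sum>k<card Y. if A = enum k then h k else 0) = (\<Sum>k<card Y. if k = k0 then c else 0)"
    using k0 enum_eq_iff assms(2) by (intro sum.cong) auto
  then show ?thesis using k0 by (simp add: sum.delta)
qed

lemma inv_closed_Y: "g \<in> carrier G \<Longrightarrow> A \<in> Y \<Longrightarrow> \<alpha> (inv g) A \<in> Y"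
  by (simp add: \<alpha>_closed)

lemma perm_rep: "is_rep G perm_rep" "rep_dim G perm_rep = card Y"
proof -
  have 1: "perm_rep g \<in> carrier_mat (card Y) (card Y)" for g by (simp add: perm_rep_def)
  have 2: "perm_rep \<one> = 1\<^sub>m (card Y)"
    by (intro eq_matI) (auto simp: perm_rep_def \<alpha>_one enum_in enum_eq_iff)
  have 3: "perm_rep (g \<otimes> h) = perm_rep g * perm_rep h" if g: "g \<in> carrier G" and h: "h \<in> carrier G" for g h
  proof (rule eq_matI)
    fix i j assume "i < dim_row (perm_rep g * perm_rep h)" "j < dim_col (perm_rep g * perm_rep h)"
    then have ij: "i < card Y" "j < card Y" by (auto simp: perm_rep_def)
    have "(perm_rep g * perm_rep h) $$ (i, j) = (\<Sum>k<card Y. (if \<alpha> (inv g) (enum i) = enum k then 1 else 0) *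
        (if \<alpha> (inv h) (enum k) = enum j then 1 else 0))"
      using ij by (simp add: perm_rep_def scalar_prod_def lessThan_atLeast0)
    also have "\<dots> = (\<Sum>k<card Y. if \<alpha> (inv g) (enum i) = enum k then
        (if \<alpha> (inv h) (enum k) = enum j then 1 else 0) else 0)"
      by (intro sum.cong) auto
    also have "\<dots> = (if \<alpha> (inv h) (\<alpha> (inv g) (enum i)) = enum j then 1 else 0)"
      using inv_closed_Y[OF g enum_in] ij by (intro sum_enum_delta) auto
    also have "\<alpha> (inv h) (\<alpha> (inv g) (enum i)) = \<alpha> (inv (g \<otimes> h)) (enum i)"
      using g h ij by (simp add: inv_mult_group \<alpha>_mult enum_in)
    finally show "perm_rep (g \<otimes> h) $$ (i, j) = (perm_rep g * perm_rep h) $$ (i, j)"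
      using ij by (simp add: perm_rep_def)
  qed (simp_all add: perm_rep_def)
  show "is_rep G perm_rep" "rep_dim G perm_rep = card Y"
    using is_repI[of G perm_rep "card Y"] 1 2 3 by blast+
qed

lemma coords_act:
  assumes g: "g \<in> carrier G" and f: "f \<in> free_space Y"
  shows "coords (act g f) = perm_rep g *\<^sub>v coords f"
proof (rule eq_vecI)
  fix i assume "i < dim_vec (perm_rep g *\<^sub>v coords f)"
  then have i: "i < card Y" by (simp add: perm_rep_def)
  have "(perm_rep g *\<^sub>v coords f) $ i =
      (\<Sum>k<card Y. (if \<alpha> (inv g) (enum i) = enum k then 1 else 0) * f (enum k))"
    using i by (simp add: perm_rep_def coords_def scalar_prod_def lessThan_atLeast0)
  also have "\<dots> = (\<Sum>k<card Y. if \<alpha> (inv g) (enum i) = enum k then f (enum k) else 0)"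
    by (intro sum.cong) auto
  also have "\<dots> = f (\<alpha> (inv g) (enum i))"
    using inv_closed_Y[OF g enum_in[OF i]] by (intro sum_enum_delta) auto
  also have "\<dots> = coords (act g f) $ i"
    using i act_eq[OF g f] by (simp add: coords_def enum_in)
  finally show "coords (act g f) $ i = (perm_rep g *\<^sub>v coords f) $ i" by simp
qed (simp add: coords_def perm_rep_def)

lemma coords_surj:
  assumes "v \<in> carrier_vec (card Y)"
  shows "\<exists>f\<in>free_space Y. coords f = v"
proof
  let ?f = "\<lambda>A. if A \<in> Y then v $ the_inv_into {..<card Y} enum A else 0"
  show "?f \<in> free_space Y" by (simp add: free_space_def)
  have "the_inv_into {..<card Y} enum (enum i) = i" if "i < card Y" for i
    using enum_bij that by (intro the_inv_into_f_f) (auto simp: bij_betw_def)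
  then show "coords ?f = v"
    using assms by (intro eq_vecI) (auto simp: coords_def enum_in)
qed

lemma coords_eq_zero:
  assumes "f \<in> free_space Y" "coords f = 0\<^sub>v (card Y)"
  shows "f = (\<lambda>_. 0)"
proof
  fix A
  show "f A = 0"
  proof (cases "A \<in> Y")
    case True
    then obtain i where i: "i < card Y" "enum i = A" using enum_surj by blast
    have "coords f $ i = 0" using assms(2) i by simp
    then show ?thesis using i by (simp add: coords_def)
  qed (use assms(1) in \<open>simp add: free_space_def\<close>)
qed

lemma carries_perm_rep: "carries G (free_space Y) {\<lambda>_. 0} act perm_rep"
  unfolding carries_def perm_rep(2)
proof (intro conjI exI[of _ coords] perm_rep(1) ballI allI)
  show "coords ` free_space Y = carrier_vec (card Y)"
    using coords_surj by (auto simp: coords_def)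
  show "{f \<in> free_space Y. coords f = 0\<^sub>v (card Y)} = {\<lambda>_. 0}"
    using coords_eq_zero by (auto simp: free_space_def coords_def)
qed (simp_all add: coords_act, auto simp: coords_def)

text \<open>Any two ways of writing the module by matrices agree up to isomorphism: here the isomorphism
  has the images under \<open>T\<close> of the basis vectors as columns.\<close>

lemma carries_iso_perm_rep:
  assumes \<sigma>: "carries G (free_space Y) {\<lambda>_. 0} act \<sigma>"
  shows "rep_iso G perm_rep \<sigma>"
proof -
  let ?d = "rep_dim G \<sigma>" and ?n = "card Y"
  have rep: "is_rep G \<sigma>" using \<sigma> by (simp add: carries_def)
  obtain T where T: "T ` free_space Y = carrier_vec ?d"
    and add: "\<And>f h. f \<in> free_space Y \<Longrightarrow> h \<in> free_space Y \<Longrightarrow> T (\<lambda>i. f i + h i) = T f + T h"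
    and smult: "\<And>a f. f \<in> free_space Y \<Longrightarrow> T (\<lambda>i. a * f i) = a \<cdot>\<^sub>v T f"
    and ker: "{f \<in> free_space Y. T f = 0\<^sub>v ?d} = {\<lambda>_. 0}"
    and act: "\<And>g f. g \<in> carrier G \<Longrightarrow> f \<in> free_space Y \<Longrightarrow> T (act g f) = \<sigma> g *\<^sub>v T f"
    using \<sigma> unfolding carries_def by blast
  have Tc: "T f \<in> carrier_vec ?d" if "f \<in> free_space Y" for f using T that by blast
  define \<delta> :: "'i \<Rightarrow> 'i \<Rightarrow> 'k" where "\<delta> A = (\<lambda>B. if B = A then 1 else 0)" for A
  have expand: "T f $ a = (\<Sum>A\<in>S. f A * T (\<delta> A) $ a)"
    if "S \<subseteq> Y" "f \<in> free_space S" "a < ?d" for S f a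
    using finite_subset[OF \<open>S \<subseteq> Y\<close> finite_Y] that
  proof (induction S arbitrary: f rule: finite_induct)
    case empty
    then have "f = (\<lambda>_. 0)" by (auto simp: free_space_def)
    then have "f \<in> {f \<in> free_space Y. T f = 0\<^sub>v ?d}" using ker by simp
    then show ?case using empty by simp
  next
    case (insert A S)
    define f' where "f' = f(A := 0)"
    have f': "f' \<in> free_space S" using insert.prems by (auto simp: f'_def free_space_def)
    have m: "f' \<in> free_space Y" "\<delta> A \<in> free_space Y" "(\<lambda>B. f A * \<delta> A B) \<in> free_space Y"
      using insert.prems f' by (auto simp: free_space_def \<delta>_def)
    have "f = (\<lambda>B. f' B + f A * \<delta> A B)" by (auto simp: f'_def \<delta>_def)
    then have "T f = T f' + f A \<cdot>\<^sub>v T (\<delta> A)" using add[OF m(1,3)] smult[OF m(2), of "f A"] by simp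
    then have "T f $ a = T f' $ a + f A * T (\<delta> A) $ a"
      using Tc[OF m(1)] Tc[OF m(2)] insert.prems(3) by simp
    also have "T f' $ a = (\<Sum>B\<in>S. f' B * T (\<delta> B) $ a)" using insert.IH f' insert.prems by blast
    also have "\<dots> = (\<Sum>B\<in>S. f B * T (\<delta> B) $ a)"
      using insert.hyps by (intro sum.cong) (auto simp: f'_def)
    finally show ?case using insert.hyps by (simp add: add.commute)
  qed
  define Q where "Q = mat ?d ?n (\<lambda>(a, j). T (\<delta> (enum j)) $ a)"
  have Q: "Q \<in> carrier_mat ?d ?n" by (simp add: Q_def)
  have cc: "coords f \<in> carrier_vec ?n" for f by (simp add: coords_def)
  have TQ: "T f = Q *\<^sub>v coords f" if f: "f \<in> free_space Y" for f
  proof (rule eq_vecI)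
    fix a assume "a < dim_vec (Q *\<^sub>v coords f)"
    then have a: "a < ?d" by (simp add: Q_def)
    have "T f $ a = (\<Sum>A\<in>Y. f A * T (\<delta> A) $ a)" using expand f a by blast
    also have "\<dots> = (\<Sum>j<?n. f (enum j) * T (\<delta> (enum j)) $ a)"
      by (rule sum.reindex_bij_betw[OF enum_bij, symmetric])
    also have "\<dots> = (Q *\<^sub>v coords f) $ a"
      using a by (simp add: Q_def coords_def scalar_prod_def lessThan_atLeast0 mult.commute)
    finally show "T f $ a = (Q *\<^sub>v coords f) $ a" .
  qed (use Tc[OF f] in \<open>simp add: Q_def\<close>)
  obtain P where P: "P \<in> carrier_mat ?n ?d" "Q * P = 1\<^sub>m ?d" "P * Q = 1\<^sub>m ?n"
  proof (rule inverse_of_bijective[OF Q])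
    fix v :: "'k vec" assume v: "v \<in> carrier_vec ?n" "Q *\<^sub>v v = 0\<^sub>v ?d"
    obtain f where f: "f \<in> free_space Y" "coords f = v" using coords_surj[OF v(1)] by blast
    then have "f \<in> {f \<in> free_space Y. T f = 0\<^sub>v ?d}" using TQ v by simp
    then have "f = (\<lambda>_. 0)" using ker by simp
    then show "v = 0\<^sub>v ?n" using f(2) by (auto simp: coords_def)
  next
    fix w :: "'k vec" assume "w \<in> carrier_vec ?d"
    then obtain f where "f \<in> free_space Y" "w = T f" using T by blast
    then show "\<exists>v\<in>carrier_vec ?n. Q *\<^sub>v v = w" using TQ cc by metis
  qed
  have int: "Q * perm_rep g = \<sigma> g * Q" if g: "g \<in> carrier G" for g
  proof (rule mat_eqI_mult_vec)
    note c = is_repD(1)[OF rep g] is_repD(1)[OF perm_rep(1) g, unfolded perm_rep(2)]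
    show "Q * perm_rep g \<in> carrier_mat ?d ?n" by (rule mult_carrier_mat[OF Q c(2)])
    show "\<sigma> g * Q \<in> carrier_mat ?d ?n" by (rule mult_carrier_mat[OF c(1) Q])
    fix v :: "'k vec" assume v: "v \<in> carrier_vec ?n"
    obtain f where f: "f \<in> free_space Y" "coords f = v" using coords_surj[OF v] by blast
    have af: "act g f \<in> free_space Y" using act_eq[OF g f(1)] by (simp add: free_space_def)
    have "(Q * perm_rep g) *\<^sub>v v = Q *\<^sub>v (perm_rep g *\<^sub>v coords f)"
      unfolding f(2) by (rule assoc_mult_mat_vec[OF Q c(2) v])
    also have "\<dots> = T (act g f)" by (simp only: coords_act[OF g f(1), symmetric] TQ[OF af])
    also have "\<dots> = \<sigma> g *\<^sub>v (Q *\<^sub>v v)" by (simp only: act[OF g f(1)] TQ[OF f(1)] f(2))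
    also have "\<dots> = (\<sigma> g * Q) *\<^sub>v v" by (rule assoc_mult_mat_vec[OF c(1) Q v, symmetric])
    finally show "(Q * perm_rep g) *\<^sub>v v = (\<sigma> g * Q) *\<^sub>v v" .
  qed
  show ?thesis
    by (rule rep_isoI[OF perm_rep(1) rep, unfolded perm_rep(2), OF Q P int])
qed

lemma tr_perm_rep:
  assumes g: "g \<in> carrier G"
  shows "tr (perm_rep g) = of_nat (card {A \<in> Y. \<alpha> g A = A})"
proof -
  have "tr (perm_rep g) = (\<Sum>i<card Y. if \<alpha> (inv g) (enum i) = enum i then 1 else 0)"
    by (simp add: tr_def perm_rep_def)
  also have "\<dots> = (\<Sum>A\<in>Y. if \<alpha> (inv g) A = A then 1 else 0)"
    by (rule sum.reindex_bij_betw[OF enum_bij])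
  also have "\<dots> = of_nat (card {A \<in> Y. \<alpha> (inv g) A = A})"
    using finite_Y by (simp add: sum.If_cases Int_def)
  also have "{A \<in> Y. \<alpha> (inv g) A = A} = {A \<in> Y. \<alpha> g A = A}"
  proof -
    have "\<alpha> (inv g) A = A \<longleftrightarrow> \<alpha> g A = A" if A: "A \<in> Y" for A
    proof -
      have "\<alpha> g (\<alpha> (inv g) A) = A" "\<alpha> (inv g) (\<alpha> g A) = A"
        using \<alpha>_mult[of g "inv g" A] \<alpha>_mult[of "inv g" g A] \<alpha>_one[OF A] g A by auto
      then show ?thesis by metis
    qed
    then show ?thesis by blast
  qed
  finally show ?thesis .
qed

lemma carries_tr:
  assumes "carries G (free_space Y) {\<lambda>_. 0} act \<sigma>" "g \<in> carrier G"
  shows "tr (\<sigma> g) = of_nat (card {A \<in> Y. \<alpha> g A = A})"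
  using rep_iso_tr[OF carries_iso_perm_rep[OF assms(1)] assms(2)] tr_perm_rep[OF assms(2)] by simp

end

section \<open>The set $M(\Gamma)$\<close>

lemma rep_pullback:
  fixes \<rho> :: "'g \<Rightarrow> 'k::field mat"
  assumes \<rho>: "is_rep G \<rho>" and \<phi>: "\<phi> \<in> hom G' G" "\<phi> \<one>\<^bsub>G'\<^esub> = \<one>\<^bsub>G\<^esub>"
  shows "is_rep G' (\<lambda>g. \<rho> (\<phi> g))" "rep_dim G' (\<lambda>g. \<rho> (\<phi> g)) = rep_dim G \<rho>"
proof -
  have 1: "\<rho> (\<phi> g) \<in> carrier_mat (rep_dim G \<rho>) (rep_dim G \<rho>)" if "g \<in> carrier G'" for g
    using is_repD(1)[OF \<rho>] hom_in_carrier[OF \<phi>(1) that] by blast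
  have 2: "\<rho> (\<phi> \<one>\<^bsub>G'\<^esub>) = 1\<^sub>m (rep_dim G \<rho>)" using is_repD(2)[OF \<rho>] \<phi>(2) by simp
  have 3: "\<rho> (\<phi> (g \<otimes>\<^bsub>G'\<^esub> h)) = \<rho> (\<phi> g) * \<rho> (\<phi> h)" if "g \<in> carrier G'" "h \<in> carrier G'" for g h
    using is_repD(3)[OF \<rho> hom_in_carrier[OF \<phi>(1) that(1)] hom_in_carrier[OF \<phi>(1) that(2)]]
      hom_mult[OF \<phi>(1) that] by simp
  show "is_rep G' (\<lambda>g. \<rho> (\<phi> g))" "rep_dim G' (\<lambda>g. \<rho> (\<phi> g)) = rep_dim G \<rho>"
    using is_repI[of G' "\<lambda>g. \<rho> (\<phi> g)"] 1 2 3 by blast+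
qed

lemma rep_iso_pullback:
  fixes \<rho> \<sigma> :: "'g \<Rightarrow> 'k::field mat"
  assumes iso: "rep_iso G \<rho> \<sigma>" and \<phi>: "\<phi> \<in> hom G' G" "\<phi> \<one>\<^bsub>G'\<^esub> = \<one>\<^bsub>G\<^esub>"
  shows "rep_iso G' (\<lambda>g. \<rho> (\<phi> g)) (\<lambda>g. \<sigma> (\<phi> g))"
proof -
  have r: "is_rep G \<rho>" "is_rep G \<sigma>" "rep_dim G \<rho> = rep_dim G \<sigma>" using iso by (auto simp: rep_iso_def)
  obtain P where P: "P \<in> carrier_mat (rep_dim G \<rho>) (rep_dim G \<rho>)" "invertible_mat P"
    "\<forall>g\<in>carrier G. P * \<rho> g = \<sigma> g * P"
    using iso by (auto simp: rep_iso_def)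
  show ?thesis
    unfolding rep_iso_def rep_pullback(2)[OF r(1) \<phi>] rep_pullback(2)[OF r(2) \<phi>]
    using rep_pullback(1)[OF r(1) \<phi>] rep_pullback(1)[OF r(2) \<phi>] r(3) P hom_in_carrier[OF \<phi>(1)] by auto
qed

lemma irreducible_pullback:
  fixes \<rho> :: "'g \<Rightarrow> 'k::field mat"
  assumes \<rho>: "irreducible_rep G \<rho>" and \<phi>: "\<phi> \<in> hom G' G" "\<phi> \<one>\<^bsub>G'\<^esub> = \<one>\<^bsub>G\<^esub>"
    and surj: "carrier G \<subseteq> \<phi> ` carrier G'"
  shows "irreducible_rep G' (\<lambda>g. \<rho> (\<phi> g))"
proof -
  note r = irreducible_repD(1)[OF \<rho>]
  have "U = {0\<^sub>v (rep_dim G \<rho>)} \<or> U = carrier_vec (rep_dim G \<rho>)"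
    if "lin_subspace (rep_dim G \<rho>) U" "\<forall>g\<in>carrier G'. \<forall>v\<in>U. \<rho> (\<phi> g) *\<^sub>v v \<in> U" for U
    using irreducible_repD(3)[OF \<rho> that(1)] that(2) surj by blast
  then show ?thesis
    unfolding irreducible_rep_def rep_pullback(2)[OF r \<phi>]
    using rep_pullback(1)[OF r \<phi>] irreducible_repD(2)[OF \<rho>] by blast
qed

text \<open>An isomorphism carries invariant subspaces to invariant subspaces.\<close>

lemma (in group) irreducible_rep_iso:
  fixes \<rho> \<sigma> :: "'a \<Rightarrow> 'k::field_char_0 mat"
  assumes \<rho>: "irreducible_rep G \<rho>" and iso: "rep_iso G \<rho> \<sigma>"
  shows "irreducible_rep G \<sigma>"
proof -
  let ?n = "rep_dim G \<rho>"
  obtain P Q where P: "P \<in> carrier_mat ?n ?n" and Q: "Q \<in> carrier_mat ?n ?n"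
    and PQ: "P * Q = 1\<^sub>m ?n" and QP: "Q * P = 1\<^sub>m ?n"
    and int: "\<And>g. g \<in> carrier G \<Longrightarrow> P * \<rho> g = \<sigma> g * P"
    and reps: "is_rep G \<rho>" "is_rep G \<sigma>" and dim: "rep_dim G \<sigma> = ?n"
    using rep_isoE[OF iso] by blast
  have "U = {0\<^sub>v ?n} \<or> U = carrier_vec ?n"
    if U: "lin_subspace ?n U" and inv: "\<forall>g\<in>carrier G. \<forall>v\<in>U. \<sigma> g *\<^sub>v v \<in> U" for U
  proof -
    have Uc: "U \<subseteq> carrier_vec ?n" using U by (simp add: lin_subspace_def)
    have PQv: "P *\<^sub>v (Q *\<^sub>v v) = v" if "v \<in> carrier_vec ?n" for v
      using assoc_mult_mat_vec[OF P Q that] that by (simp only: PQ one_mult_mat_vec)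
    have QPv: "Q *\<^sub>v (P *\<^sub>v v) = v" if "v \<in> carrier_vec ?n" for v
      using assoc_mult_mat_vec[OF Q P that] that by (simp only: QP one_mult_mat_vec)
    define U' where "U' = {v \<in> carrier_vec ?n. P *\<^sub>v v \<in> U}"
    have sub: "lin_subspace ?n U'"
      unfolding lin_subspace_def
    proof (intro conjI ballI allI)
      show "0\<^sub>v ?n \<in> U'" using mult_mat_zero_vec[OF P] U by (simp add: U'_def lin_subspace_def)
      fix v assume v: "v \<in> U'"
      show "a \<cdot>\<^sub>v v \<in> U'" for a
        using v U mult_mat_vec[OF P, of v a] by (simp add: U'_def lin_subspace_def)
      fix w assume w: "w \<in> U'"
      show "v + w \<in> U'"
        using v w U mult_add_distrib_mat_vec[OF P, of v w] by (simp add: U'_def lin_subspace_def)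
    qed (auto simp: U'_def)
    have "\<rho> g *\<^sub>v v \<in> U'" if g: "g \<in> carrier G" and v: "v \<in> U'" for g v
    proof -
      note c = is_repD(1)[OF reps(1) g] is_repD(1)[OF reps(2) g, unfolded dim]
      have vc: "v \<in> carrier_vec ?n" using v by (simp add: U'_def)
      have "P *\<^sub>v (\<rho> g *\<^sub>v v) = \<sigma> g *\<^sub>v (P *\<^sub>v v)"
        using assoc_mult_mat_vec[OF P c(1) vc] assoc_mult_mat_vec[OF c(2) P vc] int[OF g] by (simp only:)
      then show ?thesis using inv g v mult_mat_vec_carrier[OF c(1) vc] by (simp add: U'_def)
    qed
    then have "U' = {0\<^sub>v ?n} \<or> U' = carrier_vec ?n" using irreducible_repD(3)[OF \<rho> sub] by blast
    then show ?thesis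
    proof
      assume U': "U' = {0\<^sub>v ?n}"
      have "u = 0\<^sub>v ?n" if "u \<in> U" for u
      proof -
        have u: "u \<in> carrier_vec ?n" using that Uc by blast
        then have "Q *\<^sub>v u \<in> U'" using that Q by (simp add: U'_def PQv mult_mat_vec_carrier[OF Q])
        then have "Q *\<^sub>v u = 0\<^sub>v ?n" using U' by simp
        then show ?thesis using PQv[OF u] mult_mat_zero_vec[OF P] by simp
      qed
      then show ?thesis using U by (auto simp: lin_subspace_def)
    next
      assume U': "U' = carrier_vec ?n"
      have "v \<in> U" if v: "v \<in> carrier_vec ?n" for v
      proof -
        have "Q *\<^sub>v v \<in> U'" unfolding U' by (rule mult_mat_vec_carrier[OF Q v])
        then show ?thesis using PQv[OF v] by (simp add: U'_def)
      qed
      then show ?thesis using Uc by blast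
    qed
  qed
  then show ?thesis
    unfolding irreducible_rep_def dim using reps irreducible_repD(2)[OF \<rho>] by blast
qed

lemma centr_simps [simp]:
  "carrier (centr G x) = {z \<in> carrier G. z \<otimes>\<^bsub>G\<^esub> x = x \<otimes>\<^bsub>G\<^esub> z}"
  "mult (centr G x) = mult G" "one (centr G x) = one G"
  by (simp_all add: centr_def)

context group
begin

lemma centr_subgroup:
  assumes x: "x \<in> carrier G"
  shows "subgroup {z \<in> carrier G. z \<otimes> x = x \<otimes> z} G"
proof (rule subgroupI)
  show "{z \<in> carrier G. z \<otimes> x = x \<otimes> z} \<noteq> {}" using x by (auto intro!: exI[of _ \<one>])
  fix a assume "a \<in> {z \<in> carrier G. z \<otimes> x = x \<otimes> z}"
  then have a: "a \<in> carrier G" "a \<otimes> x = x \<otimes> a" by auto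
  have "inv a \<otimes> x = inv a \<otimes> (x \<otimes> a) \<otimes> inv a" using a(1) x by (simp add: m_assoc)
  also have "\<dots> = inv a \<otimes> (a \<otimes> x) \<otimes> inv a" by (simp only: a(2))
  also have "\<dots> = x \<otimes> inv a" using a(1) x by (simp add: m_assoc[symmetric])
  finally show "inv a \<in> {z \<in> carrier G. z \<otimes> x = x \<otimes> z}" using a by simp
  fix b assume "b \<in> {z \<in> carrier G. z \<otimes> x = x \<otimes> z}"
  then have b: "b \<in> carrier G" "b \<otimes> x = x \<otimes> b" by auto
  have "a \<otimes> b \<otimes> x = a \<otimes> x \<otimes> b" using a(1) b x by (simp add: m_assoc)
  also have "\<dots> = x \<otimes> (a \<otimes> b)" using a(1) b(1) x by (simp only: a(2) m_assoc)
  finally show "a \<otimes> b \<in> {z \<in> carrier G. z \<otimes> x = x \<otimes> z}" using a b by simp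
qed auto

lemma centr_group: "x \<in> carrier G \<Longrightarrow> group (centr G x)"
  unfolding centr_def by (rule subgroup_imp_group[OF centr_subgroup])

lemma centr_inv:
  assumes "x \<in> carrier G" "z \<in> carrier (centr G x)"
  shows "inv\<^bsub>centr G x\<^esub> z = inv z"
  using m_inv_consistent[OF centr_subgroup[OF assms(1)]] assms(2) by (simp add: centr_def)

lemma conj_cancel:
  assumes "g \<in> carrier G" "x \<in> carrier G"
  shows "inv g \<otimes> (g \<otimes> x \<otimes> inv g) \<otimes> g = x" "g \<otimes> (inv g \<otimes> x \<otimes> g) \<otimes> inv g = x"
    "inv g \<otimes> (g \<otimes> x) = x" "g \<otimes> (inv g \<otimes> x) = x"
proof -
  show 1: "inv g \<otimes> (g \<otimes> x) = x" "g \<otimes> (inv g \<otimes> x) = x"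
    using assms by (simp_all add: m_assoc[symmetric])
  show "inv g \<otimes> (g \<otimes> x \<otimes> inv g) \<otimes> g = x" "g \<otimes> (inv g \<otimes> x \<otimes> g) \<otimes> inv g = x"
    using assms 1 by (simp_all add: m_assoc)
qed

lemma conj_mult:
  assumes "g \<in> carrier G" "x \<in> carrier G" "y \<in> carrier G"
  shows "inv g \<otimes> (x \<otimes> y) \<otimes> g = (inv g \<otimes> x \<otimes> g) \<otimes> (inv g \<otimes> y \<otimes> g)"
  using assms by (simp add: m_assoc conj_cancel)

lemma conj_centr_mem:
  assumes g: "g \<in> carrier G" and x: "x \<in> carrier G" and z: "z \<in> carrier (centr G (g \<otimes> x \<otimes> inv g))"
  shows "inv g \<otimes> z \<otimes> g \<in> carrier (centr G x)"
proof -
  have zc: "z \<in> carrier G" and e: "z \<otimes> (g \<otimes> x \<otimes> inv g) = (g \<otimes> x \<otimes> inv g) \<otimes> z" using z by auto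
  have "(inv g \<otimes> z \<otimes> g) \<otimes> (inv g \<otimes> (g \<otimes> x \<otimes> inv g) \<otimes> g) =
      (inv g \<otimes> (g \<otimes> x \<otimes> inv g) \<otimes> g) \<otimes> (inv g \<otimes> z \<otimes> g)"
    using conj_mult[OF g zc, of "g \<otimes> x \<otimes> inv g"] conj_mult[OF g _ zc, of "g \<otimes> x \<otimes> inv g"] e g x
    by (metis inv_closed m_closed)
  then show ?thesis using conj_cancel(1)[OF g x] g zc by simp
qed

text \<open>The transport of a representation of $Z(x)$ to $Z(g x g^{-1})$.\<close>

definition twist :: "'a \<Rightarrow> ('a \<Rightarrow> complex mat) \<Rightarrow> 'a \<Rightarrow> complex mat" where
  "twist g \<rho> = (\<lambda>z. \<rho> (inv g \<otimes> z \<otimes> g))"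

lemma M_class_twist:
  "M_class G x \<rho> = {(x', \<rho>'). \<exists>g\<in>carrier G. x' = g \<otimes> x \<otimes> inv g \<and> rep_iso (centr G x') (twist g \<rho>) \<rho>'}"
  by (simp add: M_class_def twist_def)

lemma twist_hom:
  assumes g: "g \<in> carrier G" and x: "x \<in> carrier G"
  shows "(\<lambda>z. inv g \<otimes> z \<otimes> g) \<in> hom (centr G (g \<otimes> x \<otimes> inv g)) (centr G x)"
    and "inv g \<otimes> \<one>\<^bsub>centr G (g \<otimes> x \<otimes> inv g)\<^esub> \<otimes> g = \<one>\<^bsub>centr G x\<^esub>"
proof (rule homI)
  fix y z
  assume y: "y \<in> carrier (centr G (g \<otimes> x \<otimes> inv g))"
  then show "inv g \<otimes> y \<otimes> g \<in> carrier (centr G x)" by (rule conj_centr_mem[OF g x])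
  assume z: "z \<in> carrier (centr G (g \<otimes> x \<otimes> inv g))"
  show "inv g \<otimes> (y \<otimes>\<^bsub>centr G (g \<otimes> x \<otimes> inv g)\<^esub> z) \<otimes> g =
      (inv g \<otimes> y \<otimes> g) \<otimes>\<^bsub>centr G x\<^esub> (inv g \<otimes> z \<otimes> g)"
    using conj_mult[OF g] y z by simp
qed (use g in simp)

lemma twist_surj:
  assumes g: "g \<in> carrier G" and x: "x \<in> carrier G"
  shows "carrier (centr G x) \<subseteq> (\<lambda>z. inv g \<otimes> z \<otimes> g) ` carrier (centr G (g \<otimes> x \<otimes> inv g))"
proof
  fix w assume w: "w \<in> carrier (centr G x)"
  have "inv (inv g) \<otimes> w \<otimes> inv g \<in> carrier (centr G (g \<otimes> x \<otimes> inv g))"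
    using conj_centr_mem[of "inv g" "g \<otimes> x \<otimes> inv g" w] g x w conj_cancel(1)[OF g x] by simp
  then have "g \<otimes> w \<otimes> inv g \<in> carrier (centr G (g \<otimes> x \<otimes> inv g))" using g by simp
  then show "w \<in> (\<lambda>z. inv g \<otimes> z \<otimes> g) ` carrier (centr G (g \<otimes> x \<otimes> inv g))"
    using conj_cancel(1)[of g w] g w by (intro image_eqI[of _ _ "g \<otimes> w \<otimes> inv g"]) auto
qed

lemma twist_rep:
  assumes "g \<in> carrier G" "x \<in> carrier G" "is_rep (centr G x) \<rho>"
  shows "is_rep (centr G (g \<otimes> x \<otimes> inv g)) (twist g \<rho>)"
  unfolding twist_def by (rule rep_pullback(1)[OF assms(3) twist_hom[OF assms(1,2)]])

lemma twist_irreducible: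
  assumes "g \<in> carrier G" "x \<in> carrier G" "irreducible_rep (centr G x) \<rho>"
  shows "irreducible_rep (centr G (g \<otimes> x \<otimes> inv g)) (twist g \<rho>)"
  unfolding twist_def by (rule irreducible_pullback[OF assms(3) twist_hom[OF assms(1,2)] twist_surj[OF assms(1,2)]])

lemma twist_iso:
  assumes "g \<in> carrier G" "x \<in> carrier G" "rep_iso (centr G x) \<rho> \<sigma>"
  shows "rep_iso (centr G (g \<otimes> x \<otimes> inv g)) (twist g \<rho>) (twist g \<sigma>)"
  unfolding twist_def by (rule rep_iso_pullback[OF assms(3) twist_hom[OF assms(1,2)]])

lemma twist_twist:
  assumes "g \<in> carrier G" "h \<in> carrier G" "z \<in> carrier G"
  shows "twist h (twist g \<rho>) z = twist (h \<otimes> g) \<rho> z"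
  using assms by (simp add: twist_def inv_mult_group m_assoc)

lemma M_class_trans:
  assumes x: "x \<in> carrier G" and \<rho>: "is_rep (centr G x) \<rho>"
    and 1: "(x', \<rho>') \<in> M_class G x \<rho>" and 2: "(x'', \<rho>'') \<in> M_class G x' \<rho>'"
  shows "(x'', \<rho>'') \<in> M_class G x \<rho>"
proof -
  obtain g where g: "g \<in> carrier G" "x' = g \<otimes> x \<otimes> inv g" "rep_iso (centr G x') (twist g \<rho>) \<rho>'"
    using 1 by (auto simp: M_class_twist)
  obtain h where h: "h \<in> carrier G" "x'' = h \<otimes> x' \<otimes> inv h" "rep_iso (centr G x'') (twist h \<rho>') \<rho>''"
    using 2 by (auto simp: M_class_twist)
  have x': "x' \<in> carrier G" using g x by simp
  have e: "x'' = (h \<otimes> g) \<otimes> x \<otimes> inv (h \<otimes> g)"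
    using g h x by (simp add: inv_mult_group m_assoc)
  have gr: "group (centr G x'')" using h x' by (intro centr_group) simp
  have "rep_iso (centr G x'') (twist h (twist g \<rho>)) (twist h \<rho>')"
    using twist_iso[OF h(1) x' g(3)] h(2) by simp
  moreover have "rep_iso (centr G x'') (twist (h \<otimes> g) \<rho>) (twist h (twist g \<rho>))"
    using twist_rep[of "h \<otimes> g" x \<rho>] g h x \<rho> e
    by (intro group.rep_iso_cong[OF gr]) (simp_all add: twist_twist)
  ultimately have "rep_iso (centr G x'') (twist (h \<otimes> g) \<rho>) \<rho>''"
    using h(3) group.rep_iso_trans[OF gr] by blast
  then show ?thesis using e g h by (auto simp: M_class_twist intro!: bexI[of _ "h \<otimes> g"])
qed

lemma M_class_refl:
  assumes x: "x \<in> carrier G" and iso: "rep_iso (centr G x) \<rho> \<rho>'"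
  shows "(x, \<rho>') \<in> M_class G x \<rho>"
proof -
  note gr = centr_group[OF x]
  have r: "is_rep (centr G x) \<rho>" using iso by (simp add: rep_iso_def)
  have "rep_iso (centr G x) \<rho> (twist \<one> \<rho>)"
    by (rule group.rep_iso_cong[OF gr r]) (simp add: twist_def)
  then have "rep_iso (centr G x) (twist \<one> \<rho>) \<rho>'"
    using iso group.rep_iso_sym[OF gr] group.rep_iso_trans[OF gr] by blast
  then show ?thesis using x by (auto simp: M_class_twist intro!: bexI[of _ \<one>])
qed

lemma M_class_sym:
  assumes x: "x \<in> carrier G" and \<rho>: "is_rep (centr G x) \<rho>" and 1: "(x', \<rho>') \<in> M_class G x \<rho>"
  shows "(x, \<rho>) \<in> M_class G x' \<rho>'"
proof -
  obtain g where g: "g \<in> carrier G" "x' = g \<otimes> x \<otimes> inv g" "rep_iso (centr G x') (twist g \<rho>) \<rho>'"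
    using 1 by (auto simp: M_class_twist)
  have x': "x' \<in> carrier G" using g x by simp
  have e: "x = inv g \<otimes> x' \<otimes> inv (inv g)" using conj_cancel(1)[OF g(1) x] g by simp
  note gr = centr_group[OF x]
  have "rep_iso (centr G x) (twist (inv g) (twist g \<rho>)) (twist (inv g) \<rho>')"
    using twist_iso[OF inv_closed[OF g(1)] x' g(3)] e by simp
  moreover have "rep_iso (centr G x) \<rho> (twist (inv g) (twist g \<rho>))"
    by (rule group.rep_iso_cong[OF gr \<rho>]) (use g in \<open>simp add: twist_twist, simp add: twist_def\<close>)
  ultimately have "rep_iso (centr G x) (twist (inv g) \<rho>') \<rho>"
    using group.rep_iso_trans[OF gr] group.rep_iso_sym[OF gr] by blast
  with e have "x = inv g \<otimes> x' \<otimes> inv (inv g) \<and> rep_iso (centr G x) (twist (inv g) \<rho>') \<rho>" by blast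
  then show ?thesis unfolding M_class_twist mem_Collect_eq prod.case using inv_closed[OF g(1)] by blast
qed

lemma M_class_memD:
  assumes x: "x \<in> carrier G" and \<rho>: "irreducible_rep (centr G x) \<rho>" and 1: "(x', \<rho>') \<in> M_class G x \<rho>"
  shows "x' \<in> carrier G" "irreducible_rep (centr G x') \<rho>'" "M_class G x' \<rho>' = M_class G x \<rho>"
proof -
  obtain g where g: "g \<in> carrier G" "x' = g \<otimes> x \<otimes> inv g" "rep_iso (centr G x') (twist g \<rho>) \<rho>'"
    using 1 by (auto simp: M_class_twist)
  show x': "x' \<in> carrier G" using g x by simp
  show irr: "irreducible_rep (centr G x') \<rho>'"
    using group.irreducible_rep_iso[OF centr_group[OF x'] _ g(3)] twist_irreducible[OF g(1) x \<rho>] g(2) by simp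
  note r = irreducible_repD(1)[OF \<rho>] irreducible_repD(1)[OF irr]
  show "M_class G x' \<rho>' = M_class G x \<rho>"
  proof (intro equalityI subsetI)
    fix p
    show "p \<in> M_class G x \<rho>" if "p \<in> M_class G x' \<rho>'"
      using that M_class_trans[OF x r(1) 1] by (cases p) simp
    show "p \<in> M_class G x' \<rho>'" if "p \<in> M_class G x \<rho>"
      using that M_class_trans[OF x' r(2) M_class_sym[OF x r(1) 1]] by (cases p) simp
  qed
qed

text \<open>An element \<open>g\<close> which conjugates \<open>(x, \<rho>)\<close> to \<open>(x, \<sigma>)\<close> lies in the centralizer of \<open>x\<close>, and then
  \<open>\<rho> (inv g)\<close> is an isomorphism of \<open>\<rho>\<close> with its transport by \<open>g\<close>. So the elements of $M(\Gamma)$ over the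
  conjugacy class of \<open>x\<close> are the isomorphism classes of irreducible representations of $Z(x)$.\<close>

lemma M_class_eq_iff:
  assumes x: "x \<in> carrier G" and \<rho>: "irreducible_rep (centr G x) \<rho>"
    and \<sigma>: "irreducible_rep (centr G x) \<sigma>"
  shows "M_class G x \<rho> = M_class G x \<sigma> \<longleftrightarrow> rep_iso (centr G x) \<rho> \<sigma>"
proof
  note gr = centr_group[OF x]
  note r = irreducible_repD(1)[OF \<rho>] irreducible_repD(1)[OF \<sigma>]
  {
    assume "rep_iso (centr G x) \<rho> \<sigma>"
    then show "M_class G x \<rho> = M_class G x \<sigma>"
      using M_class_memD(3)[OF x \<rho> M_class_refl[OF x]] by simp
  next
    assume "M_class G x \<rho> = M_class G x \<sigma>"
    then have "(x, \<sigma>) \<in> M_class G x \<rho>"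
      using M_class_refl[OF x group.rep_iso_refl[OF gr r(2)]] by simp
    then obtain g where g: "g \<in> carrier G" "x = g \<otimes> x \<otimes> inv g" "rep_iso (centr G x) (twist g \<rho>) \<sigma>"
      by (auto simp: M_class_twist)
    let ?n = "rep_dim (centr G x) \<rho>"
    have "g \<otimes> x = g \<otimes> x \<otimes> inv g \<otimes> g" using g(1) x by (simp add: m_assoc)
    then have gZ: "g \<in> carrier (centr G x)" using g x by simp
    then have igZ: "inv g \<in> carrier (centr G x)"
      using group.inv_closed[OF gr gZ] centr_inv[OF x gZ] by simp
    have tw: "is_rep (centr G x) (twist g \<rho>)" using g(3) by (simp add: rep_iso_def)
    have tw_eq: "twist g \<rho> z = \<rho> (inv g) * \<rho> z * \<rho> g" if z: "z \<in> carrier (centr G x)" for z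
    proof -
      have "inv g \<otimes> z \<in> carrier (centr G x)"
        using monoid.m_closed[OF group.is_monoid[OF gr] igZ z] by simp
      then show ?thesis
        using is_repD(3)[OF r(1) igZ z] is_repD(3)[OF r(1) _ gZ, of "inv g \<otimes> z"] by (simp add: twist_def)
    qed
    have ii: "\<rho> g * \<rho> (inv g) = 1\<^sub>m ?n" "\<rho> (inv g) * \<rho> g = 1\<^sub>m ?n"
      using group.is_rep_inv[OF gr r(1) gZ] centr_inv[OF x gZ] by simp_all
    note c = is_repD(1)[OF r(1) gZ] is_repD(1)[OF r(1) igZ]
    have dim: "rep_dim (centr G x) (twist g \<rho>) = ?n"
      using g by (simp add: rep_dim_def twist_def)
    have "rep_iso (centr G x) \<rho> (twist g \<rho>)"
    proof (rule group.rep_isoI[OF gr r(1) tw, unfolded dim, OF c(2) c(1) ii(2) ii(1)])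
      fix z assume z: "z \<in> carrier (centr G x)"
      note cz = is_repD(1)[OF r(1) z]
      have "twist g \<rho> z * \<rho> (inv g) = (\<rho> (inv g) * \<rho> z) * (\<rho> g * \<rho> (inv g))"
        using assoc_mult_mat[OF mult_carrier_mat[OF c(2) cz] c(1) c(2)] by (simp only: tw_eq[OF z])
      then show "\<rho> (inv g) * \<rho> z = twist g \<rho> z * \<rho> (inv g)"
        using right_mult_one_mat[OF mult_carrier_mat[OF c(2) cz]] by (simp only: ii(1))
    qed
    then show "rep_iso (centr G x) \<rho> \<sigma>" using g(3) group.rep_iso_trans[OF gr] by blast
  }
qed

lemma M_set_representative:
  assumes "m \<in> M_set G"
  shows "m_elt m \<in> carrier G" "irreducible_rep (centr G (m_elt m)) (m_rep m)"
    "m = M_class G (m_elt m) (m_rep m)"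
proof -
  obtain x \<rho> where x: "x \<in> carrier G" and \<rho>: "irreducible_rep (centr G x) \<rho>" and m: "m = M_class G x \<rho>"
    using assms by (auto simp: M_set_def)
  have "(x, \<rho>) \<in> m"
    unfolding m by (rule M_class_refl[OF x group.rep_iso_refl[OF centr_group[OF x] irreducible_repD(1)[OF \<rho>]]])
  then have "(SOME p. p \<in> m) \<in> m" by (rule someI)
  then have *: "(m_elt m, m_rep m) \<in> M_class G x \<rho>" by (simp add: m_elt_def m_rep_def m)
  show "m_elt m \<in> carrier G" "irreducible_rep (centr G (m_elt m)) (m_rep m)"
    "m = M_class G (m_elt m) (m_rep m)"
    using M_class_memD[OF x \<rho> *] m by auto
qed

end

lemma (in fin_group) centr_fin_group: "x \<in> carrier G \<Longrightarrow> fin_group (centr G x)"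
  using fin by (intro fin_group.intro centr_group fin_group_axioms.intro) auto

section \<open>The multiplicities $N_{H,H',x,\rho}$\<close>

lemma pushforward_image:
  fixes p :: "'i \<Rightarrow> 'j"
  assumes "finite X"
  shows "pushforward X p ` free_space X = (free_space (p ` X) :: ('j \<Rightarrow> 'k::comm_monoid_add) set)"
proof (intro equalityI subsetI)
  fix f assume "f \<in> pushforward X p ` (free_space X :: ('i \<Rightarrow> 'k) set)"
  then obtain h where h: "f = pushforward X p h" by blast
  have "f j = 0" if "j \<notin> p ` X" for j
  proof -
    have e: "{i. i \<in> X \<and> p i = j} = {}" using that by blast
    show ?thesis unfolding h pushforward_def e by simp
  qed
  then show "f \<in> free_space (p ` X)" by (simp add: free_space_def)
next
  fix f :: "'j \<Rightarrow> 'k" assume f: "f \<in> free_space (p ` X)"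
  \<comment> \<open>A preimage of \<open>f\<close> is supported on a set of representatives of the fibres of \<open>p\<close>.\<close>
  define s where "s = inv_into X p"
  have s: "s j \<in> X \<and> p (s j) = j" if "j \<in> p ` X" for j
    using that by (simp add: s_def inv_into_into f_inv_into_f)
  define h where "h i = (if i \<in> X \<and> s (p i) = i then f (p i) else 0)" for i
  have "pushforward X p h j = f j" for j
  proof (cases "j \<in> p ` X")
    case True
    have "pushforward X p h j = (\<Sum>i | i \<in> X \<and> p i = j. if i = s j then f j else 0)"
      unfolding pushforward_def h_def by (rule sum.cong) auto
    also have "\<dots> = f j" using assms s[OF True] by (subst sum.delta) auto
    finally show ?thesis .
  next
    case False
    then have e: "{i. i \<in> X \<and> p i = j} = {}" by blast
    show ?thesis using False f unfolding pushforward_def e by (simp add: free_space_def)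
  qed
  moreover have "h \<in> free_space X" by (simp add: free_space_def h_def)
  ultimately show "f \<in> pushforward X p ` free_space X" by (auto intro!: image_eqI[of _ _ h])
qed

locale normal_pair = fin_group G for G :: "('a, 'b) monoid_scheme" (structure) +
  fixes H H' :: "'a set"
  assumes H: "subgroup H G" and H': "subgroup H' G" and normal: "H \<lhd> G\<lparr>carrier := H'\<rparr>"
begin

text \<open>For \<open>x = k\<close> the image of the map $(\Gamma/H)^x \to (\Gamma/H')^x$.\<close>

definition image_cosets :: "'a \<Rightarrow> 'a set set" where
  "image_cosets k = {u <# H' | u. u \<in> carrier G \<and> inv u \<otimes> k \<otimes> u \<in> H}"

text \<open>The character of the image of $\mathbf{C}[(\Gamma/H)^x] \to \mathbf{C}[(\Gamma/H')^x]$ for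
  \<open>x = k\<close>.\<close>

definition image_char :: "'a \<Rightarrow> 'a \<Rightarrow> complex" where
  "image_char k z = of_nat (card {A \<in> image_cosets k. z <# A = A})"

lemma H_sub: "H \<subseteq> H'"
  using subgroup.subset[OF normal_imp_subgroup[OF normal]] by simp

lemma H_conj:
  assumes "h' \<in> H'" "h \<in> H"
  shows "inv h' \<otimes> h \<otimes> h' \<in> H"
  using normal.inv_op_closed1[OF normal, of h' h] m_inv_consistent[OF H'] assms by simp

lemma in_carrier: "h \<in> H \<Longrightarrow> h \<in> carrier G" "h' \<in> H' \<Longrightarrow> h' \<in> carrier G"
  using H H' by (auto dest: subgroup.mem_carrier)

lemma fixed_coset_iff:
  assumes K: "subgroup K G" and u: "u \<in> carrier G" and k: "k \<in> carrier G"
  shows "k <# (u <# K) = u <# K \<longleftrightarrow> inv u \<otimes> k \<otimes> u \<in> K"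
proof -
  have Kc: "K \<subseteq> carrier G" by (rule subgroup.subset[OF K])
  have ku: "k <# (u <# K) = (k \<otimes> u) <# K" by (rule lcos_m_assoc[OF Kc k u])
  show ?thesis unfolding ku
  proof
    assume "(k \<otimes> u) <# K = u <# K"
    then have "k \<otimes> u \<in> u <# K" using lcos_self[of "k \<otimes> u" K] K k u by simp
    then obtain h where h: "h \<in> K" "k \<otimes> u = u \<otimes> h" by (auto simp: l_coset_def)
    then have "inv u \<otimes> k \<otimes> u = h" using u k Kc by (simp add: m_assoc conj_cancel subsetD)
    then show "inv u \<otimes> k \<otimes> u \<in> K" using h by simp
  next
    assume *: "inv u \<otimes> k \<otimes> u \<in> K"
    have "k \<otimes> u = u \<otimes> (inv u \<otimes> k \<otimes> u)" using u k by (simp add: m_assoc conj_cancel)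
    then have "(k \<otimes> u) <# K = u <# ((inv u \<otimes> k \<otimes> u) <# K)"
      using lcos_m_assoc[OF Kc u, of "inv u \<otimes> k \<otimes> u"] u k by simp
    also have "(inv u \<otimes> k \<otimes> u) <# K = K" using * u k by (intro coset_join3 K) auto
    finally show "(k \<otimes> u) <# K = u <# K" .
  qed
qed

lemma lcoset_set_mult:
  assumes "u \<in> carrier G"
  shows "(u <# H) <#> H' = u <# H'"
proof (intro equalityI subsetI)
  fix y assume "y \<in> (u <# H) <#> H'"
  then obtain h h' where "h \<in> H" "h' \<in> H'" "y = u \<otimes> h \<otimes> h'" by (auto simp: set_mult_def l_coset_def)
  then have "y = u \<otimes> (h \<otimes> h')" "h \<otimes> h' \<in> H'"
    using assms in_carrier H_sub subgroup.m_closed[OF H'] by (auto simp: m_assoc)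
  then show "y \<in> u <# H'" by (auto simp: l_coset_def)
next
  fix y assume "y \<in> u <# H'"
  then obtain h' where "h' \<in> H'" "y = u \<otimes> \<one> \<otimes> h'" using assms by (auto simp: l_coset_def)
  then show "y \<in> (u <# H) <#> H'"
    using subgroup.one_closed[OF H] unfolding set_mult_def l_coset_def by blast
qed

lemma image_cosets_eq:
  assumes k: "k \<in> carrier G"
  shows "(\<lambda>A. A <#> H') ` coset_fix G H k = image_cosets k"
proof -
  have "coset_fix G H k = (\<lambda>u. u <# H) ` {u. u \<in> carrier G \<and> inv u \<otimes> k \<otimes> u \<in> H}"
    using fixed_coset_iff[OF H _ k] by (auto simp: coset_fix_def LCOSETS_def)
  then show ?thesis
    unfolding image_cosets_def setcompr_eq_image by (simp add: image_image lcoset_set_mult)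
qed

lemma finite_lcosets: "finite (lcosets\<^bsub>G\<^esub> K)"
  unfolding LCOSETS_def using fin by simp

lemma image_cosets_sub: "image_cosets k \<subseteq> lcosets\<^bsub>G\<^esub> H'"
  by (auto simp: image_cosets_def LCOSETS_def)

lemma finite_image_cosets: "finite (image_cosets k)"
  by (rule finite_subset[OF image_cosets_sub finite_lcosets])

lemma perm_image_eq:
  assumes "k \<in> carrier G"
  shows "perm_image G H H' k = free_space (image_cosets k)"
proof -
  have "finite (coset_fix G H k)" using finite_lcosets[of H] by (simp add: coset_fix_def)
  then show ?thesis unfolding perm_image_def by (simp add: pushforward_image image_cosets_eq[OF assms])
qed

text \<open>Here normality of \<open>H\<close> in \<open>H'\<close> enters: the condition on \<open>u\<close> in the definition of
  \<open>image_cosets\<close> does not change when \<open>u\<close> is replaced by another element of its coset.\<close>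

lemma mem_image_cosets:
  assumes u: "u \<in> carrier G" and k: "k \<in> carrier G"
  shows "u <# H' \<in> image_cosets k \<longleftrightarrow> inv u \<otimes> k \<otimes> u \<in> H"
proof
  assume "u <# H' \<in> image_cosets k"
  then obtain v where v: "v \<in> carrier G" "u <# H' = v <# H'" "inv v \<otimes> k \<otimes> v \<in> H"
    by (auto simp: image_cosets_def)
  have "u \<in> v <# H'" using lcos_self[OF u H'] v by simp
  then obtain h' where h': "h' \<in> H'" "u = v \<otimes> h'" by (auto simp: l_coset_def)
  have "inv u \<otimes> k \<otimes> u = inv h' \<otimes> (inv v \<otimes> k \<otimes> v) \<otimes> h'"
    using h' v k in_carrier(2)[OF h'(1)] by (simp add: inv_mult_group m_assoc)
  then show "inv u \<otimes> k \<otimes> u \<in> H" using H_conj[OF h'(1) v(3)] by simp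
qed (use u in \<open>auto simp: image_cosets_def\<close>)

lemma image_cosets_fixed: "k \<in> carrier G \<Longrightarrow> A \<in> image_cosets k \<Longrightarrow> k <# A = A"
  using fixed_coset_iff[OF H'] H_sub by (auto simp: image_cosets_def)

lemma image_cosets_carrier: "A \<in> image_cosets k \<Longrightarrow> A \<subseteq> carrier G"
  using l_coset_subset_G[OF subgroup.subset[OF H']] by (auto simp: image_cosets_def)

lemma image_cosets_conj:
  assumes g: "g \<in> carrier G" and k: "k \<in> carrier G" and A: "A \<in> image_cosets k"
  shows "g <# A \<in> image_cosets (g \<otimes> k \<otimes> inv g)"
proof -
  obtain u where u: "u \<in> carrier G" "A = u <# H'" "inv u \<otimes> k \<otimes> u \<in> H"
    using A by (auto simp: image_cosets_def)
  have "g <# A = (g \<otimes> u) <# H'"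
    unfolding u(2) by (rule lcos_m_assoc[OF subgroup.subset[OF H'] g u(1)])
  moreover have "inv (g \<otimes> u) \<otimes> (g \<otimes> k \<otimes> inv g) \<otimes> (g \<otimes> u) = inv u \<otimes> k \<otimes> u"
    using g k u by (simp add: inv_mult_group m_assoc conj_cancel)
  ultimately show ?thesis using g u by (auto simp: image_cosets_def)
qed

lemma image_permutation_module:
  assumes k: "k \<in> carrier G"
  shows "permutation_module (centr G k) (image_cosets k) (\<lambda>z A. z <# A)
    (perm_act G (coset_fix G H' k) :: 'a \<Rightarrow> ('a set \<Rightarrow> complex) \<Rightarrow> 'a set \<Rightarrow> complex)"
proof (intro permutation_module.intro permutation_module_axioms.intro)
  show "fin_group (centr G k)" by (rule centr_fin_group[OF k])
  show "finite (image_cosets k)" by (rule finite_image_cosets)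
  show closed: "z <# A \<in> image_cosets k" if z: "z \<in> carrier (centr G k)" and A: "A \<in> image_cosets k" for z A
  proof -
    have "z \<otimes> k \<otimes> inv z = k" using z k by (simp add: m_assoc)
    then show ?thesis using image_cosets_conj[of z k A] z k A by simp
  qed
  show "\<one>\<^bsub>centr G k\<^esub> <# A = A" if "A \<in> image_cosets k" for A
    using lcos_mult_one[OF image_cosets_carrier[OF that]] by simp
  show "(y \<otimes>\<^bsub>centr G k\<^esub> z) <# A = y <# (z <# A)"
    if "y \<in> carrier (centr G k)" "z \<in> carrier (centr G k)" "A \<in> image_cosets k" for y z A
    using lcos_m_assoc[OF image_cosets_carrier[OF that(3)], of y z] that by simp
  fix z and f :: "'a set \<Rightarrow> complex"
  assume z: "z \<in> carrier (centr G k)" and f: "f \<in> free_space (image_cosets k)"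
  have iz: "inv z \<in> carrier (centr G k)"
    using group.inv_closed[OF centr_group[OF k] z] centr_inv[OF k z] by simp
  show "perm_act G (coset_fix G H' k) z f =
      (\<lambda>A. if A \<in> image_cosets k then f (inv\<^bsub>centr G k\<^esub> z <# A) else 0)"
  proof
    fix A
    have 1: "A \<in> coset_fix G H' k" if "A \<in> image_cosets k"
      using that image_cosets_sub image_cosets_fixed[OF k that] by (auto simp: coset_fix_def)
    have 2: "f (inv z <# A) = 0" if "A \<in> coset_fix G H' k" "A \<notin> image_cosets k"
    proof -
      have A: "A \<subseteq> carrier G"
        using that(1) l_coset_subset_G[OF subgroup.subset[OF H']] by (auto simp: coset_fix_def LCOSETS_def)
      have "z <# (inv z <# A) = A" using z A lcos_m_assoc[OF A, of z "inv z"] lcos_mult_one[OF A] by simp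
      then have "inv z <# A \<notin> image_cosets k" using closed[OF z, of "inv z <# A"] that(2) by auto
      then show ?thesis using f by (simp add: free_space_def)
    qed
    show "perm_act G (coset_fix G H' k) z f A =
        (if A \<in> image_cosets k then f (inv\<^bsub>centr G k\<^esub> z <# A) else 0)"
      using 1 2 centr_inv[OF k z] by (simp add: perm_act_def)
  qed
qed

abbreviation carries_image :: "'a \<Rightarrow> ('a \<Rightarrow> complex mat) \<Rightarrow> bool" where
  "carries_image k \<sigma> \<equiv> carries (centr G k) (perm_image G H H' k) {\<lambda>_. 0} (perm_act G (coset_fix G H' k)) \<sigma>"

lemma ex_carries_image: "k \<in> carrier G \<Longrightarrow> \<exists>\<sigma>. carries_image k \<sigma>"
  using permutation_module.carries_perm_rep[OF image_permutation_module] by (auto simp: perm_image_eq)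

lemma carries_image_tr:
  assumes "k \<in> carrier G" "carries_image k \<sigma>" "z \<in> carrier (centr G k)"
  shows "tr (\<sigma> z) = image_char k z"
  using permutation_module.carries_tr[OF image_permutation_module[OF assms(1)] _ assms(3)] assms(2)
  by (simp add: perm_image_eq[OF assms(1)] image_char_def)

lemma mult_of_image:
  assumes k: "k \<in> carrier G" and \<sigma>: "carries_image k \<sigma>" and \<rho>: "irreducible_rep (centr G k) \<rho>"
  shows "of_nat (mult_of (centr G k) (iso_class (centr G k) \<rho>) \<sigma>) * of_nat (card (carrier (centr G k))) =
    (\<Sum>z\<in>carrier (centr G k). image_char k z * tr (\<rho> (inv z)))"
proof -
  have "is_rep (centr G k) \<sigma>" using \<sigma> by (simp add: carries_def)
  from fin_group.mult_of_character[OF centr_fin_group[OF k] \<rho> this]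
  have "of_nat (mult_of (centr G k) (iso_class (centr G k) \<rho>) \<sigma>) * of_nat (card (carrier (centr G k))) =
    (\<Sum>z\<in>carrier (centr G k). tr (\<sigma> z) * tr (\<rho> (inv\<^bsub>centr G k\<^esub> z)))" .
  also have "\<dots> = (\<Sum>z\<in>carrier (centr G k). image_char k z * tr (\<rho> (inv z)))"
    using carries_image_tr[OF k \<sigma>] centr_inv[OF k] by (intro sum.cong refl) simp
  finally show ?thesis .
qed

lemma card_centr_nonzero: "k \<in> carrier G \<Longrightarrow> of_nat (card (carrier (centr G k))) \<noteq> (0 :: complex)"
  using fin_group.card_carrier_nonzero[OF centr_fin_group] by blast

text \<open>The multiplicity does not depend on the matrices \<open>\<sigma>\<close> chosen for the module, because it is
  determined by the character of the module.\<close>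

lemma N_mult_eq:
  assumes k: "k \<in> carrier G" and \<sigma>: "carries_image k \<sigma>" and \<rho>: "irreducible_rep (centr G k) \<rho>"
  shows "N_mult G H H' k \<rho> = mult_of (centr G k) (iso_class (centr G k) \<rho>) \<sigma>"
  unfolding N_mult_def
proof (rule the_equality)
  show "\<exists>\<sigma>'. carries_image k \<sigma>' \<and> mult_of (centr G k) (iso_class (centr G k) \<rho>) \<sigma> =
      mult_of (centr G k) (iso_class (centr G k) \<rho>) \<sigma>'"
    using \<sigma> by blast
  fix n assume "\<exists>\<sigma>'. carries_image k \<sigma>' \<and> n = mult_of (centr G k) (iso_class (centr G k) \<rho>) \<sigma>'"
  then obtain \<sigma>' where \<sigma>': "carries_image k \<sigma>'" "n = mult_of (centr G k) (iso_class (centr G k) \<rho>) \<sigma>'"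
    by blast
  have "of_nat n * of_nat (card (carrier (centr G k))) =
      (of_nat (mult_of (centr G k) (iso_class (centr G k) \<rho>) \<sigma>) * of_nat (card (carrier (centr G k))) :: complex)"
    by (simp only: mult_of_image[OF k \<sigma> \<rho>] mult_of_image[OF k \<sigma>'(1) \<rho>] \<sigma>'(2))
  then have "(of_nat n :: complex) = of_nat (mult_of (centr G k) (iso_class (centr G k) \<rho>) \<sigma>)"
    by (simp only: mult_right_cancel[OF card_centr_nonzero[OF k]])
  then show "n = mult_of (centr G k) (iso_class (centr G k) \<rho>) \<sigma>" by (simp only: of_nat_eq_iff)
qed

lemma N_mult_character:
  assumes k: "k \<in> carrier G" and \<rho>: "irreducible_rep (centr G k) \<rho>"
  shows "of_nat (N_mult G H H' k \<rho>) * of_nat (card (carrier (centr G k))) =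
    (\<Sum>z\<in>carrier (centr G k). image_char k z * tr (\<rho> (inv z)))"
proof -
  obtain \<sigma> where \<sigma>: "carries_image k \<sigma>" using ex_carries_image[OF k] by blast
  show ?thesis using mult_of_image[OF k \<sigma> \<rho>] N_mult_eq[OF k \<sigma> \<rho>] by simp
qed

lemma image_char_conj:
  assumes g: "g \<in> carrier G" and k: "k \<in> carrier G" and z: "z \<in> carrier G"
  shows "image_char (g \<otimes> k \<otimes> inv g) (g \<otimes> z \<otimes> inv g) = image_char k z"
proof -
  have cancel: "inv g <# (g <# A) = A" "g <# (inv g <# A) = A" if "A \<subseteq> carrier G" for A
    using that g lcos_m_assoc[OF that, of "inv g" g] lcos_m_assoc[OF that, of g "inv g"] lcos_mult_one[OF that]
    by auto
  have fwd: "g <# A \<in> {A \<in> image_cosets (g \<otimes> k \<otimes> inv g). (g \<otimes> z \<otimes> inv g) <# A = A}"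
    if g: "g \<in> carrier G" and k: "k \<in> carrier G" and z: "z \<in> carrier G"
      and A: "A \<in> {A \<in> image_cosets k. z <# A = A}" for g k z A
  proof -
    have Ac: "A \<subseteq> carrier G" using A image_cosets_carrier by blast
    have "(g \<otimes> z \<otimes> inv g) <# (g <# A) = (g \<otimes> z \<otimes> inv g \<otimes> g) <# A"
      using lcos_m_assoc[OF Ac, of "g \<otimes> z \<otimes> inv g" g] g z by simp
    also have "\<dots> = g <# (z <# A)" using lcos_m_assoc[OF Ac g z] g z by (simp add: m_assoc)
    finally show ?thesis using A image_cosets_conj[OF g k] by simp
  qed
  have "bij_betw (\<lambda>A. g <# A) {A \<in> image_cosets k. z <# A = A}
      {A \<in> image_cosets (g \<otimes> k \<otimes> inv g). (g \<otimes> z \<otimes> inv g) <# A = A}"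
  proof (rule bij_betw_byWitness[where f' = "\<lambda>A. inv g <# A"])
    show "(\<lambda>A. g <# A) ` {A \<in> image_cosets k. z <# A = A} \<subseteq>
        {A \<in> image_cosets (g \<otimes> k \<otimes> inv g). (g \<otimes> z \<otimes> inv g) <# A = A}"
      using fwd[OF g k z] by blast
    show "(\<lambda>A. inv g <# A) ` {A \<in> image_cosets (g \<otimes> k \<otimes> inv g). (g \<otimes> z \<otimes> inv g) <# A = A} \<subseteq>
        {A \<in> image_cosets k. z <# A = A}"
      using fwd[of "inv g" "g \<otimes> k \<otimes> inv g" "g \<otimes> z \<otimes> inv g"] g k z conj_cancel(1)[OF g] by auto
    show "\<forall>A\<in>{A \<in> image_cosets k. z <# A = A}. inv g <# (g <# A) = A"
      using cancel(1)[OF image_cosets_carrier] by blast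
    show "\<forall>A\<in>{A \<in> image_cosets (g \<otimes> k \<otimes> inv g). (g \<otimes> z \<otimes> inv g) <# A = A}. g <# (inv g <# A) = A"
      using cancel(2)[OF image_cosets_carrier] by blast
  qed
  from bij_betw_same_card[OF this] show ?thesis unfolding image_char_def by (simp only:)
qed

lemma bij_betw_conj_centr:
  assumes g: "g \<in> carrier G" and k: "k \<in> carrier G"
  shows "bij_betw (\<lambda>z. inv g \<otimes> z \<otimes> g) (carrier (centr G (g \<otimes> k \<otimes> inv g))) (carrier (centr G k))"
proof -
  have "inj_on (\<lambda>z. inv g \<otimes> z \<otimes> g) (carrier (centr G (g \<otimes> k \<otimes> inv g)))"
    using conj_cancel(2)[OF g] by (intro inj_on_inverseI[of _ "\<lambda>z. g \<otimes> z \<otimes> inv g"]) auto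
  then show ?thesis
    using twist_surj[OF g k] conj_centr_mem[OF g k] by (auto simp: bij_betw_def simp del: centr_simps)
qed

text \<open>The multiplicity is an inner product of characters, and these are invariant under
  conjugation.\<close>

lemma N_mult_twist:
  assumes g: "g \<in> carrier G" and k: "k \<in> carrier G" and \<rho>: "irreducible_rep (centr G k) \<rho>"
  shows "N_mult G H H' (g \<otimes> k \<otimes> inv g) (twist g \<rho>) = N_mult G H H' k \<rho>"
proof -
  let ?k' = "g \<otimes> k \<otimes> inv g"
  have k': "?k' \<in> carrier G" using g k by simp
  have c: "card (carrier (centr G ?k')) = card (carrier (centr G k))"
    by (rule bij_betw_same_card[OF bij_betw_conj_centr[OF g k]])
  have "of_nat (N_mult G H H' ?k' (twist g \<rho>)) * of_nat (card (carrier (centr G ?k'))) =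
      (\<Sum>z\<in>carrier (centr G ?k'). image_char ?k' z * tr (twist g \<rho> (inv z)))"
    by (rule N_mult_character[OF k' twist_irreducible[OF g k \<rho>]])
  also have "\<dots> = (\<Sum>z\<in>carrier (centr G ?k'). image_char k (inv g \<otimes> z \<otimes> g) * tr (\<rho> (inv (inv g \<otimes> z \<otimes> g))))"
  proof (rule sum.cong[OF refl])
    fix z assume "z \<in> carrier (centr G ?k')"
    then have z: "z \<in> carrier G" by simp
    have "image_char ?k' z = image_char k (inv g \<otimes> z \<otimes> g)"
      using image_char_conj[OF g k, of "inv g \<otimes> z \<otimes> g"] conj_cancel(2)[OF g z] g z by simp
    moreover have "twist g \<rho> (inv z) = \<rho> (inv (inv g \<otimes> z \<otimes> g))"
      using g z by (simp add: twist_def inv_mult_group m_assoc)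
    ultimately show "image_char ?k' z * tr (twist g \<rho> (inv z)) =
        image_char k (inv g \<otimes> z \<otimes> g) * tr (\<rho> (inv (inv g \<otimes> z \<otimes> g)))" by simp
  qed
  also have "\<dots> = (\<Sum>w\<in>carrier (centr G k). image_char k w * tr (\<rho> (inv w)))"
    by (rule sum.reindex_bij_betw[OF bij_betw_conj_centr[OF g k]])
  also have "\<dots> = of_nat (N_mult G H H' k \<rho>) * of_nat (card (carrier (centr G k)))"
    by (rule N_mult_character[OF k \<rho>, symmetric])
  finally have "(of_nat (N_mult G H H' ?k' (twist g \<rho>)) :: complex) = of_nat (N_mult G H H' k \<rho>)"
    by (simp only: c mult_right_cancel[OF card_centr_nonzero[OF k]])
  then show ?thesis by (simp only: of_nat_eq_iff)
qed

end

section \<open>Bipositivity of $S_{H,H'}$\<close>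

lemma sum_nonneg_Reals:
  fixes f :: "'i \<Rightarrow> complex"
  assumes "\<And>i. i \<in> S \<Longrightarrow> f i \<in> \<real>\<^sub>\<ge>\<^sub>0"
  shows "sum f S \<in> \<real>\<^sub>\<ge>\<^sub>0"
  using assms by (induction S rule: infinite_finite_induct) auto

context normal_pair
begin

text \<open>Conjugation by \<open>g\<close> moves the representative of \<open>m\<close> to a pair \<open>(x, \<tau>)\<close>, and \<open>\<tau>\<close> is isomorphic
  exactly to the summands of class \<open>m\<close>. So \<open>m\<close> contributes to the character of the image at \<open>y\<close>
  what these summands do.\<close>

lemma class_contribution:
  assumes x: "x \<in> carrier G" and y: "y \<in> carrier (centr G x)"
    and \<sigma>: "carries_image x \<sigma>" and dec: "decomposes (centr G x) \<rho>s \<sigma>"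
    and m: "m \<in> M_set G" and g: "g \<in> carrier G" and gx: "inv g \<otimes> m_elt m \<otimes> g = x"
  shows "of_nat (N_mult G H H' (m_elt m) (m_rep m)) * tr (m_rep m (g \<otimes> y \<otimes> inv g)) =
    (\<Sum>\<rho>\<leftarrow>\<rho>s. if M_class G x \<rho> = m then tr (\<rho> y) else 0)"
proof -
  note gr = centr_group[OF x]
  note rm = M_set_representative[OF m]
  have ig: "inv g \<in> carrier G" using g by simp
  have x_eq: "inv g \<otimes> m_elt m \<otimes> inv (inv g) = x" using gx g by simp
  define \<tau> where "\<tau> = twist (inv g) (m_rep m)"
  have \<tau>: "irreducible_rep (centr G x) \<tau>"
    unfolding \<tau>_def using twist_irreducible[OF ig rm(1,2)] x_eq by simp
  have N: "N_mult G H H' (m_elt m) (m_rep m) = N_mult G H H' x \<tau>"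
    unfolding \<tau>_def using N_mult_twist[OF ig rm(1,2)] x_eq by simp
  have "(x, \<tau>) \<in> M_class G (m_elt m) (m_rep m)"
    unfolding M_class_twist mem_Collect_eq prod.case
    using x_eq ig group.rep_iso_refl[OF gr irreducible_repD(1)[OF \<tau>]] \<tau>_def by blast
  then have m_eq: "M_class G x \<tau> = m" using M_class_memD(3)[OF rm(1,2)] rm(3) by simp
  have irr: "irreducible_rep (centr G x) \<rho>" if "\<rho> \<in> set \<rho>s" for \<rho>
    using dec that by (simp add: decomposes_def)
  have "(\<Sum>\<rho>\<leftarrow>\<rho>s. if M_class G x \<rho> = m then tr (\<rho> y) else 0) =
      (\<Sum>\<rho>\<leftarrow>\<rho>s. if \<rho> \<in> iso_class (centr G x) \<tau> then tr (\<tau> y) else 0)"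
  proof (intro arg_cong[of _ _ sum_list] map_cong refl)
    fix \<rho> assume "\<rho> \<in> set \<rho>s"
    note r = irr[OF this]
    have "M_class G x \<rho> = m \<longleftrightarrow> rep_iso (centr G x) \<tau> \<rho>"
      using M_class_eq_iff[OF x \<tau> r] m_eq by auto
    then show "(if M_class G x \<rho> = m then tr (\<rho> y) else 0) =
        (if \<rho> \<in> iso_class (centr G x) \<tau> then tr (\<tau> y) else 0)"
      using group.rep_iso_tr[OF gr _ y, of \<tau> \<rho>] by (simp add: iso_class_def)
  qed
  also have "\<dots> = of_nat (length (filter (\<lambda>\<rho>. \<rho> \<in> iso_class (centr G x) \<tau>) \<rho>s)) * tr (\<tau> y)"
    by (induction \<rho>s) (simp_all add: algebra_simps)
  also have "length (filter (\<lambda>\<rho>. \<rho> \<in> iso_class (centr G x) \<tau>) \<rho>s) = N_mult G H H' (m_elt m) (m_rep m)"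
    unfolding N N_mult_eq[OF x \<sigma> \<tau>]
    by (rule fin_group.mult_of_eq_length[OF centr_fin_group[OF x] \<tau> dec, symmetric])
  also have "tr (\<tau> y) = tr (m_rep m (g \<otimes> y \<otimes> inv g))"
    using g by (simp add: \<tau>_def twist_def)
  finally show ?thesis by simp
qed

text \<open>The conjugating elements form a coset of the centralizer.\<close>

lemma card_conjugators:
  assumes g0: "g0 \<in> carrier G" and a: "a \<in> carrier G"
  shows "card {g \<in> carrier G. inv g \<otimes> a \<otimes> g = inv g0 \<otimes> a \<otimes> g0} = card (carrier (centr G a))"
proof -
  have "bij_betw (\<lambda>z. z \<otimes> g0) (carrier (centr G a)) {g \<in> carrier G. inv g \<otimes> a \<otimes> g = inv g0 \<otimes> a \<otimes> g0}"
  proof (rule bij_betw_byWitness[where f' = "\<lambda>g. g \<otimes> inv g0"])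
    show "(\<lambda>z. z \<otimes> g0) ` carrier (centr G a) \<subseteq> {g \<in> carrier G. inv g \<otimes> a \<otimes> g = inv g0 \<otimes> a \<otimes> g0}"
    proof
      fix g assume "g \<in> (\<lambda>z. z \<otimes> g0) ` carrier (centr G a)"
      then obtain z where z: "z \<in> carrier G" "z \<otimes> a = a \<otimes> z" "g = z \<otimes> g0" by auto
      have "inv z \<otimes> (a \<otimes> z) = a" using z(1) a by (simp add: z(2)[symmetric] conj_cancel)
      moreover have "inv g \<otimes> a \<otimes> g = inv g0 \<otimes> (inv z \<otimes> (a \<otimes> z)) \<otimes> g0"
        using z(1) g0 a unfolding z(3) by (simp add: inv_mult_group m_assoc)
      ultimately have "inv g \<otimes> a \<otimes> g = inv g0 \<otimes> a \<otimes> g0" by (simp only:)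
      then show "g \<in> {g \<in> carrier G. inv g \<otimes> a \<otimes> g = inv g0 \<otimes> a \<otimes> g0}" using z(1) g0 by (simp add: z(3))
    qed
    show "(\<lambda>g. g \<otimes> inv g0) ` {g \<in> carrier G. inv g \<otimes> a \<otimes> g = inv g0 \<otimes> a \<otimes> g0} \<subseteq> carrier (centr G a)"
    proof
      fix z assume "z \<in> (\<lambda>g. g \<otimes> inv g0) ` {g \<in> carrier G. inv g \<otimes> a \<otimes> g = inv g0 \<otimes> a \<otimes> g0}"
      then obtain g where g: "g \<in> carrier G" "inv g \<otimes> a \<otimes> g = inv g0 \<otimes> a \<otimes> g0" "z = g \<otimes> inv g0" by auto
      have "z \<otimes> a = g \<otimes> (inv g0 \<otimes> a \<otimes> g0) \<otimes> inv g0" using g(1,3) g0 a by (simp add: m_assoc)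
      also have "\<dots> = a \<otimes> z" using g(1,3) g0 a by (simp add: g(2)[symmetric] m_assoc conj_cancel)
      finally show "z \<in> carrier (centr G a)" using g g0 by simp
    qed
  qed (use g0 in \<open>auto simp: m_assoc\<close>)
  from bij_betw_same_card[OF this] show ?thesis by (rule sym)
qed

text \<open>The inner sum has \<open>card (carrier (centr G (m_elt m)))\<close> equal terms if \<open>m\<close> lies over the
  conjugacy class of \<open>x\<close>, and none otherwise. So the sum over \<open>m\<close> is the sum of the characters of
  the summands of the image.\<close>

lemma sum_contributions:
  assumes fin_M: "finite (M_set G)" and x: "x \<in> carrier G" and y: "y \<in> carrier (centr G x)"
  shows "(\<Sum>m\<in>M_set G. of_nat (N_mult G H H' (m_elt m) (m_rep m)) *
      (inverse (of_nat (card (carrier (centr G (m_elt m))))) *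
        (\<Sum>g | g \<in> carrier G \<and> inv g \<otimes> m_elt m \<otimes> g = x. tr (m_rep m (g \<otimes> y \<otimes> inv g))))) =
    image_char x y"
proof -
  obtain \<sigma> where \<sigma>: "carries_image x \<sigma>" using ex_carries_image[OF x] by blast
  then have "is_rep (centr G x) \<sigma>" by (simp add: carries_def)
  then obtain \<rho>s where dec: "decomposes (centr G x) \<rho>s \<sigma>"
    using fin_group.complete_reducibility[OF centr_fin_group[OF x]] by blast
  have irr: "irreducible_rep (centr G x) \<rho>" if "\<rho> \<in> set \<rho>s" for \<rho>
    using dec that by (simp add: decomposes_def)
  have "of_nat (N_mult G H H' (m_elt m) (m_rep m)) *
      (inverse (of_nat (card (carrier (centr G (m_elt m))))) *
        (\<Sum>g | g \<in> carrier G \<and> inv g \<otimes> m_elt m \<otimes> g = x. tr (m_rep m (g \<otimes> y \<otimes> inv g)))) =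
    (\<Sum>\<rho>\<leftarrow>\<rho>s. if M_class G x \<rho> = m then tr (\<rho> y) else 0)" (is "?N * (inverse ?c * ?S) = ?R")
    if m: "m \<in> M_set G" for m
  proof (cases "\<exists>g\<in>carrier G. inv g \<otimes> m_elt m \<otimes> g = x")
    case True
    then obtain g0 where g0: "g0 \<in> carrier G" "inv g0 \<otimes> m_elt m \<otimes> g0 = x" by blast
    note a = M_set_representative(1)[OF m]
    have "?N * ?S = (\<Sum>g | g \<in> carrier G \<and> inv g \<otimes> m_elt m \<otimes> g = x. ?R)"
      unfolding sum_distrib_left using class_contribution[OF x y \<sigma> dec m] by (intro sum.cong) auto
    also have "\<dots> = ?c * ?R"
      using card_conjugators[OF g0(1) a] by (simp add: g0(2))
    finally have "?N * (inverse ?c * ?S) = inverse ?c * (?c * ?R)" by (simp only: mult.left_commute)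
    then show ?thesis
      by (simp only: mult.assoc[symmetric] left_inverse[OF card_centr_nonzero[OF a]] mult_1)
  next
    case False
    then have e: "{g. g \<in> carrier G \<and> inv g \<otimes> m_elt m \<otimes> g = x} = {}" by blast
    have "M_class G x \<rho> \<noteq> m" if "\<rho> \<in> set \<rho>s" for \<rho>
    proof
      assume mx: "M_class G x \<rho> = m"
      note a = M_set_representative[OF m]
      have "(m_elt m, m_rep m) \<in> M_class G x \<rho>"
        unfolding mx using M_class_refl[OF a(1) group.rep_iso_refl[OF centr_group[OF a(1)] irreducible_repD(1)[OF a(2)]]]
          a(3) by simp
      then obtain g where "g \<in> carrier G" "m_elt m = g \<otimes> x \<otimes> inv g" by (auto simp: M_class_twist)
      then show False using False conj_cancel(1)[of g x] x by auto
    qed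
    then have "?R = (\<Sum>\<rho>\<leftarrow>\<rho>s. 0)" by (intro arg_cong[of _ _ sum_list] map_cong) auto
    then show ?thesis unfolding e by simp
  qed
  then have "(\<Sum>m\<in>M_set G. of_nat (N_mult G H H' (m_elt m) (m_rep m)) *
      (inverse (of_nat (card (carrier (centr G (m_elt m))))) *
        (\<Sum>g | g \<in> carrier G \<and> inv g \<otimes> m_elt m \<otimes> g = x. tr (m_rep m (g \<otimes> y \<otimes> inv g))))) =
      (\<Sum>m\<in>M_set G. \<Sum>\<rho>\<leftarrow>\<rho>s. if M_class G x \<rho> = m then tr (\<rho> y) else 0)"
    by (intro sum.cong refl) blast
  also have "\<dots> = (\<Sum>\<rho>\<leftarrow>\<rho>s. \<Sum>m\<in>M_set G. if M_class G x \<rho> = m then tr (\<rho> y) else 0)"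
    by (induction \<rho>s) (simp_all add: sum.distrib)
  also have "\<dots> = (\<Sum>\<rho>\<leftarrow>\<rho>s. tr (\<rho> y))"
  proof (intro arg_cong[of _ _ sum_list] map_cong refl)
    fix \<rho> assume "\<rho> \<in> set \<rho>s"
    then have "M_class G x \<rho> \<in> M_set G" using irr x by (auto simp: M_set_def)
    then show "(\<Sum>m\<in>M_set G. if M_class G x \<rho> = m then tr (\<rho> y) else 0) = tr (\<rho> y)"
      using fin_M by simp
  qed
  also have "\<dots> = tr (\<sigma> y)"
  proof -
    have "rep_iso (centr G x) (dsum \<rho>s) \<sigma>" using dec by (simp add: decomposes_def)
    then have "tr (\<sigma> y) = tr (dsum \<rho>s y)" using group.rep_iso_tr[OF centr_group[OF x] _ y] by metis
    then show ?thesis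
      using group.tr_dsum[OF centr_group[OF x] irreducible_repD(1)[OF irr] y] by simp
  qed
  also have "\<dots> = image_char x y" by (rule carries_image_tr[OF x \<sigma> y])
  finally show ?thesis .
qed

text \<open>In the pairing, collect the \<open>g\<close> with the same $x' = g^{-1} x g$, where \<open>x\<close> is the first
  component of the representative of \<open>m\<close>; these \<open>x'\<close> run through the centralizer of the first
  component of \<open>m'\<close>.\<close>

lemma fourier_S_elt:
  assumes fin_M: "finite (M_set G)" and m': "m' \<in> M_set G"
  shows "fourier G (S_elt G H H') m' = inverse (of_nat (card (carrier (centr G (m_elt m'))))) *
    (\<Sum>x\<in>carrier (centr G (m_elt m')). cnj (tr (m_rep m' x)) * image_char x (m_elt m'))"
proof -
  define y where "y = m_elt m'"
  define \<rho>' where "\<rho>' = m_rep m'"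
  note rm' = M_set_representative[OF m', folded y_def \<rho>'_def]
  let ?N = "\<lambda>m. of_nat (N_mult G H H' (m_elt m) (m_rep m)) :: complex"
  let ?ic = "\<lambda>a. inverse (of_nat (card (carrier (centr G a)))) :: complex"
  let ?I = "\<lambda>m x. \<Sum>g | g \<in> carrier G \<and> inv g \<otimes> m_elt m \<otimes> g = x. tr (m_rep m (g \<otimes> y \<otimes> inv g))"
  have pairing: "M_pairing G (m_elt m) (m_rep m) y \<rho>' =
      ?ic (m_elt m) * ?ic y * (\<Sum>x\<in>carrier (centr G y). cnj (tr (\<rho>' x)) * ?I m x)"
    if m: "m \<in> M_set G" for m
  proof -
    note a = M_set_representative(1)[OF m]
    let ?A = "{g \<in> carrier G. m_elt m \<otimes> (g \<otimes> y \<otimes> inv g) = (g \<otimes> y \<otimes> inv g) \<otimes> m_elt m}"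
    have A_iff: "m_elt m \<otimes> (g \<otimes> y \<otimes> inv g) = (g \<otimes> y \<otimes> inv g) \<otimes> m_elt m \<longleftrightarrow>
        inv g \<otimes> m_elt m \<otimes> g \<in> carrier (centr G y)" if g: "g \<in> carrier G" for g
    proof
      assume "m_elt m \<otimes> (g \<otimes> y \<otimes> inv g) = (g \<otimes> y \<otimes> inv g) \<otimes> m_elt m"
      then show "inv g \<otimes> m_elt m \<otimes> g \<in> carrier (centr G y)"
        using conj_centr_mem[OF g rm'(1)] a by simp
    next
      assume "inv g \<otimes> m_elt m \<otimes> g \<in> carrier (centr G y)"
      then have "inv (inv g) \<otimes> (inv g \<otimes> m_elt m \<otimes> g) \<otimes> inv g \<in> carrier (centr G (g \<otimes> y \<otimes> inv g))"
        using conj_centr_mem[of "inv g" "g \<otimes> y \<otimes> inv g" "inv g \<otimes> m_elt m \<otimes> g"] g rm'(1)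
        by (simp add: conj_cancel(1) del: centr_simps)
      then show "m_elt m \<otimes> (g \<otimes> y \<otimes> inv g) = (g \<otimes> y \<otimes> inv g) \<otimes> m_elt m"
        using conj_cancel(2)[OF g a] g by simp
    qed
    have "(\<Sum>g\<in>?A. cnj (tr (\<rho>' (inv g \<otimes> m_elt m \<otimes> g))) * tr (m_rep m (g \<otimes> y \<otimes> inv g))) =
      (\<Sum>x\<in>carrier (centr G y). \<Sum>g | g \<in> ?A \<and> inv g \<otimes> m_elt m \<otimes> g = x.
          cnj (tr (\<rho>' (inv g \<otimes> m_elt m \<otimes> g))) * tr (m_rep m (g \<otimes> y \<otimes> inv g)))"
      using fin A_iff by (intro sum.group[symmetric]) auto
    also have "\<dots> = (\<Sum>x\<in>carrier (centr G y). cnj (tr (\<rho>' x)) * ?I m x)"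
    proof (rule sum.cong[OF refl])
      fix x assume x: "x \<in> carrier (centr G y)"
      have "{g. g \<in> ?A \<and> inv g \<otimes> m_elt m \<otimes> g = x} = {g. g \<in> carrier G \<and> inv g \<otimes> m_elt m \<otimes> g = x}"
        using x A_iff by (auto simp del: centr_simps)
      then show "(\<Sum>g | g \<in> ?A \<and> inv g \<otimes> m_elt m \<otimes> g = x.
          cnj (tr (\<rho>' (inv g \<otimes> m_elt m \<otimes> g))) * tr (m_rep m (g \<otimes> y \<otimes> inv g))) = cnj (tr (\<rho>' x)) * ?I m x"
        unfolding sum_distrib_left by (intro sum.cong) auto
    qed
    finally show ?thesis by (simp only: M_pairing_def)
  qed
  have "fourier G (S_elt G H H') m' = (\<Sum>m\<in>M_set G. ?N m * M_pairing G (m_elt m) (m_rep m) y \<rho>')"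
    using m' by (simp add: fourier_def S_elt_def y_def \<rho>'_def)
  also have "\<dots> = (\<Sum>m\<in>M_set G. \<Sum>x\<in>carrier (centr G y).
      ?ic y * (cnj (tr (\<rho>' x)) * (?N m * (?ic (m_elt m) * ?I m x))))"
    by (intro sum.cong refl) (simp add: pairing sum_distrib_left mult_ac)
  also have "\<dots> = (\<Sum>x\<in>carrier (centr G y). \<Sum>m\<in>M_set G.
      ?ic y * (cnj (tr (\<rho>' x)) * (?N m * (?ic (m_elt m) * ?I m x))))"
    by (rule sum.swap)
  also have "\<dots> = (\<Sum>x\<in>carrier (centr G y). ?ic y * (cnj (tr (\<rho>' x)) * image_char x y))"
  proof (rule sum.cong[OF refl])
    fix x assume "x \<in> carrier (centr G y)"
    then have "x \<in> carrier G" "y \<in> carrier (centr G x)" using rm'(1) by auto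
    from sum_contributions[OF fin_M this]
    show "(\<Sum>m\<in>M_set G. ?ic y * (cnj (tr (\<rho>' x)) * (?N m * (?ic (m_elt m) * ?I m x)))) =
        ?ic y * (cnj (tr (\<rho>' x)) * image_char x y)"
      by (simp only: sum_distrib_left[symmetric])
  qed
  finally show ?thesis by (simp only: sum_distrib_left[symmetric] y_def \<rho>'_def)
qed

text \<open>It is the intersection of the centralizer of \<open>y\<close> with $u H u^{-1}$.\<close>

lemma image_coset_stabilizer:
  assumes u: "u \<in> carrier G" and y: "y \<in> carrier G"
  shows "subgroup {x \<in> carrier (centr G y). u <# H' \<in> image_cosets x} (centr G y)"
proof -
  interpret Z: group "centr G y" by (rule centr_group[OF y])
  have eq: "{x \<in> carrier (centr G y). u <# H' \<in> image_cosets x} =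
      {x \<in> carrier (centr G y). inv u \<otimes> x \<otimes> u \<in> H}"
    using mem_image_cosets[OF u] by auto
  show ?thesis unfolding eq
  proof (rule Z.subgroupI)
    show "{x \<in> carrier (centr G y). inv u \<otimes> x \<otimes> u \<in> H} \<noteq> {}"
      using Z.one_closed u subgroup.one_closed[OF H] y by (auto intro!: exI[of _ \<one>])
    fix a assume a: "a \<in> {x \<in> carrier (centr G y). inv u \<otimes> x \<otimes> u \<in> H}"
    then have aG: "a \<in> carrier G" by simp
    have "inv u \<otimes> inv a \<otimes> u = inv (inv u \<otimes> a \<otimes> u)" using u aG by (simp add: inv_mult_group m_assoc)
    then have "inv u \<otimes> inv a \<otimes> u \<in> H" using a subgroup.m_inv_closed[OF H] by simp
    then show "inv\<^bsub>centr G y\<^esub> a \<in> {x \<in> carrier (centr G y). inv u \<otimes> x \<otimes> u \<in> H}"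
      using Z.inv_closed[of a] a centr_inv[OF y, of a] by simp
    fix b assume b: "b \<in> {x \<in> carrier (centr G y). inv u \<otimes> x \<otimes> u \<in> H}"
    then have bG: "b \<in> carrier G" by simp
    have "inv u \<otimes> (a \<otimes> b) \<otimes> u \<in> H"
      unfolding conj_mult[OF u aG bG] using a b by (auto intro: subgroup.m_closed[OF H])
    then show "a \<otimes>\<^bsub>centr G y\<^esub> b \<in> {x \<in> carrier (centr G y). inv u \<otimes> x \<otimes> u \<in> H}"
      using Z.m_closed[of a b] a b by simp
  qed auto
qed

text \<open>The coset \<open>A\<close> is counted by those \<open>x\<close> which form the subgroup of the preceding lemma;
  exchanging the sums leaves a sum of values of a character over a subgroup for every \<open>A\<close>.\<close>

lemma fourier_coefficient_nonneg:
  assumes y: "y \<in> carrier G" and \<rho>': "is_rep (centr G y) \<rho>'"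
  shows "(\<Sum>x\<in>carrier (centr G y). cnj (tr (\<rho>' x)) * image_char x y) \<in> \<real>\<^sub>\<ge>\<^sub>0"
proof -
  let ?Y = "{A \<in> lcosets\<^bsub>G\<^esub> H'. y <# A = A}" and ?Z = "carrier (centr G y)"
  have finZ: "finite ?Z" using fin by simp
  have finY: "finite ?Y" using finite_lcosets by simp
  have "(\<Sum>x\<in>?Z. cnj (tr (\<rho>' x)) * image_char x y) =
      (\<Sum>x\<in>?Z. \<Sum>A\<in>?Y. if A \<in> image_cosets x then cnj (tr (\<rho>' x)) else 0)"
  proof (rule sum.cong[OF refl])
    fix x
    have "{A \<in> image_cosets x. y <# A = A} = {A \<in> ?Y. A \<in> image_cosets x}"
      using image_cosets_sub[of x] by blast
    then show "cnj (tr (\<rho>' x)) * image_char x y = (\<Sum>A\<in>?Y. if A \<in> image_cosets x then cnj (tr (\<rho>' x)) else 0)"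
      using finY by (simp add: image_char_def sum.If_cases Int_def conj_commute conj_left_commute)
  qed
  also have "\<dots> = (\<Sum>A\<in>?Y. \<Sum>x\<in>?Z. if A \<in> image_cosets x then cnj (tr (\<rho>' x)) else 0)"
    by (rule sum.swap)
  also have "\<dots> = (\<Sum>A\<in>?Y. cnj (\<Sum>x | x \<in> ?Z \<and> A \<in> image_cosets x. tr (\<rho>' x)))"
    using finZ by (intro sum.cong refl) (simp add: sum.If_cases Int_def)
  also have "\<dots> \<in> \<real>\<^sub>\<ge>\<^sub>0"
  proof (rule sum_nonneg_Reals)
    fix A assume "A \<in> ?Y"
    then obtain u where u: "u \<in> carrier G" "A = u <# H'" by (auto simp: LCOSETS_def)
    let ?K = "{x \<in> ?Z. A \<in> image_cosets x}"
    have sub: "subgroup ?K (centr G y)" unfolding u(2) by (rule image_coset_stabilizer[OF u(1) y])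
    have "finite ?K" by (rule finite_subset[OF _ finZ]) blast
    then have K: "fin_group ((centr G y)\<lparr>carrier := ?K\<rparr>)"
      by (intro fin_group.intro fin_group_axioms.intro group.subgroup_imp_group[OF centr_group[OF y] sub]) (simp del: centr_simps)
    have "is_rep ((centr G y)\<lparr>carrier := ?K\<rparr>) \<rho>'"
      using \<rho>' by (simp add: is_rep_def rep_dim_def)
    from fin_group.sum_character_nonneg[OF K this]
    have "(\<Sum>x\<in>?K. tr (\<rho>' x)) \<in> \<real>\<^sub>\<ge>\<^sub>0" by simp
    then obtain r where "0 \<le> r" "(\<Sum>x\<in>?K. tr (\<rho>' x)) = complex_of_real r" by (auto elim: nonneg_Reals_cases)
    then show "cnj (\<Sum>x | x \<in> ?Z \<and> A \<in> image_cosets x. tr (\<rho>' x)) \<in> \<real>\<^sub>\<ge>\<^sub>0" by simp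
  qed
  finally show ?thesis .
qed

theorem bipositive_S_elt: "bipositive G (S_elt G H H')"
  unfolding bipositive_def
proof
  show "S_elt G H H' \<in> M_nonneg G"
    by (auto simp: M_nonneg_def free_space_def S_elt_def)
  have "fourier G (S_elt G H H') m' \<in> \<real>\<^sub>\<ge>\<^sub>0" if m': "m' \<in> M_set G" for m'
  proof (cases "finite (M_set G)")
    case True
    note rm' = M_set_representative[OF m']
    have "inverse (of_nat (card (carrier (centr G (m_elt m'))))) \<in> (\<real>\<^sub>\<ge>\<^sub>0 :: complex set)"
      by (intro nonneg_Reals_inverse_I nonneg_Reals_of_nat_I)
    then show ?thesis
      unfolding fourier_S_elt[OF True m']
      using fourier_coefficient_nonneg[OF rm'(1) irreducible_repD(1)[OF rm'(2)]] by (rule nonneg_Reals_mult_I)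
  next
    case False
    \<comment> \<open>A sum over an infinite set is \<open>0\<close> by convention.\<close>
    then show ?thesis using m' by (simp add: fourier_def)
  qed
  then show "fourier G (S_elt G H H') \<in> M_nonneg G"
    by (auto simp: M_nonneg_def free_space_def fourier_def)
qed

end

section \<open>The collections $\mathcal{F}(V)$ are isotropic\<close>

lemma odd_card_sym_diff:
  assumes "finite A" "finite B"
  shows "odd (card (sym_diff A B)) \<longleftrightarrow> odd (card A) \<noteq> odd (card B)"
proof -
  have "card (A - B) + card (A \<inter> B) = card A"
    using assms by (simp add: card_Diff_subset_Int card_mono)
  moreover have "card (B - A) + card (A \<inter> B) = card B"
    using assms by (simp add: card_Diff_subset_Int card_mono Int_commute)
  moreover have "card (sym_diff A B) = card (A - B) + card (B - A)"
    using assms by (intro card_Un_disjoint) auto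
  ultimately show ?thesis by presburger
qed

text \<open>The linear functional on the $\mathbf{F}_2$-space of sets whose value at the basis vector
  \<open>{k}\<close> is \<open>p k\<close>.\<close>

definition odd_on :: "('i \<Rightarrow> bool) \<Rightarrow> 'i set \<Rightarrow> bool" where
  "odd_on p x \<longleftrightarrow> odd (card {k \<in> x. p k})"

lemma odd_on_empty [simp]: "\<not> odd_on p {}"
  by (simp add: odd_on_def)

lemma odd_on_sym_diff:
  assumes "finite x" "finite y"
  shows "odd_on p (sym_diff x y) \<longleftrightarrow> odd_on p x \<noteq> odd_on p y"
proof -
  have "{k \<in> sym_diff x y. p k} = sym_diff {k \<in> x. p k} {k \<in> y. p k}" by blast
  then show ?thesis using odd_card_sym_diff[of "{k \<in> x. p k}" "{k \<in> y. p k}"] assms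
    by (simp add: odd_on_def)
qed

lemma odd_on_insert:
  assumes "finite x" "k \<notin> x"
  shows "odd_on p (insert k x) \<longleftrightarrow> p k \<noteq> odd_on p x"
proof -
  have "{j \<in> insert k x. p j} = (if p k then insert k {j \<in> x. p j} else {j \<in> x. p j})" by auto
  then show ?thesis using assms by (simp add: odd_on_def)
qed

lemma odd_on_singleton [simp]: "odd_on p {k} \<longleftrightarrow> p k"
  using odd_on_insert[of "{}" k p] by simp

lemma odd_on_cong: "x = y \<Longrightarrow> (\<And>k. k \<in> y \<Longrightarrow> p k = q k) \<Longrightarrow> odd_on p x = odd_on q y"
  unfolding odd_on_def by (metis (no_types, lifting) Collect_cong)

lemma odd_sum_iff:
  fixes f :: "'i \<Rightarrow> nat"
  assumes "finite x"
  shows "odd (sum f x) \<longleftrightarrow> odd_on (\<lambda>k. odd (f k)) x"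
  using assms by (induction x rule: finite_induct) (auto simp: odd_on_insert)

definition adj :: "nat \<Rightarrow> nat \<Rightarrow> bool" where
  "adj i j \<longleftrightarrow> i = j + 1 \<or> j = i + 1"

text \<open>The symplectic form in a shape that shows its linearity in the first argument.\<close>

definition form :: "nat set \<Rightarrow> nat set \<Rightarrow> bool" where
  "form x y \<longleftrightarrow> odd_on (\<lambda>k. odd_on (adj k) y) x"

lemma V_form_eq_0_iff:
  assumes "finite x" "finite y"
  shows "V_form x y = 0 \<longleftrightarrow> \<not> form x y"
proof -
  have "{(i, j). i \<in> x \<and> j \<in> y \<and> (i = j + 1 \<or> j = i + 1)} = Sigma x (\<lambda>i. {j \<in> y. adj i j})"
    by (auto simp: adj_def)
  then have "V_form x y = (\<Sum>i\<in>x. card {j \<in> y. adj i j}) mod 2"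
    using assms by (simp add: V_form_def)
  then show ?thesis
    using odd_sum_iff[OF assms(1), of "\<lambda>i. card {j \<in> y. adj i j}"]
    by (simp add: form_def odd_on_def mod2_eq_if)
qed

lemma form_sym:
  assumes "finite x" "finite y"
  shows "form x y \<longleftrightarrow> form y x"
proof -
  have "bij_betw prod.swap {(i, j). i \<in> x \<and> j \<in> y \<and> (i = j + 1 \<or> j = i + 1)}
     {(i, j). i \<in> y \<and> j \<in> x \<and> (i = j + 1 \<or> j = i + 1)}"
    by (rule bij_betw_byWitness[where f' = prod.swap]) auto
  from bij_betw_same_card[OF this] have "V_form x y = V_form y x" by (simp only: V_form_def)
  then have "(\<not> form x y) = (\<not> form y x)"
    unfolding V_form_eq_0_iff[OF assms, symmetric] V_form_eq_0_iff[OF assms(2,1), symmetric] by (simp only:)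
  then show ?thesis by blast
qed

lemma form_sym_diff_left:
  assumes "finite x" "finite y"
  shows "form (sym_diff x y) z \<longleftrightarrow> form x z \<noteq> form y z"
  unfolding form_def by (rule odd_on_sym_diff[OF assms])

lemma form_sym_diff_right:
  assumes "finite x" "finite y" "finite z"
  shows "form z (sym_diff x y) \<longleftrightarrow> form z x \<noteq> form z y"
  using form_sym_diff_left[OF assms(1,2), of z] assms by (simp add: form_sym[of z])

lemma lin2_insert:
  assumes "finite x" "k \<notin> x"
  shows "lin2 f (insert k x) = sym_diff (f k) (lin2 f x)"
proof (rule Set.set_eqI)
  fix b
  have "b \<in> lin2 f x \<longleftrightarrow> odd_on (\<lambda>k. b \<in> f k) x" for x
    unfolding lin2_def odd_on_def by (rule mem_Collect_eq)
  then have "b \<in> lin2 f (insert k x) \<longleftrightarrow> (b \<in> f k) \<noteq> (b \<in> lin2 f x)"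
    using odd_on_insert[OF assms, of "\<lambda>k. b \<in> f k"] by simp
  then show "b \<in> lin2 f (insert k x) \<longleftrightarrow> b \<in> sym_diff (f k) (lin2 f x)" by blast
qed

lemma lin2_subset: "lin2 f x \<subseteq> (\<Union>k\<in>x. f k)"
proof
  fix b assume "b \<in> lin2 f x"
  then have "odd (card {k \<in> x. b \<in> f k})" by (simp add: lin2_def)
  then have "{k \<in> x. b \<in> f k} \<noteq> {}" by (metis card.empty even_zero)
  then show "b \<in> (\<Union>k\<in>x. f k)" by blast
qed

text \<open>An additive function is determined on the image of a linear map by its values on the images
  of the basis vectors.\<close>

lemma additive_lin2:
  assumes "finite x" and f: "\<And>k. k \<in> x \<Longrightarrow> finite (f k)"
    and "\<not> \<phi> {}" and add: "\<And>y z. finite y \<Longrightarrow> finite z \<Longrightarrow> \<phi> (sym_diff y z) \<longleftrightarrow> \<phi> y \<noteq> \<phi> z"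
  shows "\<phi> (lin2 f x) \<longleftrightarrow> odd_on (\<lambda>k. \<phi> (f k)) x"
  using assms(1) f
proof (induction x rule: finite_induct)
  case empty
  have "lin2 f {} = {}" by (simp add: lin2_def)
  then show ?case using assms(3) by simp
next
  case (insert k x)
  have "finite (lin2 f x)" using insert by (intro finite_subset[OF lin2_subset]) auto
  then show ?case
    using insert by (simp add: lin2_insert odd_on_insert add)
qed

definition T_basis :: "nat \<Rightarrow> nat \<Rightarrow> nat set" where
  "T_basis i k = (if k + 2 \<le> i then {k} else if i \<le> k then {k + 2} else {i - 1, i, i + 1})"

lemma T_map_eq: "T_map i = lin2 (T_basis i)"
  by (simp add: T_map_def T_basis_def[abs_def])

lemma form_singletons [simp]: "form {k} {l} \<longleftrightarrow> adj k l"
  by (simp add: form_def)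

lemma T_basis_simps:
  "k + 2 \<le> i \<Longrightarrow> T_basis i k = {k}" "i \<le> k \<Longrightarrow> T_basis i k = {k + 2}"
  "T_basis (Suc k) k = {k, Suc k, Suc (Suc k)}"
  by (auto simp: T_basis_def)

lemma odd_on_triple: "odd_on p {k, Suc k, Suc (Suc k)} \<longleftrightarrow> p k \<noteq> (p (Suc k) \<noteq> p (Suc (Suc k)))"
  by (simp add: odd_on_insert)

text \<open>The map $T_i$ is an isometry. The only new basis vector is $e_{i-1} + e_i + e_{i+1}$; it is
  isotropic, pairs with the other $e_k$ like the vector $e'_{i-1}$ does, and is orthogonal to $e_i$.\<close>

lemma form_T_basis:
  "form (T_basis i k) (T_basis i l) \<longleftrightarrow> adj k l"
proof -
  consider "k + 2 \<le> i" | "i \<le> k" | "i = Suc k" by linarith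
  then show ?thesis
  proof cases
    case 1
    consider "l + 2 \<le> i" | "i \<le> l" | "i = Suc l" by linarith
    then show ?thesis using 1
      by cases (auto simp: T_basis_simps form_def odd_on_triple adj_def simp del: One_nat_def)
  next
    case 2
    consider "l + 2 \<le> i" | "i \<le> l" | "i = Suc l" by linarith
    then show ?thesis using 2
      by cases (auto simp: T_basis_simps form_def odd_on_triple adj_def)
  next
    case 3
    consider "l + 2 \<le> i" | "i \<le> l" | "i = Suc l" by linarith
    then show ?thesis using 3
      by cases (auto simp: T_basis_simps form_def odd_on_triple adj_def)
  qed
qed

lemma form_T_basis_e: "\<not> form (T_basis i k) {i}"
proof -
  consider "k + 2 \<le> i" | "i \<le> k" | "i = Suc k" by linarith
  then show ?thesis
    by cases (auto simp: T_basis_simps form_def odd_on_triple adj_def)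
qed

lemma finite_T_basis [simp]: "finite (T_basis i k)"
  by (simp add: T_basis_def)

lemma finite_T_map: "finite x \<Longrightarrow> finite (T_map i x)"
  unfolding T_map_eq by (rule finite_subset[OF lin2_subset]) simp

lemma form_empty [simp]: "\<not> form {} z" "\<not> form z {}"
  by (simp_all add: form_def) (simp add: odd_on_def)

lemma form_T_map:
  assumes x: "finite x" and y: "finite y"
  shows "form (T_map i x) (T_map i y) \<longleftrightarrow> form x y"
proof -
  have "form (T_map i x) (T_map i y) \<longleftrightarrow> odd_on (\<lambda>k. form (T_basis i k) (T_map i y)) x"
    unfolding T_map_eq[of i] by (rule additive_lin2[OF x]) (simp_all add: form_sym_diff_left)
  also have "\<dots> \<longleftrightarrow> odd_on (\<lambda>k. odd_on (\<lambda>l. form (T_basis i k) (T_basis i l)) y) x"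
    unfolding T_map_eq[of i]
    by (intro odd_on_cong refl additive_lin2[OF y]) (simp_all add: form_sym_diff_right)
  also have "\<dots> \<longleftrightarrow> form x y"
    by (simp only: form_T_basis form_def[of x y])
  finally show ?thesis .
qed

lemma form_T_map_e:
  assumes x: "finite x"
  shows "\<not> form (T_map i x) {i}"
proof -
  have "form (T_map i x) {i} \<longleftrightarrow> odd_on (\<lambda>k. form (T_basis i k) {i}) x"
    unfolding T_map_eq[of i] by (rule additive_lin2[OF x]) (simp_all add: form_sym_diff_left)
  also have "\<dots> \<longleftrightarrow> odd_on (\<lambda>_. False) x"
    by (simp only: form_T_basis_e)
  finally show ?thesis by (simp add: odd_on_def)
qed

text \<open>Adding $e_i$ to the isometric image of an isotropic subspace under $T_i$ keeps it isotropic,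
  since $e_i$ is orthogonal to itself and to the image of $T_i$.\<close>

lemma F_coll_isotropic:
  assumes "F_coll D X"
  shows "even D" "\<And>x. x \<in> X \<Longrightarrow> x \<subseteq> {1..D}" "\<And>x y. x \<in> X \<Longrightarrow> y \<in> X \<Longrightarrow> \<not> form x y"
  using assms
proof (induction rule: F_coll.induct)
  case (zero D)
  { case 1 show ?case using zero by simp }
  { case (2 x) then show ?case by simp }
  { case (3 x y) then show ?case by simp }
next
  case (step D X' i)
  have sub: "x \<subseteq> {1..D}" if "x \<in> X'" for x using step.IH(2) that by blast
  have fin: "finite x" if "x \<in> X'" for x using sub[OF that] finite_subset by blast
  have Tb: "T_basis i k \<subseteq> {1..D + 2}" if "k \<in> {1..D}" for k
    using that by (auto simp: T_basis_def)
  have Tsub: "T_map i x \<subseteq> {1..D + 2}" if "x \<in> X'" for x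
    unfolding T_map_eq using lin2_subset[of "T_basis i" x] Tb sub[OF that] by blast
  { case 1 show ?case using step.IH(1) by simp }
  { case (2 x) then show ?case using Tsub step.hyps(2) by auto }
  {
    case (3 x y)
    have isos: "\<not> form (T_map i a) (T_map i b)" if "a \<in> X'" "b \<in> X'" for a b
      using form_T_map[of a b i] fin that step.IH(3) by blast
    have ort: "\<not> form (T_map i a) {i}" "\<not> form {i} (T_map i a)" if "a \<in> X'" for a
      using form_T_map_e[of a i] form_sym[of "{i}" "T_map i a"] finite_T_map[of a i] fin[OF that] by auto
    have ee: "\<not> form {i} {i}" by (simp add: adj_def)
    have fT: "finite (T_map i a)" if "a \<in> X'" for a using finite_T_map fin that by blast
    obtain a where a: "a \<in> X'" "x = T_map i a \<or> x = sym_diff (T_map i a) {i}" using 3(1) by blast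
    obtain b where b: "b \<in> X'" "y = T_map i b \<or> y = sym_diff (T_map i b) {i}" using 3(2) by blast
    have left: "\<not> form x z" if "\<not> form (T_map i a) z" "\<not> form {i} z" for z
      using a(2) form_sym_diff_left[OF fT[OF a(1)], of "{i}" z] that by auto
    have right: "\<not> form z y" if "finite z" "\<not> form z (T_map i b)" "\<not> form z {i}" for z
      using b(2) form_sym_diff_right[OF fT[OF b(1)], of "{i}" z] that by auto
    show ?case
      by (intro left right fT a(1) isos[OF a(1) b(1)] ort a(1) b(1) ee) simp
  }
qed

section \<open>The pairs in $\Theta_c$\<close>

text \<open>Separation of a vector from a subspace of $\mathbf{F}_2^I$ by a linear functional, by induction
  on \<open>I\<close>. If some \<open>z0\<close> in the subspace involves the coordinate \<open>k\<close>, it serves to eliminate \<open>k\<close> from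
  all other vectors, and the value of the functional at \<open>k\<close> is chosen to make it vanish at \<open>z0\<close>.
  Otherwise the coordinate \<open>k\<close> itself or a functional on the remaining coordinates will do.\<close>

lemma separating_functional:
  assumes "finite I" "L \<subseteq> Pow I" "{} \<in> L" "\<And>y z. y \<in> L \<Longrightarrow> z \<in> L \<Longrightarrow> sym_diff y z \<in> L"
    and "x \<subseteq> I" "x \<notin> L"
  shows "\<exists>p. (\<forall>z\<in>L. \<not> odd_on p z) \<and> odd_on p x"
  using assms
proof (induction I arbitrary: L x rule: finite_induct)
  case empty
  then show ?case by auto
next
  case (insert k I)
  have fin: "finite z" if "z \<subseteq> insert k I" for z using that insert.hyps(1) finite_subset by blast
  show ?case
  proof (cases "\<exists>z0\<in>L. k \<in> z0")
    case True
    then obtain z0 where z0: "z0 \<in> L" "k \<in> z0" by blast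
    define L0 where "L0 = {z \<in> L. k \<notin> z}"
    define x0 where "x0 = (if k \<in> x then sym_diff x z0 else x)"
    have x_eq: "x = sym_diff (sym_diff x z0) z0" by blast
    have "sym_diff x z0 \<notin> L" using insert.prems(3)[OF _ z0(1), of "sym_diff x z0"] x_eq insert.prems(5) by metis
    then have x0: "x0 \<subseteq> I" "x0 \<notin> L0"
      using insert.prems z0 by (auto simp: x0_def L0_def)
    have "\<exists>p. (\<forall>z\<in>L0. \<not> odd_on p z) \<and> odd_on p x0"
    proof (rule insert.IH)
      show "L0 \<subseteq> Pow I" "{} \<in> L0" using insert.prems(1,2) by (auto simp: L0_def)
      show "sym_diff y z \<in> L0" if "y \<in> L0" "z \<in> L0" for y z
        using that insert.prems(3)[of y z] by (simp add: L0_def)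
    qed (use x0 in auto)
    then obtain p where p: "\<And>z. z \<in> L0 \<Longrightarrow> \<not> odd_on p z" "odd_on p x0" by blast
    define q where "q = p(k := odd_on p (z0 - {k}))"
    have q_eq: "odd_on q w = odd_on p w" if "k \<notin> w" for w
      using that by (intro odd_on_cong) (auto simp: q_def)
    have "finite z0" using fin insert.prems(1) z0(1) by blast
    then have "odd_on q (insert k (z0 - {k})) \<longleftrightarrow> q k \<noteq> odd_on q (z0 - {k})"
      by (intro odd_on_insert) auto
    then have qz0: "\<not> odd_on q z0" using q_eq[of "z0 - {k}"] z0(2) by (simp add: q_def insert_absorb)
    have add: "odd_on q (sym_diff w z0) \<longleftrightarrow> odd_on q w" if "w \<subseteq> insert k I" for w
      using odd_on_sym_diff[OF fin[OF that] \<open>finite z0\<close>] qz0 by blast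
    have "\<not> odd_on q z" if z: "z \<in> L" for z
    proof (cases "k \<in> z")
      case True
      have "sym_diff z z0 \<in> L0" using insert.prems(3)[OF z z0(1)] True z0(2) by (simp add: L0_def)
      then have "\<not> odd_on q (sym_diff z z0)" using p(1) q_eq[of "sym_diff z z0"] True z0(2) by simp
      then show ?thesis using add[of z] insert.prems(1) z by blast
    next
      case False
      then show ?thesis using p(1)[of z] q_eq z by (simp add: L0_def)
    qed
    moreover have "odd_on q x"
    proof (cases "k \<in> x")
      case True
      then have "odd_on q (sym_diff x z0)" using p(2) q_eq[of "sym_diff x z0"] z0(2) by (simp add: x0_def)
      then show ?thesis using add[OF insert.prems(4)] by blast
    next
      case False
      then show ?thesis using p(2) q_eq by (simp add: x0_def)
    qed
    ultimately show ?thesis by blast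
  next
    case False
    show ?thesis
    proof (cases "k \<in> x")
      case True
      have "{j \<in> z. j = k} = {}" if "z \<in> L" for z using that False by blast
      then have "\<not> odd_on (\<lambda>j. j = k) z" if "z \<in> L" for z
        using that unfolding odd_on_def by (metis card.empty even_zero)
      moreover have "{j \<in> x. j = k} = {k}" using True by blast
      then have "odd_on (\<lambda>j. j = k) x" by (simp add: odd_on_def)
      ultimately show ?thesis by blast
    next
      case kx: False
      show ?thesis
        by (rule insert.IH) (use insert.prems False kx in blast)+
    qed
  qed
qed

text \<open>The pairing of $V^\delta$ with $V^{1-\delta}$ is perfect: every functional \<open>p\<close> on $V^\delta$ is
  of the form $(\cdot, y)$.\<close>

lemma V_perp_separates:
  assumes D: "even D" and \<delta>: "\<delta> \<in> {0, 1}"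
    and L: "L \<subseteq> Pow (V_ind D \<delta>)" "{} \<in> L" "\<And>y z. y \<in> L \<Longrightarrow> z \<in> L \<Longrightarrow> sym_diff y z \<in> L"
    and x: "x \<subseteq> V_ind D \<delta>" "x \<notin> L"
  shows "\<exists>y\<in>V_perp D \<delta> L. form x y"
proof -
  let ?I = "V_ind D \<delta>"
  have finI: "finite ?I" by (simp add: V_ind_def)
  obtain p where p: "\<And>z. z \<in> L \<Longrightarrow> \<not> odd_on p z" "odd_on p x"
    using separating_functional[OF finI L x] by blast
  \<comment> \<open>The equations \<open>(e\<^sub>k, y) = y\<^sub>k\<^sub>-\<^sub>1 + y\<^sub>k\<^sub>+\<^sub>1 = p k\<close> are solved by partial sums. These start at the
    end of \<open>{1..D}\<close> whose neighbour outside would otherwise enter an equation: it belongs to \<open>k = 1\<close>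
    for \<open>\<delta> = 1\<close> and to \<open>k = D\<close>, which is even, for \<open>\<delta> = 0\<close>.\<close>
  define S where "S j = odd_on p {k \<in> ?I. if \<delta> = 1 then k < j else j < k}" for j
  define y where "y = {j \<in> V_ind D (1 - \<delta>). S j}"
  have y: "y \<in> Pow (V_ind D (1 - \<delta>))" by (auto simp: y_def)
  have fy: "finite y" by (rule finite_subset[of _ "V_ind D (1 - \<delta>)"]) (auto simp: y_def V_ind_def)
  have key: "odd_on (adj k) y \<longleftrightarrow> p k" if k: "k \<in> ?I" for k
  proof -
    have k1: "1 \<le> k" "k \<le> D" "k mod 2 = \<delta>" using k by (auto simp: V_ind_def)
    have "{j \<in> y. adj k j} = {j \<in> {k - 1, k + 1}. j \<in> y}" using k1 by (auto simp: adj_def)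
    then have "odd_on (adj k) y \<longleftrightarrow> odd_on (\<lambda>j. j \<in> y) {k - 1, k + 1}"
      unfolding odd_on_def by (simp only:)
    then have 1: "odd_on (adj k) y \<longleftrightarrow> (k - 1 \<in> y) \<noteq> (k + 1 \<in> y)"
      using odd_on_insert[of "{k + 1}" "k - 1" "\<lambda>j. j \<in> y"] by simp
    have step: "S a \<longleftrightarrow> p k \<noteq> S b"
      if "{k' \<in> ?I. if \<delta> = 1 then k' < a else a < k'} = insert k {k' \<in> ?I. if \<delta> = 1 then k' < b else b < k'}"
        "k \<notin> {k' \<in> ?I. if \<delta> = 1 then k' < b else b < k'}" for a b
      unfolding S_def that(1) using finI that(2) by (intro odd_on_insert) simp
    show ?thesis
    proof (cases "\<delta> = 1")
      case True
      have "S (k + 1) \<longleftrightarrow> p k \<noteq> S (k - 1)"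
      proof (rule step)
        have "k' = k" if "k' mod 2 = 1" "k' < k + 1" "\<not> k' < k - 1" for k'
          using that k1 True by presburger
        then show "{k' \<in> ?I. if \<delta> = 1 then k' < k + 1 else k + 1 < k'} =
            insert k {k' \<in> ?I. if \<delta> = 1 then k' < k - 1 else k - 1 < k'}"
          using True k by (auto simp: V_ind_def)
      qed (use True k1 in auto)
      moreover have "k + 1 \<in> V_ind D (1 - \<delta>)"
      proof -
        have "(k + 1) mod 2 = 0" "k + 1 \<le> D" using k1 D True by presburger+
        then show ?thesis using True by (simp add: V_ind_def)
      qed
      moreover have "k - 1 \<in> y \<longleftrightarrow> S (k - 1)"
      proof (cases "k = 1")
        case True
        then show ?thesis using \<open>\<delta> = 1\<close> by (simp add: y_def V_ind_def S_def)
      next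
        case False
        have "(k - 1) mod 2 = 0" "1 \<le> k - 1" "k - 1 \<le> D" using k1 False \<open>\<delta> = 1\<close> by presburger+
        then show ?thesis using \<open>\<delta> = 1\<close> by (simp add: y_def V_ind_def)
      qed
      ultimately show ?thesis using 1 by (auto simp: y_def)
    next
      case False
      then have d0: "\<delta> = 0" using \<delta> by simp
      have "S (k - 1) \<longleftrightarrow> p k \<noteq> S (k + 1)"
      proof (rule step)
        have "k' = k" if "k' mod 2 = 0" "k - 1 < k'" "\<not> k + 1 < k'" for k'
          using that k1 d0 by presburger
        then show "{k' \<in> ?I. if \<delta> = 1 then k' < k - 1 else k - 1 < k'} =
            insert k {k' \<in> ?I. if \<delta> = 1 then k' < k + 1 else k + 1 < k'}"
          using d0 k k1(1) by (auto simp: V_ind_def simp flip: even_iff_mod_2_eq_zero)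
      qed (use d0 k1 in auto)
      moreover have "k - 1 \<in> V_ind D (1 - \<delta>)"
      proof -
        have "(k - 1) mod 2 = 1" "1 \<le> k - 1" using k1 d0 by presburger+
        then show ?thesis using d0 k1 by (simp add: V_ind_def)
      qed
      moreover have "k + 1 \<in> y \<longleftrightarrow> S (k + 1)"
      proof (cases "k = D")
        case True
        have e: "{k' \<in> ?I. if \<delta> = 1 then k' < k + 1 else k + 1 < k'} = {}"
          using True d0 by (auto simp: V_ind_def)
        have "\<not> S (k + 1)" unfolding S_def e by simp
        then show ?thesis by (simp add: y_def)
      next
        case False
        have "(k + 1) mod 2 = 1" using k1 d0 by presburger
        then show ?thesis using d0 False k1 by (simp add: y_def V_ind_def)
      qed
      ultimately show ?thesis using 1 by (auto simp: y_def)
    qed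
  qed
  have form_p: "form z y \<longleftrightarrow> odd_on p z" if "z \<subseteq> ?I" for z
    unfolding form_def using key that by (intro odd_on_cong refl) blast
  have "V_form y z = 0" if z: "z \<in> L" for z
  proof -
    have zI: "z \<subseteq> ?I" using L(1) z by blast
    then have fz: "finite z" using finI finite_subset by blast
    have "\<not> form z y" using form_p[OF zI] p(1)[OF z] by simp
    then show ?thesis using V_form_eq_0_iff[OF fy fz] form_sym[OF fy fz] by simp
  qed
  then have "y \<in> V_perp D \<delta> L" using y by (simp add: V_perp_def)
  moreover have "form x y" using form_p[OF x(1)] p(2) by simp
  ultimately show ?thesis by blast
qed

lemma V_group_comm_group: "comm_group (V_group D \<delta>)"
proof (rule comm_groupI)
  fix x y z
  show "x \<otimes>\<^bsub>V_group D \<delta>\<^esub> y \<otimes>\<^bsub>V_group D \<delta>\<^esub> z = x \<otimes>\<^bsub>V_group D \<delta>\<^esub> (y \<otimes>\<^bsub>V_group D \<delta>\<^esub> z)"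
    by (auto simp: V_group_def)
  show "\<exists>y\<in>carrier (V_group D \<delta>). y \<otimes>\<^bsub>V_group D \<delta>\<^esub> x = \<one>\<^bsub>V_group D \<delta>\<^esub>" if "x \<in> carrier (V_group D \<delta>)"
    using that by (intro bexI[of _ x]) (auto simp: V_group_def)
qed (auto simp: V_group_def)

definition is_normal_pair :: "('g, 'm) monoid_scheme \<Rightarrow> 'g set \<Rightarrow> 'g set \<Rightarrow> bool" where
  "is_normal_pair G H H' \<longleftrightarrow> subgroup H G \<and> subgroup H' G \<and> H \<lhd> G\<lparr>carrier := H'\<rparr>"

lemma (in comm_group) is_normal_pair_comm:
  assumes H: "subgroup H G" and H': "subgroup H' G" and sub: "H \<subseteq> H'"
  shows "is_normal_pair G H H'"
proof -
  have "comm_group (G\<lparr>carrier := H'\<rparr>)"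
    using subgroup.mem_carrier[OF H'] m_comm
    by (intro group.group_comm_groupI[OF subgroup_imp_group[OF H']]) simp
  then have "H \<lhd> G\<lparr>carrier := H'\<rparr>"
    by (rule comm_group.subgroup_imp_normal) (rule subgroup_incl[OF H H' sub])
  then show ?thesis using H H' by (simp add: is_normal_pair_def)
qed

text \<open>If \<open>x\<close> were in \<open>L\<close> but not in \<open>L'\<close>, some \<open>y\<close> orthogonal to \<open>L'\<close> would not be orthogonal to \<open>x\<close>,
  although \<open>x\<close> and \<open>y\<close> both lie in an isotropic subspace.\<close>

lemma Theta_V_normal_pair:
  assumes \<delta>: "\<delta> \<in> {0, 1}" and LL: "(L, L') \<in> Theta_V D \<delta>"
  shows "is_normal_pair (V_group D \<delta>) L L'"
proof -
  have L: "subgroup L (V_group D \<delta>)" and L': "subgroup L' (V_group D \<delta>)"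
    and F: "F_coll D {sym_diff x y | x y. x \<in> L \<and> y \<in> V_perp D \<delta> L'}"
    using LL by (auto simp: Theta_V_def)
  have facts: "M \<subseteq> Pow (V_ind D \<delta>)" "{} \<in> M" "\<And>y z. y \<in> M \<Longrightarrow> z \<in> M \<Longrightarrow> sym_diff y z \<in> M"
    if "subgroup M (V_group D \<delta>)" for M
    using subgroup.subset[OF that] subgroup.one_closed[OF that] subgroup.m_closed[OF that]
    by (auto simp: V_group_def)
  have "L \<subseteq> L'"
  proof (rule ccontr)
    assume "\<not> L \<subseteq> L'"
    then obtain x where x: "x \<in> L" "x \<notin> L'" by blast
    have "x \<subseteq> V_ind D \<delta>" using facts(1)[OF L] x(1) by blast
    then obtain y where y: "y \<in> V_perp D \<delta> L'" "form x y"
      using V_perp_separates[OF F_coll_isotropic(1)[OF F] \<delta> facts[OF L'] _ x(2)] by blast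
    have 0: "{} \<in> V_perp D \<delta> L'" by (simp add: V_perp_def V_form_def)
    have "sym_diff x {} \<in> {sym_diff x y | x y. x \<in> L \<and> y \<in> V_perp D \<delta> L'}" using x(1) 0 by blast
    moreover have "sym_diff {} y \<in> {sym_diff x y | x y. x \<in> L \<and> y \<in> V_perp D \<delta> L'}"
      using facts(2)[OF L] y(1) by blast
    ultimately show False using F_coll_isotropic(3)[OF F, of x y] y(2) by simp
  qed
  then show ?thesis by (rule comm_group.is_normal_pair_comm[OF V_group_comm_group L L'])
qed

lemma is_normal_pair_iso_image:
  assumes G: "group G" and G': "group G'" and h: "h \<in> iso G G'" and HH: "is_normal_pair G H H'"
  shows "is_normal_pair G' (h ` H) (h ` H')"
proof -
  have H: "subgroup H G" and H': "subgroup H' G" and n: "H \<lhd> G\<lparr>carrier := H'\<rparr>"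
    using HH by (auto simp: is_normal_pair_def)
  interpret group_hom G G' h
    using G G' h by (intro group_hom.intro group_hom_axioms.intro) (auto simp: iso_def)
  have sub: "H \<subseteq> H'" using subgroup.subset[OF normal_imp_subgroup[OF n]] by simp
  have conj: "a \<otimes>\<^bsub>G\<^esub> b \<otimes>\<^bsub>G\<^esub> inv\<^bsub>G\<^esub> a \<in> H" if "a \<in> H'" "b \<in> H" for a b
    using normal.inv_op_closed2[OF n, of a b] G.m_inv_consistent[OF H'] that by simp
  note hH = subgroup_img_is_subgroup[OF H] and hH' = subgroup_img_is_subgroup[OF H']
  have "h ` H \<lhd> G'\<lparr>carrier := h ` H'\<rparr>"
    unfolding group.normal_inv_iff[OF H.subgroup_imp_group[OF hH']]
  proof (intro conjI ballI)
    show "subgroup (h ` H) (G'\<lparr>carrier := h ` H'\<rparr>)"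
      by (rule H.subgroup_incl[OF hH hH']) (use sub in blast)
    fix x y assume "x \<in> carrier (G'\<lparr>carrier := h ` H'\<rparr>)" "y \<in> h ` H"
    then obtain a b where ab: "a \<in> H'" "x = h a" "b \<in> H" "y = h b" by auto
    then have c: "a \<in> carrier G" "b \<in> carrier G"
      using subgroup.mem_carrier[OF H] subgroup.mem_carrier[OF H'] by auto
    have "inv\<^bsub>G'\<lparr>carrier := h ` H'\<rparr>\<^esub> x = inv\<^bsub>G'\<^esub> x"
      using H.m_inv_consistent[OF hH'] ab by blast
    then have "x \<otimes>\<^bsub>G'\<lparr>carrier := h ` H'\<rparr>\<^esub> y \<otimes>\<^bsub>G'\<lparr>carrier := h ` H'\<rparr>\<^esub> inv\<^bsub>G'\<lparr>carrier := h ` H'\<rparr>\<^esub> x =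
        h (a \<otimes>\<^bsub>G\<^esub> b \<otimes>\<^bsub>G\<^esub> inv\<^bsub>G\<^esub> a)"
      using ab c by simp
    then show "x \<otimes>\<^bsub>G'\<lparr>carrier := h ` H'\<rparr>\<^esub> y \<otimes>\<^bsub>G'\<lparr>carrier := h ` H'\<rparr>\<^esub> inv\<^bsub>G'\<lparr>carrier := h ` H'\<rparr>\<^esub> x \<in> h ` H"
      using conj[OF ab(1,3)] by simp
  qed
  then show ?thesis using hH hH' by (simp add: is_normal_pair_def)
qed

lemma (in group) conjugates_subgroup:
  assumes H: "subgroup H G" and K: "K \<in> conjugates G H"
  shows "subgroup K G"
proof -
  obtain g where g: "g \<in> carrier G" "K = (\<lambda>h. g \<otimes> h \<otimes> inv g) ` H"
    using K by (auto simp: conjugates_def)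
  have "group_hom G G (\<lambda>h. g \<otimes> h \<otimes> inv g)"
  proof (intro group_hom.intro group_hom_axioms.intro is_group homI)
    fix x y assume xy: "x \<in> carrier G" "y \<in> carrier G"
    show "g \<otimes> x \<otimes> inv g \<in> carrier G" using g(1) xy by simp
    show "g \<otimes> (x \<otimes> y) \<otimes> inv g = g \<otimes> x \<otimes> inv g \<otimes> (g \<otimes> y \<otimes> inv g)"
      using conj_mult[of "inv g" x y] g(1) xy by simp
  qed
  then show ?thesis using group_hom.subgroup_img_is_subgroup[OF _ H] g(2) by blast
qed

lemma sym_group_subgroupI:
  assumes "\<And>p. p \<in> P \<Longrightarrow> p permutes {1..n}" "id \<in> P"
    and "\<And>p. p \<in> P \<Longrightarrow> inv' p \<in> P" "\<And>p q. p \<in> P \<Longrightarrow> q \<in> P \<Longrightarrow> p \<circ> q \<in> P"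
  shows "subgroup P (sym_group n)"
proof (rule group.subgroupI[OF sym_group_is_group])
  show "P \<subseteq> carrier (sym_group n)" using assms(1) by (auto simp: sym_group_carrier)
  show "inv\<^bsub>sym_group n\<^esub> p \<in> P" if "p \<in> P" for p
    using assms(1,3)[OF that] by (simp add: sym_group_carrier)
qed (use assms in \<open>auto simp: sym_group_mult\<close>)

lemma row_stab_subgroup: "subgroup (row_stab n \<xi>) (sym_group n)"
proof (rule sym_group_subgroupI)
  show "p permutes {1..n}" if "p \<in> row_stab n \<xi>" for p using that by (simp add: row_stab_def)
  show "id \<in> row_stab n \<xi>" by (simp add: row_stab_def permutes_id)
  show "inv' p \<in> row_stab n \<xi>" if "p \<in> row_stab n \<xi>" for p
  proof -
    have p: "p permutes {1..n}" and st: "\<And>i. i \<in> {1..n} \<Longrightarrow> fst (box \<xi> (p i - 1)) = fst (box \<xi> (i - 1))"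
      using that by (auto simp: row_stab_def)
    have "fst (box \<xi> (inv' p i - 1)) = fst (box \<xi> (i - 1))" if "i \<in> {1..n}" for i
      using st[of "inv' p i"] permutes_in_image[OF permutes_inv[OF p], of i] that permutes_inverses(1)[OF p]
      by simp
    then show ?thesis using permutes_inv[OF p] by (simp add: row_stab_def)
  qed
  show "p \<circ> q \<in> row_stab n \<xi>" if "p \<in> row_stab n \<xi>" "q \<in> row_stab n \<xi>" for p q
  proof -
    have p: "p permutes {1..n}" "\<And>i. i \<in> {1..n} \<Longrightarrow> fst (box \<xi> (p i - 1)) = fst (box \<xi> (i - 1))"
      and q: "q permutes {1..n}" "\<And>i. i \<in> {1..n} \<Longrightarrow> fst (box \<xi> (q i - 1)) = fst (box \<xi> (i - 1))"
      using that by (auto simp: row_stab_def)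
    have "fst (box \<xi> ((p \<circ> q) i - 1)) = fst (box \<xi> (i - 1))" if "i \<in> {1..n}" for i
      using p(2)[of "q i"] q(2)[OF that] permutes_in_image[OF q(1), of i] that by simp
    then show ?thesis using permutes_compose[OF q(1) p(1)] by (simp add: row_stab_def)
  qed
qed

text \<open>The commutation with \<open>t\<close> is only required on \<open>{1..4}\<close>; it passes to products because fixing
  the larger points makes \<open>{1..4}\<close> stable.\<close>

lemma commutant_subgroup:
  "subgroup {p. p permutes {1..n} \<and> (\<forall>i>4. p i = i) \<and> (\<forall>i\<in>{1..4}. p (t i) = t (p i))} (sym_group n)"
    (is "subgroup ?P _")
proof (rule sym_group_subgroupI)
  have range: "p i \<in> {1..4}" if p: "p permutes {1..n}" "\<And>i. i > 4 \<Longrightarrow> p i = i" and i: "i \<in> {1..4}"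
    for p :: "nat \<Rightarrow> nat" and i
  proof -
    have "\<not> p i > 4" using p(2)[of "p i"] i inj_eq[OF permutes_inj[OF p(1)], of "p i" i] by auto
    moreover have "p i \<noteq> 0"
    proof
      assume "p i = 0"
      moreover have "p 0 = 0" using p(1) by (simp add: permutes_not_in)
      ultimately have "i = 0" using inj_eq[OF permutes_inj[OF p(1)], of i 0] by simp
      then show False using i by simp
    qed
    ultimately show ?thesis by simp
  qed
  show "p permutes {1..n}" if "p \<in> ?P" for p using that by simp
  show "id \<in> ?P" by (simp add: permutes_id)
  show "inv' p \<in> ?P" if "p \<in> ?P" for p
  proof -
    have p: "p permutes {1..n}" "\<And>i. i > 4 \<Longrightarrow> p i = i" "\<And>i. i \<in> {1..4} \<Longrightarrow> p (t i) = t (p i)"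
      using that by auto
    note ip = permutes_inv[OF p(1)] and pi = permutes_inverses[OF p(1)]
    have f: "inv' p i = i" if "i > 4" for i using p(2)[OF that] pi(2)[of i] by simp
    have "inv' p (t i) = t (inv' p i)" if i: "i \<in> {1..4}" for i
      using p(3)[OF range[OF ip f i]] pi(1)[of i] pi(2)[of "t (inv' p i)"] by simp
    then show ?thesis using ip f by simp
  qed
  show "p \<circ> q \<in> ?P" if "p \<in> ?P" "q \<in> ?P" for p q
  proof -
    have p: "p permutes {1..n}" "\<And>i. i > 4 \<Longrightarrow> p i = i" "\<And>i. i \<in> {1..4} \<Longrightarrow> p (t i) = t (p i)"
      and q: "q permutes {1..n}" "\<And>i. i > 4 \<Longrightarrow> q i = i" "\<And>i. i \<in> {1..4} \<Longrightarrow> q (t i) = t (q i)"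
      using that by auto
    show ?thesis
      using permutes_compose[OF q(1) p(1)] p(2,3) q(2,3) range[OF q(1,2)] by simp
  qed
qed

lemma F_hat_subgroup:
  assumes "H \<in> F_hat N"
  shows "subgroup H (sym_group N)"
proof -
  interpret S: group "sym_group N" by (rule sym_group_is_group)
  consider "H = {id}" | "H = carrier (sym_group N)"
    | \<xi> where "H \<in> young_subgroups N \<xi>" | "H \<in> dihedral_subgroups N"
    using assms by (auto simp: F_hat_def)
  then show ?thesis
  proof cases
    case 1
    then show ?thesis using S.triv_subgroup by (simp add: sym_group_one)
  next
    case 2
    then show ?thesis using S.subgroup_self by simp
  next
    case 3
    then show ?thesis using S.conjugates_subgroup[OF row_stab_subgroup] by (simp add: young_subgroups_def)
  next
    case 4
    then show ?thesis using S.conjugates_subgroup[OF commutant_subgroup]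
      by (auto simp: dihedral_subgroups_def split: if_splits)
  qed
qed

lemma Theta_exc_normal_pair:
  assumes "(H, H') \<in> Theta_exc c N"
  shows "is_normal_pair (sym_group N) H H'"
  using assms F_hat_subgroup by (auto simp: Theta_exc_def is_normal_pair_def)

lemma trivial_normal_pair: "is_normal_pair (sym_group 1) {id} {id}"
proof -
  interpret S: group "sym_group 1" by (rule sym_group_is_group)
  have s: "subgroup {id} (sym_group 1)" using S.triv_subgroup by (simp add: sym_group_one)
  interpret T: group "(sym_group 1)\<lparr>carrier := {id}\<rparr>" by (rule S.subgroup_imp_group[OF s])
  have "{id} \<lhd> (sym_group 1)\<lparr>carrier := {id}\<rparr>"
    using T.subgroup_self by (intro comm_group.subgroup_imp_normal T.group_comm_groupI) auto
  then show ?thesis using s by (simp add: is_normal_pair_def)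
qed

lemma transported_normal_pairs:
  assumes "group G0" "group \<Gamma>" "transported G0 c j \<Theta>0 \<Gamma> \<iota> \<Theta>"
    and "\<And>H H'. (H, H') \<in> \<Theta>0 \<Longrightarrow> is_normal_pair G0 H H'" and "(H, H') \<in> \<Theta>"
  shows "is_normal_pair \<Gamma> H H'"
  using assms is_normal_pair_iso_image[OF assms(1,2)] unfolding transported_def by fast

lemma family_group_normal_pairs:
  assumes G: "group \<Gamma>" and fam: "family_group r a c \<Gamma> \<iota> \<Theta>" and HH: "(H, H') \<in> \<Theta>"
  shows "is_normal_pair \<Gamma> H H'"
proof -
  note tr = transported_normal_pairs[OF _ G _ _ HH]
  consider "transported (sym_group 1) c (\<lambda>_. (id, triv_rep)) {({id}, {id})} \<Gamma> \<iota> \<Theta>"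
    | D \<delta> y where "\<delta> \<in> {0, 1}"
        "transported (V_group D \<delta>) c (\<lambda>E. V_pair D \<delta> (y E)) (Theta_V D \<delta>) \<Gamma> \<iota> \<Theta>"
    | N j where "transported (sym_group N) c j (Theta_exc (card c) N) \<Gamma> \<iota> \<Theta>"
    using fam unfolding family_group_def by blast
  then show ?thesis
  proof cases
    case 1
    then show ?thesis by (rule tr[OF sym_group_is_group]) (use trivial_normal_pair in simp)
  next
    case 2
    show ?thesis
      by (rule tr[OF comm_group.axioms(2)[OF V_group_comm_group] 2(2)]) (rule Theta_V_normal_pair[OF 2(1)])
  next
    case 3
    then show ?thesis by (rule tr[OF sym_group_is_group]) (rule Theta_exc_normal_pair)
  qed
qed

section \<open>Bipositivity of new representations\<close>

theorem theorem0p7: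
  fixes \<Gamma> :: "('g, 'm) monoid_scheme"
  assumes "group \<Gamma>" and "finite (carrier \<Gamma>)"
  shows "(\<forall>H H'. subgroup H \<Gamma> \<and> subgroup H' \<Gamma> \<and> H \<lhd> \<Gamma>\<lparr>carrier := H'\<rparr> \<longrightarrow>
            bipositive \<Gamma> (S_elt \<Gamma> H H')) \<and>
         (\<forall>r a c \<iota> \<Theta> \<E>.
            irreducible_cartan r a \<and>
            c \<in> families (weyl_group r a) (simple_reflections r a) \<and>
            family_group r a c \<Gamma> \<iota> \<Theta> \<and>
            new_rep (weyl_group r a) c \<Gamma> \<iota> \<Theta> \<E> \<longrightarrow>
            bipositive \<Gamma> (underline (weyl_group r a) c \<iota> \<E>))"
proof -
  have S: "bipositive \<Gamma> (S_elt \<Gamma> H H')" if "is_normal_pair \<Gamma> H H'" for H H'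
  proof -
    interpret normal_pair \<Gamma> H H'
      using assms that
      by (intro normal_pair.intro fin_group.intro fin_group_axioms.intro normal_pair_axioms.intro)
        (auto simp: is_normal_pair_def)
    show ?thesis by (rule bipositive_S_elt)
  qed
  have "bipositive \<Gamma> (underline (weyl_group r a) c \<iota> \<E>)"
    if fam: "family_group r a c \<Gamma> \<iota> \<Theta>" and new: "new_rep (weyl_group r a) c \<Gamma> \<iota> \<Theta> \<E>" for r a c \<iota> \<Theta> \<E>
  proof -
    obtain H H' where "(H, H') \<in> \<Theta>" "underline (weyl_group r a) c \<iota> \<E> = S_elt \<Gamma> H H'"
      using new by (auto simp: new_rep_def)
    then show ?thesis using S[OF family_group_normal_pairs[OF assms(1) fam]] by simp
  qed
  then show ?thesis using S by (auto simp: is_normal_pair_def)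
qed

end
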